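(* Under Assumptions (A1) and (A2) of the context, there is an $\mathbb R^3$-valued function $s\in L^\infty(S_v\times\Omega\times Y)$ with $\partial_ts,\ D_ys\in L^\infty(S_v\times\Omega\times Y)$ such that $Ds_\varepsilon$ strongly two-scale converges to $D_ys$, i.e. $[Ds_\varepsilon]^\varepsilon\to D_ys$ in $L^2(S_v\times\Omega\times Y)$ as $\varepsilon\to0$.
   Context: Geometry. $S=(0,T)$ with $T>0$; $\Omega\subset\mathbb R^3$ is a bounded Lipschitz domain; $\varepsilon$ runs through a decreasing sequence $(\varepsilon_n)$ of positive numbers converging to $0$. $Y=(0,1)^3$; $Y^{(1)},Y^{(2)}\subset Y$ are open and disjoint, $Y^{(1)}$ connected, $\overline{Y^{(2)}}\subset Y$, $Y=Y^{(1)}\cup\overline{Y^{(2)}}$, and $\Gamma:=\partial Y^{(2)}$ is a $C^3$-hypersurface with normal $n_\Gamma$ pointing out of $Y^{(2)}$. With $Z_\varepsilon=\{k\in\mathbb Z^3:\varepsilon(Y+k)\subset\Omega\}$ set $\Omega^{(2)}_\varepsilon=\bigcup_{k\in Z_\varepsilon}\varepsilon(Y^{(2)}+k)$, $\Omega^{(1)}_\varepsilon=\Omega\setminus\overline{\Omega^{(2)}_\varepsilon}$, $\Gamma_\varepsilon=\partial\Omega^{(2)}_\varepsilon$, with normal $n_{\Gamma_\varepsilon}$ pointing out of $\Omega^{(2)}_\varepsilon$. The number $a>0$ is the width of a tubular neighbourhood of $\Gamma$: $\Lambda(\gamma,s)=\gamma+sn_\Gamma(\gamma)$ is a $C^2$-diffeomorphism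 from $\Gamma\times(-a,a)$ onto $U_\Gamma\subset Y$. Correspondingly $\Lambda_\varepsilon(\gamma,r)=\gamma+rn_{\Gamma_\varepsilon}(\gamma)$ is a $C^2$-diffeomorphism from $\Gamma_\varepsilon\times(-\varepsilon a,\varepsilon a)$ onto the tube $U_{\Gamma_\varepsilon}$, and $P_{\Gamma_\varepsilon}\colon U_{\Gamma_\varepsilon}\to\Gamma_\varepsilon$ is the projection. The Weingarten map $L_{\Gamma_\varepsilon}=-\nabla_{\Gamma_\varepsilon}n_{\Gamma_\varepsilon}$ satisfies $\sup_{\Gamma_\varepsilon}|L_{\Gamma_\varepsilon}|\le\frac1{2\varepsilon a}$. $W^{(k,l),\infty}(S\times\Omega)$ is the set of $u\in L^\infty(S\times\Omega)$ with $\partial_t^iu,D_x^ju\in L^\infty(S\times\Omega)$ for $1\le i\le k$, $1\le j\le l$. Unfolding. $[x]$ is the unique $k\in\mathbb Z^3$ with $x-k\in[0,1)^3$. For $f$ on $S_v\times\Omega$, $[f]^\varepsilon(t,x,y)=f(t,\varepsilon y+\varepsilon[x/\varepsilon])$ for $(t,x,y)\in S_v\times\Omega\times Y$ (set to $0$ if the cell $\varepsilon([x/\varepsilon]+Y)$ is not contained in $\Omega$). Assumption (A1): $v_\varepsilon\in W^{(1,3),\infty}(S\times\Omega)$ is real-valued, $\mathrm{supp}(v_\varepsilon)\subset U_{\Gamma_\varepsilon}$, and $l_v:=\sup_{\varepsilon}\big(\|v_\varepsilon\|_{W^{1,\infty}(S\times\Omega)}+\varepsilon\|D_x^2v_\varepsilon\|_\infty+\varepsilon^2\|D^3_xv_\varepsilon\|_\infty\big)<\infty$.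 Motion problem (normal velocity $\varepsilon v_\varepsilon$). On a time interval $[0,\tau]$, a family $(\Gamma_\varepsilon(t))_t$ is a solution of the motion problem if $\Gamma_\varepsilon(t)=\{x\in\Omega:\varphi_\varepsilon(t,x)=0\}$ for some $C^1$ function $\varphi_\varepsilon$ on $(0,\tau)\times\Omega$ (extending continuously to $t=0$) such that, with $\Xi_\varepsilon=\bigcup_t\{t\}\times\Gamma_\varepsilon(t)$: $\partial_t\varphi_\varepsilon=\varepsilon|\nabla\varphi_\varepsilon|v_\varepsilon$ and $|\nabla\varphi_\varepsilon|>0$ on $\Xi_\varepsilon$; the function $(\partial_t\varphi_\varepsilon-\varepsilon|\nabla\varphi_\varepsilon|v_\varepsilon)/\varphi_\varepsilon$ defined off $\Xi_\varepsilon$ extends to a function in $W^{(0,1),\infty}((0,\tau)\times\Omega)$; $\Gamma_\varepsilon=\{\varphi_\varepsilon(0,\cdot)=0\}$ and $\Omega_\varepsilon^{(1)}=\{\varphi_\varepsilon(0,\cdot)<0\}$. The evolved domains are $\Omega_\varepsilon^{(1)}(t)=\{\varphi_\varepsilon(t,\cdot)<0\}$, $\Omega_\varepsilon^{(2)}(t)=\{\varphi_\varepsilon(t,\cdot)>0\}$. Time $T_v$ and motion function $s_\varepsilon$. Under (A1) there is $T_v\in(0,T]$, depending on $l_v$ but not on $\varepsilon$, such that the motion problem has a unique solution on $[0,T_v]$, and $\Gamma_\varepsilon(t)=\{\gamma+h_\varepsilon(t,\gamma)n_{\Gamma_\varepsilon}(\gamma):\gamma\in\Gamma_\varepsilon\}$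 with a height function $h_\varepsilon\colon[0,T_v]\times\Gamma_\varepsilon\to(-\varepsilon a,\varepsilon a)$ satisfying $\frac5{\varepsilon a}\|h_\varepsilon\|_\infty+2\|\nabla_{\Gamma_\varepsilon}h_\varepsilon\|_\infty\le\frac12$. Fix $T_v$ and set $S_v=(0,T_v)$. Let $\chi\colon[0,\infty)\to[0,1]$ be smooth with $\chi(r)=1$ for $r<\frac13$, $\chi(r)=0$ for $r>\frac23$, $\chi'<0$ on $(\frac13,\frac23)$, $\|\chi'\|_\infty\le4$. Then $$s_\varepsilon(t,x)=x+h_\varepsilon(t,P_{\Gamma_\varepsilon}(x))\,n_{\Gamma_\varepsilon}(P_{\Gamma_\varepsilon}(x))\,\chi\Big(\frac{\mathrm{dist}(x,\Gamma_\varepsilon)}{\varepsilon a}\Big)\ (x\in U_{\Gamma_\varepsilon}),\qquad s_\varepsilon(t,x)=x\ (x\notin U_{\Gamma_\varepsilon}).$$ $D$ denotes the derivative in $x$. Assumption (A2): with $Q^{(i)}_\varepsilon=\bigcup_{t\in S_v}\{t\}\times\Omega_\varepsilon^{(i)}(t)$, $f^{(i)}_\varepsilon\in L^2(Q^{(i)}_\varepsilon)$ (heat source densities) and $\vartheta^{(i)}_\varepsilon\in L^2(\Omega^{(i)}_\varepsilon)$ (initial temperatures) satisfy $\sup_\varepsilon\big(\|f^{(i)}_\varepsilon\|_{L^2(Q^{(i)}_\varepsilon)}+\|\vartheta^{(i)}_\varepsilon\|_{L^2(\Omega^{(i)}_\varepsilon)}\big)<\infty$ for $i=1,2$. *)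

theory Defs
  imports "HOL-Probability.Essential_Supremum"
begin

section \<open>Classical differentiability\<close>

text \<open>
  \<open>Ck_on k S f\<close> is meant for open \<open>S\<close>; \<open>Ck_map\<close> is the notion for arbitrary subsets of a
  Euclidean space (local extendability), which for embedded submanifolds is the usual one.
\<close>

fun Ck_on :: "nat \<Rightarrow> 'a::euclidean_space set \<Rightarrow> ('a \<Rightarrow> 'b::real_normed_vector) \<Rightarrow> bool" where
  "Ck_on 0 S f \<longleftrightarrow> continuous_on S f"
| "Ck_on (Suc k) S f \<longleftrightarrow> (\<forall>x\<in>S. f differentiable (at x)) \<and>
     (\<forall>b\<in>Basis. Ck_on k S (\<lambda>x. frechet_derivative f (at x) b))"

definition Ck_map :: "nat \<Rightarrow> 'a::euclidean_space set \<Rightarrow> ('a \<Rightarrow> 'b::real_normed_vector) \<Rightarrow> bool" where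
  "Ck_map k S f \<longleftrightarrow>
     (\<forall>x\<in>S. \<exists>V g. open V \<and> x \<in> V \<and> Ck_on k V g \<and> (\<forall>y\<in>S \<inter> V. g y = f y))"

definition Ck_diffeo ::
  "nat \<Rightarrow> 'a::euclidean_space set \<Rightarrow> 'b::euclidean_space set \<Rightarrow> ('a \<Rightarrow> 'b) \<Rightarrow> bool" where
  "Ck_diffeo k S U f \<longleftrightarrow> bij_betw f S U \<and> Ck_map k S f \<and> Ck_map k U (inv_into S f)"

definition grad :: "('a::real_inner \<Rightarrow> real) \<Rightarrow> 'a \<Rightarrow> 'a" where
  "grad f x = (THE D. GDERIV f x :> D)"

section \<open>Essentially bounded functions, weak derivatives, square-integrable functions\<close>

definition Linf_norm :: "'a::euclidean_space set \<Rightarrow> ('a \<Rightarrow> 'b::euclidean_space) \<Rightarrow> ennreal" where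
  "Linf_norm D f = esssup (lebesgue_on D) (\<lambda>z. ennreal (norm (f z)))"

definition in_Linf :: "'a::euclidean_space set \<Rightarrow> ('a \<Rightarrow> 'b::euclidean_space) \<Rightarrow> bool" where
  "in_Linf D f \<longleftrightarrow> f \<in> borel_measurable (lebesgue_on D) \<and> Linf_norm D f < \<infinity>"

definition in_L1_loc :: "'a::euclidean_space set \<Rightarrow> ('a \<Rightarrow> 'b::euclidean_space) \<Rightarrow> bool" where
  "in_L1_loc D f \<longleftrightarrow> (\<forall>K. compact K \<and> K \<subseteq> D \<longrightarrow> integrable (lebesgue_on K) f)"

definition test_function :: "'a::euclidean_space set \<Rightarrow> ('a \<Rightarrow> real) \<Rightarrow> bool" where
  "test_function D \<zeta> \<longleftrightarrow> (\<forall>k. Ck_on k UNIV \<zeta>) \<and>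
     compact (closure {z. \<zeta> z \<noteq> 0}) \<and> closure {z. \<zeta> z \<noteq> 0} \<subseteq> D"

primrec iter_deriv :: "'a list \<Rightarrow> ('a::euclidean_space \<Rightarrow> real) \<Rightarrow> 'a \<Rightarrow> real" where
  "iter_deriv [] f = f"
| "iter_deriv (b # bs) f = (\<lambda>z. frechet_derivative (iter_deriv bs f) (at z) b)"

text \<open>\<open>g\<close> is the weak derivative of \<open>f\<close> on the open set \<open>D\<close> in the listed directions.\<close>

definition weak_deriv :: "'a::euclidean_space set \<Rightarrow> 'a list \<Rightarrow>
    ('a \<Rightarrow> 'b::euclidean_space) \<Rightarrow> ('a \<Rightarrow> 'b) \<Rightarrow> bool" where
  "weak_deriv D bs f g \<longleftrightarrow> in_L1_loc D f \<and> in_L1_loc D g \<and>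
     (\<forall>\<zeta>. test_function D \<zeta> \<longrightarrow>
        (\<integral>z. iter_deriv bs \<zeta> z *\<^sub>R f z \<partial>lebesgue_on D) =
        (- 1) ^ length bs *\<^sub>R (\<integral>z. \<zeta> z *\<^sub>R g z \<partial>lebesgue_on D))"

text \<open>A version of the weak derivative; it is determined up to null sets.\<close>

definition wderiv :: "'a::euclidean_space set \<Rightarrow> 'a list \<Rightarrow> ('a \<Rightarrow> 'b::euclidean_space) \<Rightarrow> 'a \<Rightarrow> 'b" where
  "wderiv D bs f = (SOME g. weak_deriv D bs f g)"

text \<open>Index lists of the \<open>j\<close>-th order space derivatives on space-time.\<close>

definition space_dirs :: "nat \<Rightarrow> (real \<times> (real^3)) list set" where
  "space_dirs j = {bs. length bs = j \<and> set bs \<subseteq> {(0, axis i 1) | i. True}}"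

definition in_W_inf :: "nat \<Rightarrow> nat \<Rightarrow> (real \<times> (real^3)) set \<Rightarrow> (real \<times> (real^3) \<Rightarrow> real) \<Rightarrow> bool" where
  "in_W_inf k l D u \<longleftrightarrow> in_Linf D u \<and>
     (\<forall>i\<in>{1..k}. \<exists>g. weak_deriv D (replicate i (1, 0)) u g \<and> in_Linf D g) \<and>
     (\<forall>j\<in>{1..l}. \<forall>bs\<in>space_dirs j. \<exists>g. weak_deriv D bs u g \<and> in_Linf D g)"

definition Dx_norm :: "(real \<times> (real^3)) set \<Rightarrow> nat \<Rightarrow> (real \<times> (real^3) \<Rightarrow> real) \<Rightarrow> ennreal" where
  "Dx_norm D j u = Linf_norm D (\<lambda>z. sqrt (\<Sum>bs\<in>space_dirs j. (wderiv D bs u z)\<^sup>2))"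

definition W1_inf_norm :: "(real \<times> (real^3)) set \<Rightarrow> (real \<times> (real^3) \<Rightarrow> real) \<Rightarrow> ennreal" where
  "W1_inf_norm D u = Linf_norm D u + Linf_norm D (wderiv D [(1, 0)] u) + Dx_norm D 1 u"

definition in_L2 :: "'a::euclidean_space set \<Rightarrow> ('a \<Rightarrow> 'b::euclidean_space) \<Rightarrow> bool" where
  "in_L2 D f \<longleftrightarrow> f \<in> borel_measurable (lebesgue_on D) \<and>
     integrable (lebesgue_on D) (\<lambda>z. (norm (f z))\<^sup>2)"

definition L2_norm :: "'a::euclidean_space set \<Rightarrow> ('a \<Rightarrow> 'b::euclidean_space) \<Rightarrow> real" where
  "L2_norm D f = sqrt (\<integral>z. (norm (f z))\<^sup>2 \<partial>lebesgue_on D)"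

definition L2_tendsto ::
  "'a::euclidean_space set \<Rightarrow> (nat \<Rightarrow> 'a \<Rightarrow> 'b::euclidean_space) \<Rightarrow> ('a \<Rightarrow> 'b) \<Rightarrow> bool" where
  "L2_tendsto D F f \<longleftrightarrow> (\<forall>n. in_L2 D (F n)) \<and> in_L2 D f \<and>
     (\<lambda>n. L2_norm D (\<lambda>z. F n z - f z)) \<longlonglongrightarrow> 0"

section \<open>Domains and hypersurfaces bounding an open set\<close>

definition lipschitz_domain :: "(real^3) set \<Rightarrow> bool" where
  "lipschitz_domain A \<longleftrightarrow> open A \<and> connected A \<and> A \<noteq> {} \<and>
     (\<forall>p\<in>frontier A. \<exists>e r C g. norm e = 1 \<and> 0 < r \<and> C-lipschitz_on UNIV g \<and>
        (\<forall>x\<in>ball p r. x \<in> A \<longleftrightarrow> g (x - (x \<bullet> e) *\<^sub>R e) < x \<bullet> e))"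

definition defining_function ::
  "nat \<Rightarrow> (real^3) set \<Rightarrow> (real^3) set \<Rightarrow> (real^3 \<Rightarrow> real) \<Rightarrow> bool" where
  "defining_function k A V \<psi> \<longleftrightarrow> open V \<and> Ck_on k V \<psi> \<and> (\<forall>y\<in>V. grad \<psi> y \<noteq> 0) \<and>
     A \<inter> V = {y\<in>V. \<psi> y < 0} \<and> frontier A \<inter> V = {y\<in>V. \<psi> y = 0}"

text \<open>\<open>frontier A\<close> is a \<open>C\<^sup>k\<close>-hypersurface possessing a normal that points out of \<open>A\<close>.\<close>

definition Ck_boundary :: "nat \<Rightarrow> (real^3) set \<Rightarrow> bool" where
  "Ck_boundary k A \<longleftrightarrow> (\<forall>x\<in>frontier A. \<exists>V \<psi>. x \<in> V \<and> defining_function k A V \<psi>)"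

definition outer_normal :: "(real^3) set \<Rightarrow> real^3 \<Rightarrow> real^3" where
  "outer_normal A x =
     (THE \<nu>. \<exists>V \<psi>. x \<in> V \<and> defining_function 1 A V \<psi> \<and> \<nu> = grad \<psi> x /\<^sub>R norm (grad \<psi> x))"

text \<open>
  Derivative along the surface \<open>frontier A\<close>, extended to the ambient space by 0 in normal
  direction. For scalar \<open>f\<close> its operator norm is the length of the surface gradient.
\<close>

definition surface_deriv ::
  "(real^3) set \<Rightarrow> (real^3 \<Rightarrow> 'b::real_normed_vector) \<Rightarrow> real^3 \<Rightarrow> real^3 \<Rightarrow> 'b" where
  "surface_deriv A f x =
     (THE L. (f has_derivative L) (at x within frontier A) \<and> L (outer_normal A x) = 0)"

definition weingarten :: "(real^3) set \<Rightarrow> real^3 \<Rightarrow> real^3 \<Rightarrow> real^3" where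
  "weingarten A x w = - surface_deriv A (outer_normal A) x w"

definition tube_map :: "(real^3) set \<Rightarrow> (real^3) \<times> real \<Rightarrow> real^3" where
  "tube_map A = (\<lambda>(\<gamma>, r). \<gamma> + r *\<^sub>R outer_normal A \<gamma>)"

definition tube :: "(real^3) set \<Rightarrow> real \<Rightarrow> (real^3) set" where
  "tube A w = tube_map A ` (frontier A \<times> {-w<..<w})"

definition tube_proj :: "(real^3) set \<Rightarrow> real \<Rightarrow> real^3 \<Rightarrow> real^3" where
  "tube_proj A w x = (THE \<gamma>. \<gamma> \<in> frontier A \<and> (\<exists>r\<in>{-w<..<w}. x = tube_map A (\<gamma>, r)))"

section \<open>The periodic geometry\<close>

definition unit_cell :: "(real^3) set" where
  "unit_cell = {y. \<forall>i. 0 < y $ i \<and> y $ i < 1}"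

definition scaled_cell :: "real \<Rightarrow> (real^3) set \<Rightarrow> real^3 \<Rightarrow> (real^3) set" where
  "scaled_cell \<epsilon> A k = (\<lambda>y. \<epsilon> *\<^sub>R (y + k)) ` A"

definition inclusions :: "real \<Rightarrow> (real^3) set \<Rightarrow> (real^3) set \<Rightarrow> (real^3) set" where
  "inclusions \<epsilon> \<Omega> Y2 =
     (\<Union>k\<in>{k. (\<forall>i. k $ i \<in> \<int>) \<and> scaled_cell \<epsilon> unit_cell k \<subseteq> \<Omega>}. scaled_cell \<epsilon> Y2 k)"

definition matrix_part :: "real \<Rightarrow> (real^3) set \<Rightarrow> (real^3) set \<Rightarrow> (real^3) set" where
  "matrix_part \<epsilon> \<Omega> Y2 = \<Omega> - closure (inclusions \<epsilon> \<Omega> Y2)"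

text \<open>Conditions on the reference cell, including the tubular neighbourhood of width \<open>a\<close>.\<close>

definition cell_geometry :: "(real^3) set \<Rightarrow> (real^3) set \<Rightarrow> real \<Rightarrow> bool" where
  "cell_geometry Y1 Y2 a \<longleftrightarrow>
     open Y1 \<and> open Y2 \<and> Y1 \<subseteq> unit_cell \<and> Y2 \<subseteq> unit_cell \<and> Y1 \<inter> Y2 = {} \<and> connected Y1 \<and>
     closure Y2 \<subseteq> unit_cell \<and> unit_cell = Y1 \<union> closure Y2 \<and>
     Ck_boundary 3 Y2 \<and> 0 < a \<and>
     Ck_diffeo 2 (frontier Y2 \<times> {-a<..<a}) (tube Y2 a) (tube_map Y2) \<and> tube Y2 a \<subseteq> unit_cell"

definition cell_index :: "real^3 \<Rightarrow> real^3" where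
  "cell_index x = (\<chi> i. of_int \<lfloor>x $ i\<rfloor>)"

definition unfolding_op :: "real \<Rightarrow> (real^3) set \<Rightarrow> (real \<times> (real^3) \<Rightarrow> 'b::real_vector) \<Rightarrow>
    real \<times> (real^3) \<times> (real^3) \<Rightarrow> 'b" where
  "unfolding_op \<epsilon> \<Omega> f = (\<lambda>(t, x, y).
     if scaled_cell \<epsilon> unit_cell (cell_index (x /\<^sub>R \<epsilon>)) \<subseteq> \<Omega>
     then f (t, \<epsilon> *\<^sub>R y + \<epsilon> *\<^sub>R cell_index (x /\<^sub>R \<epsilon>)) else 0)"

section \<open>The motion problem and the motion function\<close>

text \<open>
  \<open>motion_levelset \<epsilon> \<Omega> A v \<tau> \<phi>\<close>: the zero sets of \<open>\<phi>(t,\<cdot>)\<close>, \<open>0 \<le> t < \<tau>\<close>, solve the motion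
  problem with normal velocity \<open>\<epsilon> v\<close> and initial surface \<open>frontier A\<close>, where the complement
  of \<open>closure A\<close> in \<open>\<Omega>\<close> is the set of negative initial values.
\<close>

definition motion_levelset :: "real \<Rightarrow> (real^3) set \<Rightarrow> (real^3) set \<Rightarrow> (real \<times> (real^3) \<Rightarrow> real) \<Rightarrow>
    real \<Rightarrow> (real \<times> (real^3) \<Rightarrow> real) \<Rightarrow> bool" where
  "motion_levelset \<epsilon> \<Omega> A v \<tau> \<phi> \<longleftrightarrow>
     (let D = {0<..<\<tau>} \<times> \<Omega>;
          dt = (\<lambda>(t, x). deriv (\<lambda>s. \<phi> (s, x)) t);
          dx = (\<lambda>(t, x). grad (\<lambda>y. \<phi> (t, y)) x)
      in Ck_on 1 D \<phi> \<and> continuous_on ({0..<\<tau>} \<times> \<Omega>) \<phi> \<and>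
         (\<forall>z\<in>D. \<phi> z = 0 \<longrightarrow> dt z = \<epsilon> * norm (dx z) * v z \<and> norm (dx z) > 0) \<and>
         (\<exists>g. in_W_inf 0 1 D g \<and>
            (\<forall>z\<in>D. \<phi> z \<noteq> 0 \<longrightarrow> g z = (dt z - \<epsilon> * norm (dx z) * v z) / \<phi> z)) \<and>
         frontier A = {x\<in>\<Omega>. \<phi> (0, x) = 0} \<and>
         \<Omega> - closure A = {x\<in>\<Omega>. \<phi> (0, x) < 0})"

definition zero_surface :: "(real^3) set \<Rightarrow> (real \<times> (real^3) \<Rightarrow> real) \<Rightarrow> real \<Rightarrow> (real^3) set" where
  "zero_surface \<Omega> \<phi> t = {x\<in>\<Omega>. \<phi> (t, x) = 0}"

text \<open>
  The surface \<open>\<Gamma>(t)\<close> is the graph of the height function \<open>h(t,\<cdot>)\<close> over \<open>frontier A\<close>. The last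
  inequality, over independent pairs of points, is the one between the suprema.
\<close>

definition height_function :: "real \<Rightarrow> real \<Rightarrow> (real^3) set \<Rightarrow> real \<Rightarrow>
    (real \<Rightarrow> (real^3) set) \<Rightarrow> (real \<Rightarrow> real^3 \<Rightarrow> real) \<Rightarrow> bool" where
  "height_function \<epsilon> a A \<tau> \<Gamma> h \<longleftrightarrow>
     (\<forall>t\<in>{0..<\<tau>}. \<Gamma> t = (\<lambda>\<gamma>. \<gamma> + h t \<gamma> *\<^sub>R outer_normal A \<gamma>) ` frontier A) \<and>
     (\<forall>t\<in>{0..\<tau>}. \<forall>\<gamma>\<in>frontier A. - (\<epsilon> * a) < h t \<gamma> \<and> h t \<gamma> < \<epsilon> * a \<and>
        h t differentiable (at \<gamma> within frontier A)) \<and>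
     (\<forall>t\<in>{0..\<tau>}. \<forall>\<gamma>\<in>frontier A. \<forall>t'\<in>{0..\<tau>}. \<forall>\<gamma>'\<in>frontier A.
        5 / (\<epsilon> * a) * \<bar>h t \<gamma>\<bar> + 2 * onorm (surface_deriv A (h t') \<gamma>') \<le> 1 / 2)"

definition cutoff :: "(real \<Rightarrow> real) \<Rightarrow> bool" where
  "cutoff \<eta> \<longleftrightarrow> (\<forall>k. Ck_map k {0..} \<eta>) \<and> (\<forall>r\<ge>0. \<eta> r \<in> {0..1}) \<and>
     (\<forall>r. 0 \<le> r \<and> r < 1/3 \<longrightarrow> \<eta> r = 1) \<and> (\<forall>r. r > 2/3 \<longrightarrow> \<eta> r = 0) \<and>
     (\<forall>r\<in>{1/3<..<2/3}. deriv \<eta> r < 0) \<and> (\<forall>r>0. \<bar>deriv \<eta> r\<bar> \<le> 4)"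

definition motion_function :: "real \<Rightarrow> real \<Rightarrow> (real^3) set \<Rightarrow> (real \<Rightarrow> real) \<Rightarrow>
    (real \<Rightarrow> real^3 \<Rightarrow> real) \<Rightarrow> real \<Rightarrow> real^3 \<Rightarrow> real^3" where
  "motion_function \<epsilon> a A \<eta> h t x =
     (if x \<in> tube A (\<epsilon> * a)
      then let \<gamma> = tube_proj A (\<epsilon> * a) x
           in x + (h t \<gamma> * \<eta> (infdist x (frontier A) / (\<epsilon> * a))) *\<^sub>R outer_normal A \<gamma>
      else x)"

definition space_jacobian :: "(real \<Rightarrow> real^3 \<Rightarrow> real^3) \<Rightarrow> real \<times> (real^3) \<Rightarrow> real^3^3" where
  "space_jacobian s = (\<lambda>(t, x). matrix (frechet_derivative (s t) (at x)))"

section \<open>The standing assumptions\<close>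

text \<open>
  The continuous representative of \<open>v\<^sub>\<epsilon>\<close> is used, since the motion problem evaluates it on
  null sets.
\<close>

definition assumption_A1 :: "(nat \<Rightarrow> real) \<Rightarrow> real \<Rightarrow> real \<Rightarrow> (real^3) set \<Rightarrow> (real^3) set \<Rightarrow>
    (nat \<Rightarrow> real \<times> (real^3) \<Rightarrow> real) \<Rightarrow> bool" where
  "assumption_A1 \<epsilon> a T \<Omega> Y2 v \<longleftrightarrow>
     (let D = {0<..<T} \<times> \<Omega> in
        (\<forall>n. in_W_inf 1 3 D (v n) \<and> continuous_on D (v n) \<and>
           (\<forall>t\<in>{0<..<T}. closure {x\<in>\<Omega>. v n (t, x) \<noteq> 0} \<subseteq>
              tube (inclusions (\<epsilon> n) \<Omega> Y2) (\<epsilon> n * a))) \<and>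
        (SUP n. W1_inf_norm D (v n) + ennreal (\<epsilon> n) * Dx_norm D 2 (v n)
                + ennreal ((\<epsilon> n)\<^sup>2) * Dx_norm D 3 (v n)) < \<infinity>)"

definition assumption_A2 :: "(nat \<Rightarrow> (real \<times> (real^3)) set) \<Rightarrow> (nat \<Rightarrow> (real^3) set) \<Rightarrow>
    (nat \<Rightarrow> real \<times> (real^3) \<Rightarrow> real) \<Rightarrow> (nat \<Rightarrow> real^3 \<Rightarrow> real) \<Rightarrow> bool" where
  "assumption_A2 Q \<Omega>i f \<theta> \<longleftrightarrow>
     (\<forall>n. in_L2 (Q n) (f n) \<and> in_L2 (\<Omega>i n) (\<theta> n)) \<and>
     bdd_above (range (\<lambda>n. L2_norm (Q n) (f n) + L2_norm (\<Omega>i n) (\<theta> n)))"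

end

theory Submission
  imports Defs
begin

text \<open>
  The limit turns out to be explicit: \<open>D s\<^sub>\<epsilon>\<close> converges to the identity matrix, so that
  \<open>s(t, x, y) = y\<close>. The reason is that the velocity is small. In a cell of size \<open>\<epsilon>\<close> it has a
  gradient bounded independently of \<open>\<epsilon>\<close>, and it vanishes somewhere in the cell because its support
  stays inside the tube; hence \<open>v\<^sub>\<epsilon> = O(\<epsilon>)\<close> in every cell (\<open>velocity_in_cells\<close>). After rescaling a
  cell to the unit cell, the surface moves with a normal speed that is bounded by \<open>K = O(\<epsilon>)\<close> and
  \<open>K\<close>-Lipschitz in space (\<open>moving_front_place\<close>).

  It remains to see that such a front stays \<open>O(K)\<close>-close to the initial surface, not only in
  position but also in slope. The level set function is only of class \<open>C\<^sup>1\<close>, so the evolution equation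
  cannot be differentiated; both estimates come from a maximum principle for the signed distance \<open>d\<close>
  to the initial surface. For the position (\<open>height_le\<close>), maximise \<open>\<plusminus>d(x) - 2 K t\<close> over the points
  \<open>x\<close> of the moving front: at the maximum the normals of the two surfaces agree, and \<open>d\<close> changes in
  time at most with speed \<open>K\<close>. For the slope (\<open>height_lipschitz\<close>), maximise
  \<open>d(x) - d(y) - L t |x - y|\<close> over pairs of points of the front. At a positive maximum the gradients
  \<open>\<nabla>d(x) - L t e\<close> and \<open>\<nabla>d(y) - L t e\<close> with \<open>e = (x - y)/|x - y|\<close> are normal to the front, so the
  time derivative of \<open>d(x) - d(y)\<close> is the difference of two products of the speed with the length
  of such a gradient. As \<open>\<nabla>d\<close> is \<open>B\<close>-Lipschitz, this is at most \<open>K (3/2 + B) |x - y|\<close>, which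
  contradicts the choice \<open>L = K (2 + B)\<close>. Thus the height function is \<open>O(\<epsilon>)\<close>-small and
  \<open>O(\<epsilon>)\<close>-Lipschitz.

  In a cell inside \<open>\<Omega>\<close> the map \<open>s\<^sub>\<epsilon>\<close> is, after rescaling, the identity plus the product of the
  height function at the foot point, the cut-off and the normal (\<open>motion_function_place\<close>); its
  Jacobian is therefore the identity up to \<open>O(\<epsilon>)\<close> (\<open>unfolded_small\<close>). Each point of \<open>\<Omega>\<close> lies in
  such a cell once \<open>\<epsilon>\<close> is small, and the slope bound in the definition of the height function
  bounds the Jacobians uniformly, so that dominated convergence concludes.

  Three facts prepare this. A continuous function with a bounded weak derivative is Lipschitz
  (\<open>weak_derivative_bound_imp_lipschitz\<close>). The tube is the set of points at distance less than \<open>a\<close>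
  from the surface, and the gradient of the signed distance is the normal at the foot point
  (\<open>tube_eq_infdist\<close>, \<open>sdist_has_derivative\<close>). The Jacobians are measurable, since the height
  functions are jointly continuous and difference quotients converge (\<open>continuous_height\<close>,
  \<open>measurable_jacobian\<close>).
\<close>

section \<open>Calculus of \<open>Ck_on\<close>\<close>

lemma Ck_on_cong:
  assumes "open S" and "\<And>x. x \<in> S \<Longrightarrow> f x = g x" and "Ck_on k S f"
  shows "Ck_on k S g"
  using assms(2,3)
proof (induction k arbitrary: f g)
  case 0
  then show ?case by (metis Ck_on.simps(1) continuous_on_cong)
next
  case (Suc k)
  have d: "(g has_derivative frechet_derivative f (at x)) (at x)" if "x \<in> S" for x
  proof (rule has_derivative_transform_within_open[OF _ assms(1) that])
    show "(f has_derivative frechet_derivative f (at x)) (at x)"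
      using Suc.prems that by (simp add: frechet_derivative_works[symmetric])
  qed (use Suc.prems in auto)
  then have e: "frechet_derivative g (at x) = frechet_derivative f (at x)" if "x \<in> S" for x
    using frechet_derivative_at[OF d[OF that]] by simp
  have "Ck_on k S (\<lambda>x. frechet_derivative g (at x) b)" if "b \<in> Basis" for b
    by (rule Suc.IH[of "\<lambda>x. frechet_derivative f (at x) b"]) (use Suc.prems e that in auto)
  moreover have "g differentiable (at x)" if "x \<in> S" for x
    using d[OF that] by (rule differentiableI)
  ultimately show ?case by simp
qed

lemma Ck_on_Suc_imp: "Ck_on (Suc k) S f \<Longrightarrow> Ck_on k S f"
proof (induction k arbitrary: f)
  case 0
  then show ?case
    by (auto intro!: differentiable_imp_continuous_on differentiable_at_imp_differentiable_on)
next
  case (Suc k)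
  have "Ck_on k S (\<lambda>x. frechet_derivative f (at x) b)" if "b \<in> Basis" for b
    by (rule Suc.IH) (use Suc.prems that in simp)
  with Suc.prems show ?case by simp
qed

lemma Ck_on_mono: "Ck_on k S f \<Longrightarrow> j \<le> k \<Longrightarrow> Ck_on j S f"
proof (induction k)
  case (Suc k)
  then show ?case using Ck_on_Suc_imp[OF Suc.prems(1)] by (cases "j = Suc k") auto
qed simp

lemma Ck_on_subset: "Ck_on k S f \<Longrightarrow> T \<subseteq> S \<Longrightarrow> Ck_on k T f"
  by (induction k arbitrary: f) (auto intro: continuous_on_subset)

lemma Ck_on_local:
  assumes "\<And>x. x \<in> S \<Longrightarrow> \<exists>V. open V \<and> x \<in> V \<and> Ck_on k V f"
  shows "Ck_on k S f"
  using assms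
proof (induction k arbitrary: f)
  case 0
  have "isCont f x" if "x \<in> S" for x
    using 0[OF that] by (auto simp: continuous_on_eq_continuous_at)
  then show ?case by (simp add: continuous_at_imp_continuous_on)
next
  case (Suc k)
  have "\<exists>V. open V \<and> x \<in> V \<and> Ck_on k V (\<lambda>x. frechet_derivative f (at x) b)"
    if "b \<in> Basis" "x \<in> S" for b x
    using Suc.prems[OF that(2)] that(1) by auto
  then have "Ck_on k S (\<lambda>x. frechet_derivative f (at x) b)" if "b \<in> Basis" for b
    using Suc.IH that by blast
  moreover have "f differentiable (at x)" if "x \<in> S" for x
    using Suc.prems[OF that] by auto
  ultimately show ?case by simp
qed

lemma Ck_on_const: "Ck_on k S (\<lambda>x. c)"
  by (induction k arbitrary: c) auto

lemma Ck_on_add: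
  assumes "open S" "Ck_on k S f" "Ck_on k S g"
  shows "Ck_on k S (\<lambda>x. f x + g x)"
  using assms(2,3)
proof (induction k arbitrary: f g)
  case 0
  then show ?case by (auto intro: continuous_intros)
next
  case (Suc k)
  have "Ck_on k S (\<lambda>x. frechet_derivative (\<lambda>x. f x + g x) (at x) b)" if "b \<in> Basis" for b
  proof (rule Ck_on_cong[OF assms(1) _ Suc.IH])
    show "frechet_derivative f (at x) b + frechet_derivative g (at x) b
        = frechet_derivative (\<lambda>x. f x + g x) (at x) b" if "x \<in> S" for x
    proof -
      have "((\<lambda>x. f x + g x) has_derivative
          (\<lambda>b. frechet_derivative f (at x) b + frechet_derivative g (at x) b)) (at x)"
        using Suc.prems that by (intro has_derivative_add) (auto simp: frechet_derivative_works[symmetric])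
      from frechet_derivative_at[OF this, THEN fun_cong] show ?thesis by simp
    qed
  qed (use Suc.prems that in auto)
  with Suc.prems show ?case by auto
qed

lemma Ck_on_mult:
  fixes f g :: "'a::euclidean_space \<Rightarrow> real"
  assumes "open S" "Ck_on k S f" "Ck_on k S g"
  shows "Ck_on k S (\<lambda>x. f x * g x)"
  using assms(2,3)
proof (induction k arbitrary: f g)
  case 0
  then show ?case by (auto intro: continuous_intros)
next
  case (Suc k)
  have fd: "frechet_derivative (\<lambda>x. f x * g x) (at x) b
      = f x * frechet_derivative g (at x) b + frechet_derivative f (at x) b * g x" if "x \<in> S" for x b
  proof -
    have "((\<lambda>x. f x * g x) has_derivative
        (\<lambda>b. f x * frechet_derivative g (at x) b + frechet_derivative f (at x) b * g x)) (at x)"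
      using Suc.prems that by (intro has_derivative_mult) (auto simp: frechet_derivative_works[symmetric])
    from frechet_derivative_at[OF this, THEN fun_cong] show ?thesis by simp
  qed
  have "Ck_on k S (\<lambda>x. frechet_derivative (\<lambda>x. f x * g x) (at x) b)" if "b \<in> Basis" for b
  proof (rule Ck_on_cong[OF assms(1) fd[symmetric] Ck_on_add[OF assms(1) Suc.IH Suc.IH]])
    show "Ck_on k S f" "Ck_on k S g" by (rule Ck_on_Suc_imp, fact)+
  qed (use Suc.prems that in auto)
  with Suc.prems show ?case by (auto intro: differentiable_mult)
qed

lemma Ck_on_prod:
  fixes f :: "'i \<Rightarrow> 'a::euclidean_space \<Rightarrow> real"
  assumes "open S" "\<And>i. i \<in> I \<Longrightarrow> Ck_on k S (f i)"
  shows "Ck_on k S (\<lambda>x. \<Prod>i\<in>I. f i x)"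
  using assms(2)
proof (induction I rule: infinite_finite_induct)
  case (insert i I)
  then have "Ck_on k S (\<lambda>x. f i x * (\<Prod>i\<in>I. f i x))"
    by (intro Ck_on_mult[OF assms(1)]) auto
  then show ?case using insert by simp
qed (simp_all add: Ck_on_const)

lemma frechet_derivative_along_coordinate:
  fixes g :: "real \<Rightarrow> real" and c :: "'a::euclidean_space"
  assumes "g differentiable (at (l * (z \<bullet> c) + m))"
  shows "((\<lambda>z. g (l * (z \<bullet> c) + m)) has_derivative
     (\<lambda>b. frechet_derivative g (at (l * (z \<bullet> c) + m)) 1 * (l * (b \<bullet> c)))) (at z)"
proof -
  let ?u = "l * (z \<bullet> c) + m"
  have g: "(g has_derivative frechet_derivative g (at ?u)) (at ?u)"
    using assms by (simp add: frechet_derivative_works)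
  have "((\<lambda>z. l * (z \<bullet> c) + m) has_derivative (\<lambda>b. l * (b \<bullet> c))) (at z)"
    by (auto intro!: derivative_eq_intros)
  from diff_chain_at[OF this g]
  have "((\<lambda>z. g (l * (z \<bullet> c) + m)) has_derivative
     (\<lambda>b. frechet_derivative g (at ?u) (l * (b \<bullet> c)))) (at z)"
    by (simp add: o_def)
  moreover have "frechet_derivative g (at ?u) (l * (b \<bullet> c))
      = frechet_derivative g (at ?u) 1 * (l * (b \<bullet> c))" for b
    using linear_cmul[OF has_derivative_linear[OF g], of "l * (b \<bullet> c)" 1] by simp
  ultimately show ?thesis by simp
qed

lemma Ck_on_along_coordinate:
  fixes g :: "real \<Rightarrow> real" and c :: "'a::euclidean_space"
  assumes "Ck_on k UNIV g"
  shows "Ck_on k UNIV (\<lambda>z. g (l * (z \<bullet> c) + m))"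
  using assms
proof (induction k arbitrary: g)
  case 0
  then have "continuous_on UNIV (g \<circ> (\<lambda>z. l * (z \<bullet> c) + m))"
    by (intro continuous_on_compose continuous_intros) (auto elim: continuous_on_subset)
  then show ?case by (simp add: o_def)
next
  case (Suc k)
  have "g differentiable (at u)" for u
    using Suc.prems by simp
  note d = frechet_derivative_along_coordinate[OF this, where l = l and c = c and m = m]
  have df: "frechet_derivative (\<lambda>z. g (l * (z \<bullet> c) + m)) (at z) b
     = frechet_derivative g (at (l * (z \<bullet> c) + m)) 1 * (l * (b \<bullet> c))" for z b
    using frechet_derivative_at[OF d[of z], THEN fun_cong, of b] by (rule sym)
  have "Ck_on k UNIV (\<lambda>z. frechet_derivative g (at (l * (z \<bullet> c) + m)) 1)"
    by (rule Suc.IH) (use Suc.prems in simp)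
  then have "Ck_on k UNIV (\<lambda>z. frechet_derivative g (at (l * (z \<bullet> c) + m)) 1 * (l * (b \<bullet> c)))" for b
    by (rule Ck_on_mult[OF open_UNIV _ Ck_on_const])
  then have "Ck_on k UNIV (\<lambda>z. frechet_derivative (\<lambda>z. g (l * (z \<bullet> c) + m)) (at z) b)" for b
    by (simp only: df)
  moreover have "(\<lambda>z. g (l * (z \<bullet> c) + m)) differentiable (at z)" for z
    using d[of z] by (rule differentiableI)
  ultimately show ?case unfolding Ck_on.simps by blast
qed

text \<open>
  Together with \<open>Ck_on_along_coordinate\<close> and \<open>Ck_on_prod\<close> this yields the smoothness of products of
  functions of one coordinate each, the shape of all test functions below.
\<close>

lemma Ck_on_antiderivative:
  fixes B b :: "real \<Rightarrow> real"
  assumes "Ck_on k UNIV b" "\<And>u. (B has_real_derivative b u) (at u)"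
  shows "Ck_on (Suc k) UNIV B"
proof -
  have "frechet_derivative B (at u) = (\<lambda>h. b u * h)" for u
    using frechet_derivative_at[OF assms(2)[of u, unfolded has_field_derivative_def]] by simp
  moreover have "B differentiable (at u)" for u
    using assms(2)[of u, unfolded has_field_derivative_def] by (rule differentiableI)
  ultimately show ?thesis using assms(1) by simp
qed

section \<open>Continuous functions with a bounded weak derivative\<close>

text \<open>A bump on the real line, equal to 1 near the origin so that its integral is positive.\<close>

definition smooth_bump :: "(real \<Rightarrow> real) \<Rightarrow> bool" where
  "smooth_bump b \<longleftrightarrow> (\<forall>k. Ck_on k UNIV b) \<and> (\<forall>u. 0 \<le> b u) \<and>
     (\<forall>u. \<bar>u\<bar> < 1/3 \<longrightarrow> b u = 1) \<and> (\<forall>u. 1 \<le> \<bar>u\<bar> \<longrightarrow> b u = 0)"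

text \<open>
  The cut-off \<open>\<eta>\<close> extended by 1 to the negative half line is smooth, since \<open>\<eta>\<close> is constant near 0;
  multiplying it with its reflection gives a bump.
\<close>

lemma cutoff_imp_smooth_bump:
  assumes "cutoff \<eta>"
  obtains b where "smooth_bump b"
proof -
  define c where "c u = \<eta> (max 0 u)" for u
  have c1: "c u = 1" if "u < 1/3" for u
    using assms that by (auto simp: cutoff_def c_def max_def)
  have smooth: "Ck_on k UNIV c" for k
  proof (rule Ck_on_local)
    fix u :: real
    show "\<exists>V. open V \<and> u \<in> V \<and> Ck_on k V c"
    proof (cases "u < 1/3")
      case True
      have "Ck_on k {..<1/3} c"
        by (rule Ck_on_cong[OF _ _ Ck_on_const[of k _ 1]]) (auto simp: c1)
      then show ?thesis using True by (intro exI[of _ "{..<1/3}"]) auto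
    next
      case False
      have "Ck_map k {0..} \<eta>" using assms by (simp add: cutoff_def)
      then obtain V g where V: "open V" "u \<in> V" "Ck_on k V g" "\<forall>y\<in>{0..} \<inter> V. g y = \<eta> y"
        unfolding Ck_map_def using False by (metis atLeast_iff le_less_linear less_le_trans
            less_numeral_extra(1) divide_pos_pos less_imp_le zero_less_numeral not_less)
      have "Ck_on k (V \<inter> {0<..}) c"
        by (rule Ck_on_cong[OF _ _ Ck_on_subset[OF V(3)]]) (use V in \<open>auto simp: c_def\<close>)
      then show ?thesis using False V by (intro exI[of _ "V \<inter> {0<..}"]) auto
    qed
  qed
  have "Ck_on k UNIV (\<lambda>u. c (- u))" for k
    using Ck_on_along_coordinate[OF smooth, of k "-1" "1::real" 0] by simp
  then have "Ck_on k UNIV (\<lambda>u. c u * c (- u))" for k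
    by (intro Ck_on_mult smooth) auto
  moreover have "0 \<le> c u" for u
    using assms by (auto simp: cutoff_def c_def)
  moreover have "c u = 0" if "u \<ge> 1" for u
    using assms that by (auto simp: cutoff_def c_def)
  ultimately have "smooth_bump (\<lambda>u. c u * c (- u))"
    unfolding smooth_bump_def using c1 by (auto simp: abs_if split: if_splits)
  then show ?thesis by (rule that)
qed

definition bump_at :: "(real \<Rightarrow> real) \<Rightarrow> real \<Rightarrow> 'a::euclidean_space \<Rightarrow> 'a \<Rightarrow> real" where
  "bump_at b \<delta> c z = (\<Prod>i\<in>Basis. b ((z - c) \<bullet> i / \<delta>))"

text \<open>
  With \<open>B\<close> an antiderivative of \<open>b\<close>, this is the integral of \<open>bump_at b \<delta> (c + r e) z\<close> over
  \<open>r \<in> [0, s]\<close>: the bump swept along the segment from \<open>c\<close> to \<open>c + s e\<close>. The integral is carried out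
  in the one factor that depends on \<open>r\<close>, which leaves an evidently smooth product.
\<close>

definition swept_bump ::
  "(real \<Rightarrow> real) \<Rightarrow> (real \<Rightarrow> real) \<Rightarrow> real \<Rightarrow> real \<Rightarrow> 'a::euclidean_space \<Rightarrow> 'a \<Rightarrow> 'a \<Rightarrow> real" where
  "swept_bump b B \<delta> s e c z =
     \<delta> * (B ((z - c) \<bullet> e / \<delta>) - B ((z - c) \<bullet> e / \<delta> - s / \<delta>)) *
     (\<Prod>i\<in>Basis - {e}. b ((z - c) \<bullet> i / \<delta>))"

context
  fixes b B :: "real \<Rightarrow> real" and \<delta> :: real
  assumes b: "smooth_bump b" and \<delta>: "0 < \<delta>"
begin

lemma bump_at_nonneg: "0 \<le> bump_at b \<delta> c z"
  using b by (auto simp: bump_at_def smooth_bump_def intro!: prod_nonneg)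

lemma bump_at_eq_0: "bump_at b \<delta> c z = 0" if "i \<in> Basis" "\<delta> \<le> \<bar>(z - c) \<bullet> i\<bar>"
proof -
  have "b ((z - c) \<bullet> i / \<delta>) = 0"
    using b \<delta> that by (auto simp: smooth_bump_def divide_simps)
  then show ?thesis unfolding bump_at_def using that(1) by (intro prod_zero) auto
qed

lemma continuous_bump_at: "continuous_on S (bump_at b \<delta> c)"
proof -
  have "continuous_on UNIV b" using b by (metis Ck_on.simps(1) smooth_bump_def)
  then have "continuous_on UNIV (b \<circ> (\<lambda>z. (z - c) \<bullet> i / \<delta>))" for i
    using \<delta> by (intro continuous_on_compose continuous_intros) (auto elim: continuous_on_subset)
  then have "continuous_on UNIV (\<lambda>z. \<Prod>i\<in>Basis. b ((z - c) \<bullet> i / \<delta>))"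
    by (intro continuous_on_prod) (simp add: o_def)
  then show ?thesis unfolding bump_at_def by (rule continuous_on_subset) simp
qed

lemma measurable_bump_at [measurable]: "bump_at b \<delta> c \<in> borel_measurable borel"
  by (intro borel_measurable_continuous_onI continuous_bump_at)

lemma bump_at_translate: "bump_at b \<delta> (c + d) z = bump_at b \<delta> c (z - d)"
  by (simp add: bump_at_def algebra_simps)

lemma integrable_bump_at: "integrable lborel (bump_at b \<delta> c)"
proof -
  let ?K = "cbox (c - \<delta> *\<^sub>R One) (c + \<delta> *\<^sub>R One)"
  have "integrable lborel (\<lambda>z. indicator ?K z *\<^sub>R bump_at b \<delta> c z)"
    by (intro borel_integrable_compact continuous_bump_at) auto
  also have "(\<lambda>z. indicator ?K z *\<^sub>R bump_at b \<delta> c z) = bump_at b \<delta> c"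
  proof
    fix z show "indicator ?K z *\<^sub>R bump_at b \<delta> c z = bump_at b \<delta> c z"
    proof (cases "z \<in> ?K")
      case False
      then obtain i where "i \<in> Basis" "\<delta> \<le> \<bar>(z - c) \<bullet> i\<bar>"
        by (fastforce simp: mem_box inner_diff_left inner_add_left)
      then show ?thesis using bump_at_eq_0[of i z c] by simp
    qed simp
  qed
  finally show ?thesis .
qed

lemma nn_integral_bump_at:
  fixes c :: "'a::euclidean_space"
  shows "(\<integral>\<^sup>+z. ennreal (bump_at b \<delta> c z) \<partial>lborel)
    = ennreal (\<integral>z. bump_at b \<delta> (0::'a) z \<partial>lborel)"
proof -
  have "(\<integral>\<^sup>+z. ennreal (bump_at b \<delta> c z) \<partial>lborel)
      = (\<integral>\<^sup>+z. ennreal (bump_at b \<delta> c z) \<partial>distr lborel borel ((+) c))"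
    by (simp add: lborel_distr_plus)
  also have "\<dots> = (\<integral>\<^sup>+z. ennreal (bump_at b \<delta> c (c + z)) \<partial>lborel)"
    by (subst nn_integral_distr) auto
  also have "\<dots> = (\<integral>\<^sup>+z. ennreal (bump_at b \<delta> (0::'a) z) \<partial>lborel)"
    by (simp add: bump_at_def)
  also have "\<dots> = ennreal (\<integral>z. bump_at b \<delta> (0::'a) z \<partial>lborel)"
    by (intro nn_integral_eq_integral integrable_bump_at) (simp add: bump_at_nonneg)
  finally show ?thesis .
qed

lemma integral_bump_at:
  fixes c :: "'a::euclidean_space"
  shows "(\<integral>z. bump_at b \<delta> c z \<partial>lborel) = (\<integral>z. bump_at b \<delta> (0::'a) z \<partial>lborel)"
proof -
  have "ennreal (\<integral>z. bump_at b \<delta> c z \<partial>lborel) = (\<integral>\<^sup>+z. ennreal (bump_at b \<delta> c z) \<partial>lborel)"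
    by (intro nn_integral_eq_integral[symmetric] integrable_bump_at) (simp add: bump_at_nonneg)
  then show ?thesis
    by (simp add: nn_integral_bump_at integral_nonneg_AE bump_at_nonneg)
qed

lemma integral_bump_at_pos: "0 < (\<integral>z. bump_at b \<delta> (0::'a::euclidean_space) z \<partial>lborel)"
proof -
  let ?K = "cbox (- (\<delta>/4) *\<^sub>R One) ((\<delta>/4) *\<^sub>R One :: 'a)"
  have le: "indicator ?K z \<le> bump_at b \<delta> 0 z" for z :: 'a
  proof (cases "z \<in> ?K")
    case True
    then have "b (z \<bullet> i / \<delta>) = 1" if "i \<in> Basis" for i
    proof -
      have "- (\<delta>/4) \<le> z \<bullet> i" "z \<bullet> i \<le> \<delta>/4"
        using True that by (auto simp: mem_box)
      then have "\<bar>z \<bullet> i / \<delta>\<bar> \<le> 1/4" using \<delta> by (auto simp: divide_simps abs_le_iff)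
      then show ?thesis using b by (auto simp: smooth_bump_def)
    qed
    then show ?thesis by (simp add: bump_at_def)
  qed (simp add: bump_at_nonneg)
  have ne: "0 < measure lborel ?K"
    using \<delta> by (auto simp: measure_lborel_cbox_eq inner_diff_left inner_add_left intro!: prod_pos)
  also have "\<dots> = (\<integral>z. indicator ?K z \<partial>lborel)" by simp
  also have "\<dots> \<le> (\<integral>z. bump_at b \<delta> (0::'a) z \<partial>lborel)"
    by (intro integral_mono integrable_bump_at le) (auto simp: emeasure_lborel_cbox_eq)
  finally show ?thesis .
qed

context
  fixes e :: "'a::euclidean_space" and s :: real
  assumes B: "\<And>u. (B has_real_derivative b u) (at u)" and e: "e \<in> Basis" and s: "0 \<le> s"
begin

lemma bump_at_along:
  "bump_at b \<delta> (c + r *\<^sub>R e) z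
    = b ((z - c) \<bullet> e / \<delta> - r / \<delta>) * (\<Prod>i\<in>Basis - {e}. b ((z - c) \<bullet> i / \<delta>))"
proof -
  have "bump_at b \<delta> (c + r *\<^sub>R e) z
      = b ((z - (c + r *\<^sub>R e)) \<bullet> e / \<delta>) * (\<Prod>i\<in>Basis - {e}. b ((z - (c + r *\<^sub>R e)) \<bullet> i / \<delta>))"
    unfolding bump_at_def using e by (simp add: prod.remove)
  also have "(\<Prod>i\<in>Basis - {e}. b ((z - (c + r *\<^sub>R e)) \<bullet> i / \<delta>))
      = (\<Prod>i\<in>Basis - {e}. b ((z - c) \<bullet> i / \<delta>))"
    using e by (intro prod.cong) (auto simp: inner_diff_left inner_add_left inner_Basis)
  also have "(z - (c + r *\<^sub>R e)) \<bullet> e / \<delta> = (z - c) \<bullet> e / \<delta> - r / \<delta>"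
    using e by (simp add: inner_diff_left inner_add_left diff_divide_distrib add_divide_distrib)
  finally show ?thesis .
qed

text \<open>The fundamental theorem of calculus in the factor belonging to the direction \<open>e\<close>.\<close>

lemma nn_integral_bump_at_along:
  "(\<integral>\<^sup>+r. ennreal (bump_at b \<delta> (c + r *\<^sub>R e) z) * indicator {0..s} r \<partial>lborel)
    = ennreal (swept_bump b B \<delta> s e c z)"
proof -
  let ?P = "\<Prod>i\<in>Basis - {e}. b ((z - c) \<bullet> i / \<delta>)"
  have "(\<integral>\<^sup>+r. ennreal (bump_at b \<delta> (c + r *\<^sub>R e) z) * indicator {0..s} r \<partial>lborel)
     = (- \<delta> * B ((z - c) \<bullet> e / \<delta> - s / \<delta>) * ?P) - (- \<delta> * B ((z - c) \<bullet> e / \<delta> - 0 / \<delta>) * ?P)"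
  proof (intro nn_integral_FTC_Icc)
    fix r
    have "((\<lambda>r. B ((z - c) \<bullet> e / \<delta> - r / \<delta>)) has_real_derivative
        b ((z - c) \<bullet> e / \<delta> - r / \<delta>) * (- (1 / \<delta>))) (at r)"
      by (rule DERIV_chain2[OF B]) (use \<delta> in \<open>auto intro!: derivative_eq_intros simp: divide_simps\<close>)
    then show "((\<lambda>r. - \<delta> * B ((z - c) \<bullet> e / \<delta> - r / \<delta>) * ?P) has_real_derivative
        bump_at b \<delta> (c + r *\<^sub>R e) z) (at r)"
      unfolding bump_at_along
      using \<delta> by (auto intro!: derivative_eq_intros)
  next
    show "(\<lambda>r. bump_at b \<delta> (c + r *\<^sub>R e) z) \<in> borel_measurable borel"
      unfolding bump_at_translate by measurable
  qed (auto simp: bump_at_nonneg s)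
  also have "\<dots> = swept_bump b B \<delta> s e c z"
    by (simp add: swept_bump_def algebra_simps)
  finally show ?thesis .
qed

lemma swept_bump_nonneg: "0 \<le> swept_bump b B \<delta> s e c z"
proof -
  have "mono B"
    by (rule monoI, rule DERIV_nonneg_imp_nondecreasing) (use B b in \<open>auto simp: smooth_bump_def\<close>)
  then show ?thesis
    unfolding swept_bump_def using \<delta> s b
    by (intro mult_nonneg_nonneg prod_nonneg) (auto simp: smooth_bump_def intro: monoD)
qed

lemma swept_bump_eq_0:
  assumes "z \<notin> cbox (c - \<delta> *\<^sub>R One) (c + s *\<^sub>R e + \<delta> *\<^sub>R One)"
  shows "swept_bump b B \<delta> s e c z = 0"
proof -
  obtain i where i: "i \<in> Basis" and
    "(z - c) \<bullet> i < - \<delta> \<or> \<delta> < (z - c) \<bullet> i - s * (e \<bullet> i)"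
    using assms by (fastforce simp: mem_box inner_diff_left inner_add_left)
  then have far: "\<delta> \<le> \<bar>(z - (c + r *\<^sub>R e)) \<bullet> i\<bar>" if "r \<in> {0..s}" for r
    using that e by (cases "i = e") (auto simp: inner_diff_left inner_add_left inner_Basis)
  have "ennreal (swept_bump b B \<delta> s e c z) = (\<integral>\<^sup>+r. 0 \<partial>(lborel::real measure))"
    unfolding nn_integral_bump_at_along[symmetric]
    by (rule nn_integral_cong) (use bump_at_eq_0[OF i far] in \<open>auto simp: indicator_def\<close>)
  then show ?thesis using swept_bump_nonneg[of c z] by simp
qed

lemma Ck_on_swept_bump: "Ck_on k UNIV (swept_bump b B \<delta> s e c)"
proof -
  have b': "Ck_on k UNIV b" using b by (simp add: smooth_bump_def)
  then have B': "Ck_on k UNIV B" using Ck_on_antiderivative[OF _ B] Ck_on_Suc_imp by blast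
  have "Ck_on k UNIV (\<lambda>z. \<delta> * (B (1/\<delta> * (z \<bullet> e) + - (c \<bullet> e / \<delta>)) +
       (-1) * B (1/\<delta> * (z \<bullet> e) + (- (c \<bullet> e / \<delta>) - s / \<delta>))) *
      (\<Prod>i\<in>Basis - {e}. b (1/\<delta> * (z \<bullet> i) + - (c \<bullet> i / \<delta>))))"
    by (intro Ck_on_mult[OF open_UNIV] Ck_on_prod[OF open_UNIV] Ck_on_add[OF open_UNIV]
        Ck_on_along_coordinate[OF b'] Ck_on_along_coordinate[OF B'] Ck_on_const)
  then show ?thesis
    unfolding swept_bump_def
    by (rule Ck_on_cong[OF open_UNIV, rotated]) (simp add: inner_diff_left diff_divide_distrib add_diff_eq)
qed

lemma measurable_swept_bump: "swept_bump b B \<delta> s e c \<in> borel_measurable borel"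
  using Ck_on_swept_bump[of 0] by (intro borel_measurable_continuous_onI) simp

text \<open>Exchange the integrations over the segment and over space; every translate of the bump has the
  same integral.\<close>

lemma nn_integral_swept_bump:
  "(\<integral>\<^sup>+z. ennreal (swept_bump b B \<delta> s e c z) \<partial>lborel) = ennreal (s * (\<integral>z. bump_at b \<delta> (0::'a) z \<partial>lborel))"
proof -
  have "(\<integral>\<^sup>+z. ennreal (swept_bump b B \<delta> s e c z) \<partial>lborel)
     = (\<integral>\<^sup>+z. \<integral>\<^sup>+r. ennreal (bump_at b \<delta> c (z - r *\<^sub>R e)) * indicator {0..s} r \<partial>lborel \<partial>lborel)"
    unfolding nn_integral_bump_at_along[symmetric] bump_at_translate ..
  also have "\<dots> = (\<integral>\<^sup>+r. \<integral>\<^sup>+z. ennreal (bump_at b \<delta> c (z - r *\<^sub>R e)) * indicator {0..s} r \<partial>lborel \<partial>lborel)"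
    by (rule lborel_pair.Fubini') (measurable)
  also have "\<dots> = (\<integral>\<^sup>+r. (\<integral>\<^sup>+z. ennreal (bump_at b \<delta> (c + r *\<^sub>R e) z) \<partial>lborel) * indicator {0..s} r \<partial>lborel)"
    unfolding bump_at_translate by (intro nn_integral_cong nn_integral_multc) measurable
  also have "\<dots> = ennreal (\<integral>z. bump_at b \<delta> (0::'a) z \<partial>lborel) * emeasure lborel {0..s}"
    unfolding nn_integral_bump_at by (rule nn_integral_cmult_indicator) simp
  also have "\<dots> = ennreal (s * (\<integral>z. bump_at b \<delta> (0::'a) z \<partial>lborel))"
    using s by (simp add: ennreal_mult mult.commute integral_nonneg_AE bump_at_nonneg)
  finally show ?thesis .
qed

text \<open>
  The reason for sweeping: the derivative along the segment telescopes to the difference of the bumps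
  at the two end points. Tested against it, a weak derivative controls the difference of two
  averages of the function.
\<close>

lemma deriv_swept_bump:
  "iter_deriv [e] (swept_bump b B \<delta> s e c) z = bump_at b \<delta> c z - bump_at b \<delta> (c + s *\<^sub>R e) z"
proof -
  let ?f = "swept_bump b B \<delta> s e c" and ?P = "\<Prod>i\<in>Basis - {e}. b ((z - c) \<bullet> i / \<delta>)"
  have "?f differentiable (at z)" using Ck_on_swept_bump[of 1] by simp
  then have "(?f has_derivative frechet_derivative ?f (at z)) (at (z + 0 *\<^sub>R e))"
    by (simp add: frechet_derivative_works)
  moreover have "((\<lambda>r. z + r *\<^sub>R e) has_derivative (\<lambda>r. r *\<^sub>R e)) (at 0)"
    by (auto intro!: derivative_eq_intros)
  ultimately have "((\<lambda>r. ?f (z + r *\<^sub>R e)) has_derivative (\<lambda>r. frechet_derivative ?f (at z) (r *\<^sub>R e))) (at 0)"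
    using diff_chain_at[of "\<lambda>r. z + r *\<^sub>R e" "\<lambda>r. r *\<^sub>R e" 0 ?f] by (simp add: o_def)
  moreover have "linear (frechet_derivative ?f (at z))"
    using \<open>?f differentiable (at z)\<close> by (simp add: linear_frechet_derivative)
  ultimately have d1: "((\<lambda>r. ?f (z + r *\<^sub>R e)) has_real_derivative frechet_derivative ?f (at z) e) (at 0)"
    by (simp add: has_field_derivative_def linear_cmul mult_commute_abs)
  have line: "?f (z + r *\<^sub>R e) = \<delta> * (B ((z - c) \<bullet> e / \<delta> + r / \<delta>) - B ((z - c) \<bullet> e / \<delta> + r / \<delta> - s / \<delta>)) * ?P" for r
  proof -
    have "(\<Prod>i\<in>Basis - {e}. b ((z + r *\<^sub>R e - c) \<bullet> i / \<delta>)) = ?P"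
      using e by (intro prod.cong) (auto simp: inner_diff_left inner_add_left inner_Basis)
    then show ?thesis
      using e by (simp add: swept_bump_def inner_diff_left inner_add_left inner_Basis diff_divide_distrib add_divide_distrib add.commute add_diff_eq)
  qed
  have dB: "((\<lambda>r. B (x + r / \<delta>)) has_real_derivative b x * (1 / \<delta>)) (at 0)" for x
    by (rule DERIV_chain2[of B]) (use \<delta> B[of x] in \<open>auto intro!: derivative_eq_intros\<close>)
  have d2: "((\<lambda>r. ?f (z + r *\<^sub>R e)) has_real_derivative
     \<delta> * (b ((z - c) \<bullet> e / \<delta>) * (1 / \<delta>) - b ((z - c) \<bullet> e / \<delta> - s / \<delta>) * (1 / \<delta>)) * ?P) (at 0)"
    unfolding line using dB[of "(z - c) \<bullet> e / \<delta>"] dB[of "(z - c) \<bullet> e / \<delta> - s / \<delta>"]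
    by (intro DERIV_cmult_right DERIV_cmult DERIV_diff) (simp_all add: algebra_simps)
  from bump_at_along[of c 0 z] bump_at_along[of c s z] DERIV_unique[OF d1 d2] \<delta> show ?thesis
    by (simp add: algebra_simps)
qed

end
end

lemma integrable_lebesgue_on_compact_support:
  fixes F :: "'a::euclidean_space \<Rightarrow> 'b::{banach, second_countable_topology}"
  assumes D: "D \<in> sets lebesgue" and K: "compact K" "K \<subseteq> D" and F: "continuous_on K F"
    and 0: "\<And>z. z \<in> D - K \<Longrightarrow> F z = 0"
  shows "integrable (lebesgue_on D) F"
proof -
  have "integrable lborel (\<lambda>z. indicator K z *\<^sub>R F z)"
    by (rule borel_integrable_compact[OF K(1) F])
  then have "integrable lebesgue (\<lambda>z. indicator K z *\<^sub>R F z)"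
    by (subst integrable_completion) (auto dest: borel_measurable_integrable)
  also have "(\<lambda>z. indicator K z *\<^sub>R F z) = (\<lambda>z. indicator D z *\<^sub>R F z)"
    using K(2) 0 by (auto simp: indicator_def fun_eq_iff)
  finally show ?thesis using D by (subst integrable_restrict_space) auto
qed

lemma integral_lebesgue_on_support:
  fixes F :: "'a::euclidean_space \<Rightarrow> 'b::{banach, second_countable_topology}"
  assumes D: "D \<in> sets lebesgue" and F: "F \<in> borel_measurable borel"
    and 0: "\<And>z. z \<notin> D \<Longrightarrow> F z = 0"
  shows "(\<integral>z. F z \<partial>lebesgue_on D) = (\<integral>z. F z \<partial>lborel)"
proof -
  have "(\<integral>z. F z \<partial>lebesgue_on D) = (\<integral>z. indicator D z *\<^sub>R F z \<partial>lebesgue)"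
    using D by (subst integral_restrict_space) auto
  also have "(\<lambda>z. indicator D z *\<^sub>R F z) = F"
    using 0 by (auto simp: indicator_def fun_eq_iff)
  also have "(\<integral>z. F z \<partial>lebesgue) = (\<integral>z. F z \<partial>lborel)"
    using F by (intro integral_completion) simp
  finally show ?thesis .
qed

lemma bump_average_close:
  fixes f :: "'a::euclidean_space \<Rightarrow> real"
  assumes b: "smooth_bump b" and \<delta>: "0 < \<delta>" and D: "open D" and f: "continuous_on D f"
    and K: "cbox (c - \<delta> *\<^sub>R One) (c + \<delta> *\<^sub>R One) \<subseteq> D"
    and close: "\<And>z. z \<in> cbox (c - \<delta> *\<^sub>R One) (c + \<delta> *\<^sub>R One) \<Longrightarrow> \<bar>f z - f c\<bar> \<le> \<kappa>"
  shows "integrable (lebesgue_on D) (\<lambda>z. bump_at b \<delta> c z * f z)" (is ?int)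
    and "\<bar>(\<integral>z. bump_at b \<delta> c z * f z \<partial>lebesgue_on D) - f c * (\<integral>z. bump_at b \<delta> 0 z \<partial>(lborel::'a measure))\<bar>
      \<le> \<kappa> * (\<integral>z. bump_at b \<delta> 0 z \<partial>(lborel::'a measure))" (is ?bound)
proof -
  let ?K = "cbox (c - \<delta> *\<^sub>R One) (c + \<delta> *\<^sub>R One)"
  have Dl: "D \<in> sets lebesgue" using D by simp
  have zero: "bump_at b \<delta> c z = 0" if "z \<notin> ?K" for z
  proof -
    from that obtain i where "i \<in> Basis" "\<delta> \<le> \<bar>(z - c) \<bullet> i\<bar>"
      by (fastforce simp: mem_box inner_diff_left inner_add_left)
    then show ?thesis using bump_at_eq_0[OF b \<delta>, of i z c] by simp
  qed
  have cont: "continuous_on ?K (\<lambda>z. bump_at b \<delta> c z * f z)"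
    by (intro continuous_intros continuous_bump_at[OF b \<delta>] continuous_on_subset[OF f K])
  show i1: ?int
    by (rule integrable_lebesgue_on_compact_support[OF Dl _ K cont]) (use zero in auto)
  have i2: "integrable (lebesgue_on D) (bump_at b \<delta> c)"
    by (rule integrable_lebesgue_on_compact_support[OF Dl _ K continuous_bump_at[OF b \<delta>]])
      (use zero in auto)
  have eq: "(\<integral>z. bump_at b \<delta> c z \<partial>lebesgue_on D) = (\<integral>z. bump_at b \<delta> 0 z \<partial>(lborel::'a measure))"
    using K zero integral_bump_at[OF b \<delta>, of c] measurable_bump_at[OF b \<delta>]
    by (subst integral_lebesgue_on_support[OF Dl]) auto
  have "(\<integral>z. bump_at b \<delta> c z * f z \<partial>lebesgue_on D) - f c * (\<integral>z. bump_at b \<delta> 0 z \<partial>(lborel::'a measure))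
     = (\<integral>z. bump_at b \<delta> c z * f z - f c * bump_at b \<delta> c z \<partial>lebesgue_on D)"
    using i1 i2 by (simp flip: eq)
  also have "\<bar>\<dots>\<bar> \<le> (\<integral>z. \<kappa> * bump_at b \<delta> c z \<partial>lebesgue_on D)"
  proof (rule integral_abs_bound_integral)
    show "\<bar>bump_at b \<delta> c z * f z - f c * bump_at b \<delta> c z\<bar> \<le> \<kappa> * bump_at b \<delta> c z" for z
    proof (cases "z \<in> ?K")
      case True
      have "\<bar>bump_at b \<delta> c z * f z - f c * bump_at b \<delta> c z\<bar> = \<bar>f z - f c\<bar> * bump_at b \<delta> c z"
        using bump_at_nonneg[OF b \<delta>, of c z] by (simp add: abs_mult flip: left_diff_distrib mult.commute[of "f z"])
      then show ?thesis
        using close[OF True] bump_at_nonneg[OF b \<delta>, of c z] by (simp add: mult_right_mono)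
    qed (simp add: zero)
  qed (use i1 i2 in auto)
  finally show ?bound by (simp add: eq)
qed

text \<open>
  Test the weak derivative with the bump swept from \<open>c\<close> to \<open>c + s e\<close>. The left-hand side is the
  difference of the averages of \<open>f\<close> near the two end points, the right-hand side is at most
  \<open>M\<close> times the integral \<open>s I\<close> of the swept bump, where \<open>I\<close> is the integral of the bump. As the
  width \<open>\<delta>\<close> tends to 0, continuity turns the averages into values. The surrounding box contains
  the support of the test function.
\<close>

proposition weak_derivative_bound_imp_lipschitz:
  fixes f :: "'a::euclidean_space \<Rightarrow> real"
  assumes b: "smooth_bump b" and D: "open D" and f: "continuous_on D f"
    and g: "weak_deriv D [e] f g" "AE z in lebesgue_on D. \<bar>g z\<bar> \<le> M" and M: "0 \<le> M"
    and e: "e \<in> Basis" and s: "0 \<le> s"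
    and box: "box p q \<subseteq> D" "c \<in> box p q" "c + s *\<^sub>R e \<in> box p q"
  shows "\<bar>f (c + s *\<^sub>R e) - f c\<bar> \<le> M * s"
proof (rule field_le_epsilon)
  fix \<kappa> :: real assume "0 < \<kappa>"
  define c' where "c' = c + s *\<^sub>R e"
  have Dl: "D \<in> sets lebesgue" using D by simp
  have "\<forall>\<^sub>F z in at x. dist (f z) (f x) < \<kappa>/2" if "x \<in> box p q" for x
    using f D that box(1) \<open>0 < \<kappa>\<close> by (intro tendstoD) (auto simp: continuous_on_eq_continuous_at isCont_def)
  then obtain r r' where r: "0 < r" "\<And>z. dist z c < r \<Longrightarrow> \<bar>f z - f c\<bar> \<le> \<kappa>/2"
    and r': "0 < r'" "\<And>z. dist z c' < r' \<Longrightarrow> \<bar>f z - f c'\<bar> \<le> \<kappa>/2"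
    using box(2,3) \<open>0 < \<kappa>\<close> unfolding eventually_at c'_def[symmetric] dist_real_def
    by (metis (no_types, lifting) abs_zero diff_self half_gt_zero less_imp_le UNIV_I)
  have ev: "\<forall>\<^sub>F \<delta> in at_right (0::real). 0 < \<delta> \<and> \<delta> * DIM('a) < r \<and> \<delta> * DIM('a) < r' \<and>
     (\<forall>i\<in>Basis. p \<bullet> i < c \<bullet> i - \<delta> \<and> c' \<bullet> i + \<delta> < q \<bullet> i)"
  proof (intro eventually_conj eventually_ball_finite ballI)
    show "\<forall>\<^sub>F \<delta> in at_right (0::real). \<delta> * DIM('a) < r" "\<forall>\<^sub>F \<delta> in at_right (0::real). \<delta> * DIM('a) < r'"
      by (rule order_tendstoD[of _ 0]; use r(1) r'(1) in \<open>auto intro!: tendsto_eq_intros\<close>)+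
    fix i :: 'a assume "i \<in> Basis"
    then have "p \<bullet> i < c \<bullet> i" "c' \<bullet> i < q \<bullet> i"
      using box(2,3) unfolding c'_def[symmetric] by (auto simp: mem_box)
    moreover have "((\<lambda>\<delta>. c \<bullet> i - \<delta>) \<longlongrightarrow> c \<bullet> i) (at_right 0)" "((\<lambda>\<delta>. c' \<bullet> i + \<delta>) \<longlongrightarrow> c' \<bullet> i) (at_right 0)"
      by (auto intro!: tendsto_eq_intros)
    ultimately show "\<forall>\<^sub>F \<delta> in at_right 0. p \<bullet> i < c \<bullet> i - \<delta>" "\<forall>\<^sub>F \<delta> in at_right 0. c' \<bullet> i + \<delta> < q \<bullet> i"
      by (auto dest: order_tendstoD)
  qed (auto simp: eventually_at_right_less)
  then obtain \<delta> :: real where \<delta>: "0 < \<delta>" "\<delta> * DIM('a) < r" "\<delta> * DIM('a) < r'"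
     "\<And>i. i \<in> Basis \<Longrightarrow> p \<bullet> i < c \<bullet> i - \<delta> \<and> c' \<bullet> i + \<delta> < q \<bullet> i"
    by (auto dest!: eventually_happens)
  define I where "I = (\<integral>z. bump_at b \<delta> 0 z \<partial>(lborel::'a measure))"
  have I: "0 < I" unfolding I_def by (rule integral_bump_at_pos[OF b \<delta>(1)])
  let ?K = "cbox (c - \<delta> *\<^sub>R One) (c + s *\<^sub>R e + \<delta> *\<^sub>R One)"
  have mono: "c \<bullet> i \<le> c' \<bullet> i" if "i \<in> Basis" for i
    using that e s by (simp add: c'_def inner_add_left inner_Basis)
  have KD: "?K \<subseteq> D"
  proof -
    have "?K \<subseteq> box p q"
      using \<delta>(4) by (force simp: mem_box inner_diff_left inner_add_left c'_def)
    with box(1) show ?thesis by simp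
  qed
  have near: "dist z x \<le> \<delta> * DIM('a)" if "z \<in> cbox (x - \<delta> *\<^sub>R One) (x + \<delta> *\<^sub>R One)" for x z :: 'a
  proof -
    have "dist z x \<le> (\<Sum>i\<in>Basis. \<bar>(z - x) \<bullet> i\<bar>)"
      unfolding dist_norm by (rule norm_le_l1)
    also have "\<dots> \<le> (\<Sum>i\<in>(Basis::'a set). \<delta>)"
      using that by (intro sum_mono) (force simp: mem_box inner_diff_left inner_add_left abs_le_iff)
    finally show ?thesis by (simp add: mult.commute)
  qed
  have KD0: "cbox (c - \<delta> *\<^sub>R One) (c + \<delta> *\<^sub>R One) \<subseteq> D" "cbox (c' - \<delta> *\<^sub>R One) (c' + \<delta> *\<^sub>R One) \<subseteq> D"
    using mono by (intro subset_trans[OF _ KD]; force simp: mem_box inner_diff_left inner_add_left c'_def)+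
  note A = bump_average_close[OF b \<delta>(1) D f KD0(1), where \<kappa> = "\<kappa>/2", folded I_def]
    and A' = bump_average_close[OF b \<delta>(1) D f KD0(2), where \<kappa> = "\<kappa>/2", folded I_def]
  have close: "\<bar>f z - f c\<bar> \<le> \<kappa>/2" if "z \<in> cbox (c - \<delta> *\<^sub>R One) (c + \<delta> *\<^sub>R One)" for z
    using near[OF that] \<delta>(2) r(2) by simp
  have close': "\<bar>f z - f c'\<bar> \<le> \<kappa>/2" if "z \<in> cbox (c' - \<delta> *\<^sub>R One) (c' + \<delta> *\<^sub>R One)" for z
    using near[OF that] \<delta>(3) r'(2) by simp
  have "continuous_on UNIV b" using b by (metis Ck_on.simps(1) smooth_bump_def)
  then obtain B where B: "\<And>u. (B has_real_derivative b u) (at u)"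
    using einterval_antiderivative[of "-\<infinity>" "\<infinity>" b]
    by (auto simp: continuous_on_eq_continuous_at has_real_derivative_iff_has_vector_derivative)
  define \<xi> where "\<xi> = swept_bump b B \<delta> s e c"
  note ctx = b \<delta>(1) B e s
  have \<xi>0: "\<xi> z = 0" if "z \<notin> ?K" for z
    unfolding \<xi>_def by (rule swept_bump_eq_0[OF ctx that])
  have supp: "closure {z. \<xi> z \<noteq> 0} \<subseteq> ?K"
    by (rule closure_minimal) (use \<xi>0 in auto)
  have "test_function D \<xi>"
    unfolding test_function_def
  proof (intro conjI allI)
    show "Ck_on k UNIV \<xi>" for k
      unfolding \<xi>_def by (rule Ck_on_swept_bump[OF ctx])
    show "compact (closure {z. \<xi> z \<noteq> 0})"
      using supp compact_cbox closed_closure by (metis compact_Int_closed inf.absorb_iff2)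
    show "closure {z. \<xi> z \<noteq> 0} \<subseteq> D" using supp KD by simp
  qed
  then have "(\<integral>z. iter_deriv [e] \<xi> z *\<^sub>R f z \<partial>lebesgue_on D) = - (\<integral>z. \<xi> z *\<^sub>R g z \<partial>lebesgue_on D)"
    using g(1) by (simp add: weak_deriv_def)
  then have weak: "(\<integral>z. (bump_at b \<delta> c z - bump_at b \<delta> c' z) * f z \<partial>lebesgue_on D)
      = - (\<integral>z. \<xi> z * g z \<partial>lebesgue_on D)"
    unfolding \<xi>_def deriv_swept_bump[OF ctx] c'_def by simp
  have \<xi>m: "\<xi> \<in> borel_measurable borel" unfolding \<xi>_def by (rule measurable_swept_bump[OF ctx])
  have \<xi>nn: "0 \<le> \<xi> z" for z unfolding \<xi>_def by (rule swept_bump_nonneg[OF ctx])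
  have "(\<integral>\<^sup>+z. ennreal (\<xi> z) \<partial>lborel) = ennreal (s * I)"
    unfolding \<xi>_def I_def by (rule nn_integral_swept_bump[OF ctx])
  then have "(\<integral>z. \<xi> z \<partial>lborel) = s * I"
    using \<xi>m \<xi>nn s I by (intro integral_eq_nn_integral[THEN trans]) auto
  then have \<xi>int: "(\<integral>z. \<xi> z \<partial>lebesgue_on D) = s * I"
    using \<xi>0 KD by (subst integral_lebesgue_on_support[OF Dl \<xi>m]) auto
  have \<xi>i: "integrable (lebesgue_on D) \<xi>"
    by (rule integrable_lebesgue_on_compact_support[OF Dl compact_cbox KD])
      (use \<xi>0 Ck_on_swept_bump[OF ctx, of 0 c] in \<open>auto simp: \<xi>_def elim: continuous_on_subset\<close>)
  have "\<bar>\<integral>z. \<xi> z * g z \<partial>lebesgue_on D\<bar> \<le> (\<integral>z. \<bar>\<xi> z * g z\<bar> \<partial>lebesgue_on D)"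
    by (rule integral_abs_bound)
  also have "\<dots> \<le> (\<integral>z. M * \<xi> z \<partial>lebesgue_on D)"
  proof (rule integral_mono_AE')
    show "AE z in lebesgue_on D. \<bar>\<xi> z * g z\<bar> \<le> M * \<xi> z"
      using g(2) by eventually_elim (use \<xi>nn in \<open>simp add: abs_mult mult.commute[of M] mult_left_mono\<close>)
  qed (use \<xi>i \<xi>nn M in auto)
  also have "\<dots> = M * (s * I)" by (simp add: \<xi>int)
  finally have "\<bar>\<integral>z. (bump_at b \<delta> c z - bump_at b \<delta> c' z) * f z \<partial>lebesgue_on D\<bar> \<le> M * s * I"
    unfolding weak by simp
  also have "(\<integral>z. (bump_at b \<delta> c z - bump_at b \<delta> c' z) * f z \<partial>lebesgue_on D)
      = (\<integral>z. bump_at b \<delta> c z * f z \<partial>lebesgue_on D) - (\<integral>z. bump_at b \<delta> c' z * f z \<partial>lebesgue_on D)"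
    using A(1)[OF close] A'(1)[OF close'] by (simp add: left_diff_distrib)
  finally have "\<bar>f c' * I - f c * I\<bar> \<le> M * s * I + \<kappa>/2 * I + \<kappa>/2 * I"
    using A(2)[OF close] A'(2)[OF close'] by linarith
  then have "\<bar>f c' - f c\<bar> * I \<le> (M * s + \<kappa>) * I"
    using I abs_mult[of "f c' - f c" I] by (simp add: algebra_simps)
  then show "\<bar>f (c + s *\<^sub>R e) - f c\<bar> \<le> M * s + \<kappa>"
    using I by (simp add: c'_def)
qed

section \<open>Derivatives along zero sets\<close>

lemma has_derivative_grad:
  fixes f :: "'a::euclidean_space \<Rightarrow> real"
  assumes "(f has_derivative f') (at x)"
  shows "f' = (\<lambda>h. h \<bullet> grad f x)"
proof -
  define D where "D = (\<Sum>b\<in>Basis. f' b *\<^sub>R b)"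
  interpret bounded_linear f' using assms by (rule has_derivative_bounded_linear)
  have f': "f' h = h \<bullet> D" for h
  proof -
    have "f' h = f' (\<Sum>b\<in>Basis. (h \<bullet> b) *\<^sub>R b)" by (simp add: euclidean_representation)
    also have "\<dots> = h \<bullet> D" by (simp add: sum scale D_def inner_sum_right mult.commute)
    finally show ?thesis .
  qed
  then have "GDERIV f x :> D"
    using assms by (simp add: gderiv_def) (metis ext)
  moreover have "E = D" if "GDERIV f x :> E" for E
  proof -
    have "f' = (\<lambda>h. h \<bullet> E)"
      using assms that by (auto simp: gderiv_def intro: has_derivative_unique)
    then have "(D - E) \<bullet> (D - E) = 0" using f' by (metis inner_diff_right right_minus_eq)
    then show ?thesis by simp
  qed
  ultimately have "grad f x = D" unfolding grad_def by (rule the_equality)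
  then show ?thesis using f' by auto
qed

lemma grad_unique:
  fixes f :: "'a::euclidean_space \<Rightarrow> real"
  assumes "(f has_derivative (\<lambda>h. h \<bullet> p)) (at x)"
  shows "grad f x = p"
proof -
  have "h \<bullet> grad f x = h \<bullet> p" for h
    using fun_cong[OF has_derivative_grad[OF assms], of h] by simp
  then have "(grad f x - p) \<bullet> (grad f x - p) = 0" by (simp add: inner_diff_right)
  then show ?thesis by simp
qed

lemma differentiable_grad:
  fixes f :: "'a::euclidean_space \<Rightarrow> real"
  assumes "f differentiable (at x)"
  shows "(f has_derivative (\<lambda>h. h \<bullet> grad f x)) (at x)"
proof -
  have d: "(f has_derivative frechet_derivative f (at x)) (at x)"
    using assms by (simp add: frechet_derivative_works)
  show ?thesis using d unfolding has_derivative_grad[OF d] .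
qed

text \<open>
  A substitute for the implicit function theorem that only needs differentiability at the point
  itself. In the direction \<open>w\<close> annihilated by the derivative the function is \<open>o(s)\<close>, whereas moving
  by \<open>\<plusminus>\<eta> q\<close> changes it by a multiple of \<open>s\<close>; the intermediate value theorem finds a zero in
  between.
\<close>

lemma zero_set_direction:
  fixes u :: "'a::real_normed_vector \<Rightarrow> real"
  assumes u: "(u has_derivative u') (at z)" "u z = 0"
    and V: "open V" "z \<in> V" "continuous_on V u"
    and q: "0 < u' q" and w: "u' w = 0" and \<eta>: "0 < \<eta>"
  shows "\<forall>\<^sub>F s in at_right 0. \<exists>c. \<bar>c\<bar> \<le> \<eta> \<and> z + s *\<^sub>R (w + c *\<^sub>R q) \<in> V \<and> u (z + s *\<^sub>R (w + c *\<^sub>R q)) = 0"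
proof -
  interpret bounded_linear u' using u(1) by (rule has_derivative_bounded_linear)
  define R where "R = norm w + \<eta> * norm q + 1"
  have R: "0 < R" unfolding R_def using \<eta> by (simp add: add_nonneg_pos)
  define \<kappa> where "\<kappa> = \<eta> * u' q / R"
  have \<kappa>: "0 < \<kappa>" unfolding \<kappa>_def using \<eta> q R by simp
  obtain d where d: "0 < d" "\<And>y. norm (y - z) < d \<Longrightarrow> norm (u y - u z - u' (y - z)) \<le> \<kappa> * norm (y - z)"
    using u(1) \<kappa> unfolding has_derivative_at_alt by blast
  obtain r where r: "0 < r" "ball z r \<subseteq> V" using V by (meson openE)
  have "\<forall>\<^sub>F s in at_right 0. 0 < s \<and> s < d / R \<and> s < r / R"
    using d(1) r(1) R by (intro eventually_conj eventually_at_right_less eventually_at_rightI[of 0 "d / R"]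
        eventually_at_rightI[of 0 "r / R"]) auto
  then show ?thesis
  proof eventually_elim
    case (elim s)
    have size: "norm (s *\<^sub>R (w + c *\<^sub>R q)) \<le> s * R" "s * R < d" "s * R < r" if "\<bar>c\<bar> \<le> \<eta>" for c
    proof -
      have "norm (w + c *\<^sub>R q) \<le> norm w + \<bar>c\<bar> * norm q" by (rule norm_triangle_le) simp
      also have "\<dots> \<le> R" unfolding R_def using that by (simp add: mult_right_mono add_increasing2)
      finally show "norm (s *\<^sub>R (w + c *\<^sub>R q)) \<le> s * R" using elim by simp
      show "s * R < d" "s * R < r" using elim R by (simp_all add: field_simps)
    qed
    have inV: "z + s *\<^sub>R (w + c *\<^sub>R q) \<in> V" if "\<bar>c\<bar> \<le> \<eta>" for c
      using size[OF that] r(2) by (auto simp: dist_norm norm_minus_commute intro!: subsetD[OF r(2)])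
    have est: "\<bar>u (z + s *\<^sub>R (w + c *\<^sub>R q)) - s * c * u' q\<bar> \<le> s * (\<eta> * u' q)" if "\<bar>c\<bar> \<le> \<eta>" for c
    proof -
      have "\<bar>u (z + s *\<^sub>R (w + c *\<^sub>R q)) - s * c * u' q\<bar> \<le> \<kappa> * norm (s *\<^sub>R (w + c *\<^sub>R q))"
        using d(2)[of "z + s *\<^sub>R (w + c *\<^sub>R q)"] size[OF that] u(2) by (simp add: scale add w)
      also have "\<dots> \<le> \<kappa> * (s * R)" using size(1)[OF that] \<kappa> by simp
      also have "\<dots> = s * (\<eta> * u' q)" unfolding \<kappa>_def using R by simp
      finally show ?thesis .
    qed
    have "\<exists>c\<ge>-\<eta>. c \<le> \<eta> \<and> u (z + s *\<^sub>R (w + c *\<^sub>R q)) = 0"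
    proof (rule IVT')
      show "u (z + s *\<^sub>R (w + (- \<eta>) *\<^sub>R q)) \<le> 0" "0 \<le> u (z + s *\<^sub>R (w + \<eta> *\<^sub>R q))"
        using est[of "- \<eta>"] est[of \<eta>] \<eta> by (simp_all add: abs_le_iff algebra_simps)
      show "continuous_on {- \<eta>..\<eta>} (\<lambda>c. u (z + s *\<^sub>R (w + c *\<^sub>R q)))"
        by (rule continuous_on_compose2[OF V(3)]) (use inV in \<open>auto intro!: continuous_intros\<close>)
    qed (use \<eta> in simp)
    then obtain c where "- \<eta> \<le> c" "c \<le> \<eta>" "u (z + s *\<^sub>R (w + c *\<^sub>R q)) = 0" by blast
    moreover from this have "\<bar>c\<bar> \<le> \<eta>" by simp
    ultimately show ?case using inV by blast
  qed
qed

text \<open>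
  First order condition at a maximum over a set that contains points arbitrarily close to the
  direction \<open>w\<close>, in the form in which \<open>zero_set_direction\<close> provides them.
\<close>

lemma derivative_le_0_along:
  fixes G :: "'a::real_normed_vector \<Rightarrow> real"
  assumes G: "(G has_derivative G') (at z within S)"
    and dirs: "\<And>\<eta>. 0 < \<eta> \<Longrightarrow> \<forall>\<^sub>F s in at_right 0. \<exists>\<zeta>. norm (\<zeta> - w) \<le> \<eta> \<and>
      z + s *\<^sub>R \<zeta> \<in> S \<and> G (z + s *\<^sub>R \<zeta>) \<le> G z"
  shows "G' w \<le> 0"
proof (rule ccontr)
  interpret bounded_linear G' using G by (rule has_derivative_bounded_linear)
  assume "\<not> G' w \<le> 0"
  then have m: "0 < G' w" by simp
  obtain K where K: "0 < K" "\<And>x. norm (G' x) \<le> norm x * K" using pos_bounded by blast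
  define \<eta> where "\<eta> = G' w / (4 * K)"
  have \<eta>: "0 < \<eta>" unfolding \<eta>_def using m K by simp
  define R where "R = norm w + \<eta>"
  have R: "0 < R" unfolding R_def using \<eta> by (simp add: add_nonneg_pos)
  obtain d where d: "0 < d" "\<And>y. y \<in> S \<Longrightarrow> norm (y - z) < d \<Longrightarrow>
      norm (G y - G z - G' (y - z)) \<le> G' w / (4 * R) * norm (y - z)"
    using G m R unfolding has_derivative_within_alt by (metis divide_pos_pos mult_pos_pos zero_less_numeral)
  have "\<forall>\<^sub>F s in at_right 0. 0 < s \<and> s < d / R"
    using d(1) R by (intro eventually_conj eventually_at_right_less eventually_at_rightI[of 0 "d / R"]) auto
  with dirs[OF \<eta>] have "\<forall>\<^sub>F s in at_right (0::real). False"
  proof eventually_elim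
    case (elim s)
    then obtain \<zeta> where \<zeta>: "norm (\<zeta> - w) \<le> \<eta>" "z + s *\<^sub>R \<zeta> \<in> S" "G (z + s *\<^sub>R \<zeta>) \<le> G z" and s: "0 < s" "s < d / R"
      by blast
    have n: "norm \<zeta> \<le> R" using \<zeta>(1) norm_triangle_sub[of \<zeta> w] by (simp add: R_def)
    then have "norm (s *\<^sub>R \<zeta>) \<le> s * R" using s by simp
    also have "s * R < d" using s R by (simp add: field_simps)
    finally have "norm (G (z + s *\<^sub>R \<zeta>) - G z - s * G' \<zeta>) \<le> G' w / (4 * R) * norm (s *\<^sub>R \<zeta>)"
      using d(2)[OF \<zeta>(2)] by (simp add: scale)
    also have "\<dots> \<le> G' w / (4 * R) * (s * R)"
      using \<open>norm (s *\<^sub>R \<zeta>) \<le> s * R\<close> m R by (intro mult_left_mono) auto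
    also have "\<dots> = s * (G' w / 4)" using R by simp
    finally have "s * G' \<zeta> \<le> s * (G' w / 4)" using \<zeta>(3) unfolding real_norm_def by linarith
    then have "G' \<zeta> \<le> G' w / 4" using s by simp
    moreover have "\<bar>G' \<zeta> - G' w\<bar> \<le> G' w / 4"
    proof -
      have "\<bar>G' \<zeta> - G' w\<bar> \<le> norm (\<zeta> - w) * K" using K(2)[of "\<zeta> - w"] by (simp add: diff)
      also have "\<dots> \<le> \<eta> * K" using \<zeta>(1) K(1) by simp
      also have "\<dots> = G' w / 4" unfolding \<eta>_def using K(1) by simp
      finally show ?thesis .
    qed
    ultimately show False using m by (simp add: abs_le_iff)
  qed
  then show False by simp
qed

lemma derivative_bound_of_local_bound:
  assumes f: "(f has_derivative f') (at x)"
    and le: "\<forall>\<^sub>F y in at x. norm (f y - f x) \<le> L * norm (y - x)"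
  shows "norm (f' h) \<le> L * norm h"
proof (rule field_le_epsilon)
  interpret bounded_linear f' using f by (rule has_derivative_bounded_linear)
  fix \<kappa> :: real assume "0 < \<kappa>"
  show "norm (f' h) \<le> L * norm h + \<kappa>"
  proof (cases "h = 0")
    case False
    then have "0 < norm h" by simp
    obtain d where d: "0 < d" "\<And>y. norm (y - x) < d \<Longrightarrow>
        norm (f y - f x - f' (y - x)) \<le> \<kappa> / norm h * norm (y - x)"
      using f \<open>0 < \<kappa>\<close> \<open>0 < norm h\<close> unfolding has_derivative_at_alt by (metis divide_pos_pos)
    obtain d' where d': "0 < d'" "\<And>y. y \<noteq> x \<Longrightarrow> norm (y - x) < d' \<Longrightarrow> norm (f y - f x) \<le> L * norm (y - x)"
      using le unfolding eventually_at dist_norm by blast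
    define s where "s = min d d' / (2 * norm h)"
    have s: "0 < s" "s * norm h < d" "s * norm h < d'"
      unfolding s_def using d(1) d'(1) \<open>0 < norm h\<close> by (auto simp: min_def)
    have "s * norm (f' h) \<le> norm (f (x + s *\<^sub>R h) - f x) + norm (f (x + s *\<^sub>R h) - f x - f' (s *\<^sub>R h))"
      using norm_triangle_ineq4[of "f (x + s *\<^sub>R h) - f x" "f (x + s *\<^sub>R h) - f x - f' (s *\<^sub>R h)"] s
      by (simp add: scaleR)
    also have "\<dots> \<le> L * (s * norm h) + \<kappa> / norm h * (s * norm h)"
      using d(2)[of "x + s *\<^sub>R h"] d'(2)[of "x + s *\<^sub>R h"] s False by (intro add_mono) auto
    also have "\<dots> = s * (L * norm h + \<kappa>)" using \<open>0 < norm h\<close> by (simp add: algebra_simps)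
    finally show ?thesis using s(1) by simp
  qed (use \<open>0 < \<kappa>\<close> in \<open>simp add: zero\<close>)
qed

section \<open>Normals of hypersurfaces\<close>

text \<open>
  An open half space contained in a closed one has the same normal. In this form, conormals that are
  only known through one-sided information about a set can be compared.
\<close>

lemma half_space_subset_imp_sgn_eq:
  fixes p q :: "'a::real_inner"
  assumes "p \<noteq> 0" "q \<noteq> 0" and le: "\<And>w. w \<bullet> p < 0 \<Longrightarrow> w \<bullet> q \<le> 0"
  shows "sgn p = sgn q"
proof -
  have orth: "w \<bullet> q \<le> 0" if "w \<bullet> p = 0" for w
  proof (rule field_le_epsilon)
    fix \<kappa> :: real assume "0 < \<kappa>"
    define s where "s = \<kappa> / (\<bar>p \<bullet> q\<bar> + 1)"
    have s: "0 < s" "s * (p \<bullet> q) \<le> \<kappa>"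
    proof -
      show "0 < s" unfolding s_def using \<open>0 < \<kappa>\<close> by (simp add: add_nonneg_pos)
      then have "s * (p \<bullet> q) \<le> s * (\<bar>p \<bullet> q\<bar> + 1)" by (intro mult_left_mono) auto
      also have "\<dots> = \<kappa>" unfolding s_def by (simp add: add_nonneg_eq_0_iff)
      finally show "s * (p \<bullet> q) \<le> \<kappa>" .
    qed
    have "(w - s *\<^sub>R p) \<bullet> p < 0" using s that \<open>p \<noteq> 0\<close> by (simp add: inner_diff_left)
    from le[OF this] show "w \<bullet> q \<le> 0 + \<kappa>" using s(2) by (simp add: inner_diff_left)
  qed
  define c where "c = (q \<bullet> p) / (p \<bullet> p)"
  define w where "w = q - c *\<^sub>R p"
  have wp: "w \<bullet> p = 0" unfolding w_def c_def using \<open>p \<noteq> 0\<close> by (simp add: inner_diff_left)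
  then have "w \<bullet> q = 0" using orth[of w] orth[of "- w"] by simp
  moreover have "w \<bullet> w = w \<bullet> q - c * (w \<bullet> p)"
    by (simp add: w_def inner_diff_right)
  ultimately have "w \<bullet> w = 0" using wp by simp
  then have q: "q = c *\<^sub>R p" by (simp add: w_def)
  have "0 \<le> q \<bullet> p" using le[of "- p"] \<open>p \<noteq> 0\<close> by (simp add: inner_commute)
  then have "0 \<le> c" by (simp add: c_def)
  moreover have "c \<noteq> 0" using q \<open>q \<noteq> 0\<close> by (metis scale_zero_left)
  ultimately have "0 < c" by simp
  then show ?thesis by (simp add: q sgn_div_norm)
qed

text \<open>
  What a defining function says about the set to first order at the single point \<open>x\<close>; the vector \<open>p\<close>
  is the gradient there and points out of \<open>A\<close>.
\<close>

definition conormal :: "(real^3) set \<Rightarrow> real^3 \<Rightarrow> real^3 \<Rightarrow> bool" where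
  "conormal A x p \<longleftrightarrow> p \<noteq> 0 \<and> (\<exists>V \<psi>. open V \<and> x \<in> V \<and> continuous_on V \<psi> \<and> \<psi> x = 0 \<and>
     (\<psi> has_derivative (\<lambda>h. h \<bullet> p)) (at x) \<and>
     (\<forall>y\<in>V. (y \<in> A \<longleftrightarrow> \<psi> y < 0) \<and> (y \<in> frontier A \<longleftrightarrow> \<psi> y = 0)))"

lemma defining_function_imp_conormal:
  assumes "defining_function 1 A V \<psi>" "x \<in> V" "x \<in> frontier A"
  shows "conormal A x (grad \<psi> x)"
proof -
  have "continuous_on V \<psi>" using assms Ck_on_mono[of 1 V \<psi> 0] by (simp add: defining_function_def)
  moreover have "(\<psi> has_derivative (\<lambda>h. h \<bullet> grad \<psi> x)) (at x)"
    by (rule differentiable_grad) (use assms in \<open>simp add: defining_function_def\<close>)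
  moreover have "open V" "grad \<psi> x \<noteq> 0" "\<psi> x = 0"
    "\<forall>y\<in>V. (y \<in> A \<longleftrightarrow> \<psi> y < 0) \<and> (y \<in> frontier A \<longleftrightarrow> \<psi> y = 0)"
    using assms unfolding defining_function_def by blast+
  ultimately show ?thesis
    unfolding conormal_def using assms(2) by (intro conjI exI[of _ V] exI[of _ \<psi>]) simp_all
qed

lemma conormal_scale:
  assumes "conormal A x p" "0 < c"
  shows "conormal A x (c *\<^sub>R p)"
proof -
  obtain V \<psi> where V: "open V" "x \<in> V" "continuous_on V \<psi>" "\<psi> x = 0"
    "(\<psi> has_derivative (\<lambda>h. h \<bullet> p)) (at x)"
    "\<forall>y\<in>V. (y \<in> A \<longleftrightarrow> \<psi> y < 0) \<and> (y \<in> frontier A \<longleftrightarrow> \<psi> y = 0)"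
    using assms(1) unfolding conormal_def by blast
  have "((\<lambda>y. c * \<psi> y) has_derivative (\<lambda>h. h \<bullet> (c *\<^sub>R p))) (at x)"
    using has_derivative_mult_right[OF V(5), of c] by simp
  moreover have "continuous_on V (\<lambda>y. c * \<psi> y)" using V(3) by (intro continuous_intros)
  moreover have "\<forall>y\<in>V. (y \<in> A \<longleftrightarrow> c * \<psi> y < 0) \<and> (y \<in> frontier A \<longleftrightarrow> c * \<psi> y = 0)"
    using V(6) \<open>0 < c\<close> by (simp add: mult_less_0_iff)
  ultimately show ?thesis
    using assms V(1,2,4) unfolding conormal_def
    by (intro conjI exI[of _ V] exI[of _ "\<lambda>y. c * \<psi> y"]) auto
qed

text \<open>A conormal decides the side of the surface on which a short segment from \<open>x\<close> lies.\<close>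

lemma conormal_eventually:
  assumes "conormal A x p"
  shows conormal_eventually_in: "w \<bullet> p < 0 \<Longrightarrow> \<forall>\<^sub>F s in at_right 0. x + s *\<^sub>R w \<in> A"
    and conormal_eventually_notin: "0 < w \<bullet> p \<Longrightarrow> \<forall>\<^sub>F s in at_right 0. x + s *\<^sub>R w \<notin> A"
proof -
  obtain V \<psi> where V: "open V" "x \<in> V" "\<psi> x = 0"
    "(\<psi> has_derivative (\<lambda>h. h \<bullet> p)) (at x)" "\<forall>y\<in>V. (y \<in> A \<longleftrightarrow> \<psi> y < 0)"
    using assms(1) unfolding conormal_def by blast
  have inV: "\<forall>\<^sub>F s in at_right 0. x + s *\<^sub>R w \<in> V" for w
  proof -
    have "((\<lambda>s. x + s *\<^sub>R w) \<longlongrightarrow> x) (at_right 0)" by (auto intro!: tendsto_eq_intros)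
    then show ?thesis using V(1,2) by (rule topological_tendstoD)
  qed
  have "((\<lambda>s. \<psi> (x + s *\<^sub>R w)) has_real_derivative (w \<bullet> p)) (at 0)" for w
  proof -
    have "((\<lambda>s. x + s *\<^sub>R w) has_derivative (\<lambda>s. s *\<^sub>R w)) (at 0)"
      by (auto intro!: derivative_eq_intros)
    from diff_chain_at[OF this, of \<psi> "\<lambda>h. h \<bullet> p"] V(4) show ?thesis
      by (simp add: o_def has_field_derivative_def mult_commute_abs)
  qed
  then have lim: "((\<lambda>s. \<psi> (x + s *\<^sub>R w) / s) \<longlongrightarrow> w \<bullet> p) (at_right 0)" for w
    unfolding has_field_derivative_iff using V(3) by (simp add: filterlim_at_split)
  show "\<forall>\<^sub>F s in at_right 0. x + s *\<^sub>R w \<in> A" if "w \<bullet> p < 0"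
    using order_tendstoD(2)[OF lim that] inV[of w] eventually_at_right_less[of "0::real"]
    by eventually_elim (use V(5) in \<open>auto simp: divide_less_0_iff\<close>)
  show "\<forall>\<^sub>F s in at_right 0. x + s *\<^sub>R w \<notin> A" if "0 < w \<bullet> p"
    using order_tendstoD(1)[OF lim that] inV[of w] eventually_at_right_less[of "0::real"]
    by eventually_elim (use V(5) in \<open>auto simp: zero_less_divide_iff\<close>)
qed

lemma conormal_unique:
  assumes p: "conormal A x p" and q: "conormal A x q"
  shows "sgn p = sgn q"
proof (rule half_space_subset_imp_sgn_eq)
  fix w assume "w \<bullet> p < 0"
  show "w \<bullet> q \<le> 0"
  proof (rule ccontr)
    assume "\<not> w \<bullet> q \<le> 0"
    then have "0 < w \<bullet> q" by simp
    from conormal_eventually_notin[OF q this] conormal_eventually_in[OF p \<open>w \<bullet> p < 0\<close>]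
    have "\<forall>\<^sub>F s in at_right (0::real). False" by eventually_elim blast
    then show False by simp
  qed
qed (use p q in \<open>auto simp: conormal_def\<close>)

text \<open>The description defining the outer normal is unique, because all conormals at a point are
  positive multiples of each other.\<close>

lemma outer_normal_eq:
  assumes "defining_function 1 A V \<psi>" "x \<in> V" "x \<in> frontier A"
  shows "outer_normal A x = sgn (grad \<psi> x)"
  unfolding outer_normal_def
proof (rule the_equality)
  show "\<exists>V \<psi>'. x \<in> V \<and> defining_function 1 A V \<psi>' \<and> sgn (grad \<psi> x) = grad \<psi>' x /\<^sub>R norm (grad \<psi>' x)"
    using assms by (auto simp: sgn_div_norm)
  fix \<nu> assume "\<exists>V \<psi>. x \<in> V \<and> defining_function 1 A V \<psi> \<and> \<nu> = grad \<psi> x /\<^sub>R norm (grad \<psi> x)"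
  then show "\<nu> = sgn (grad \<psi> x)"
    using conormal_unique defining_function_imp_conormal assms by (metis sgn_div_norm)
qed

lemma defining_function_mono: "defining_function k A V \<psi> \<Longrightarrow> j \<le> k \<Longrightarrow> defining_function j A V \<psi>"
  unfolding defining_function_def using Ck_on_mono by blast

lemma outer_normal_conormal:
  assumes "Ck_boundary k A" "1 \<le> k" "x \<in> frontier A"
  shows "conormal A x (outer_normal A x)" "norm (outer_normal A x) = 1"
proof -
  obtain V \<psi> where V: "x \<in> V" "defining_function 1 A V \<psi>"
    using assms unfolding Ck_boundary_def by (meson defining_function_mono)
  have c: "conormal A x (grad \<psi> x)" by (rule defining_function_imp_conormal[OF V(2,1) assms(3)])
  then have "grad \<psi> x \<noteq> 0" by (simp add: conormal_def)
  then show "conormal A x (outer_normal A x)" "norm (outer_normal A x) = 1"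
    unfolding outer_normal_eq[OF V(2,1) assms(3)] using conormal_scale[OF c, of "inverse (norm (grad \<psi> x))"]
    by (simp_all add: sgn_div_norm)
qed

text \<open>
  The ball around \<open>y\<close> does not meet the surface, so it lies entirely on one side. All directions
  from the touching point \<open>x\<close> into the ball, an open half space, therefore stay on this side, which
  forces the conormal to be parallel to \<open>y - x\<close>.
\<close>

lemma nearest_point_normal:
  assumes p: "conormal A x p" "norm p = 1"
    and r: "dist y x = r" "0 < r" and empty: "ball y r \<inter> frontier A = {}"
  shows "y = (if y \<in> A then x - r *\<^sub>R p else x + r *\<^sub>R p)"
proof -
  define u where "u = y - x"
  have u: "norm u = r" using r by (simp add: u_def dist_norm)
  have side: "z \<in> A \<longleftrightarrow> y \<in> A" if "z \<in> ball y r" for z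
  proof -
    have "ball y r \<inter> A = {} \<or> ball y r \<subseteq> A"
      using connected_Int_frontier[of "ball y r" A] empty by auto
    moreover have "y \<in> ball y r" using r(2) by simp
    ultimately show ?thesis using that by blast
  qed
  have inball: "\<forall>\<^sub>F s in at_right 0. x + s *\<^sub>R w \<in> ball y r" if "0 < w \<bullet> u" for w
  proof -
    have "((\<lambda>s. s * (w \<bullet> w)) \<longlongrightarrow> 0) (at_right 0)" by (auto intro!: tendsto_eq_intros)
    moreover have "0 < 2 * (w \<bullet> u)" using that by simp
    ultimately have "\<forall>\<^sub>F s in at_right 0. s * (w \<bullet> w) < 2 * (w \<bullet> u)"
      by (rule order_tendstoD(2))
    then show ?thesis using eventually_at_right_less[of "0::real"]
    proof eventually_elim
      case (elim s)
      have "(dist y (x + s *\<^sub>R w))\<^sup>2 = (u - s *\<^sub>R w) \<bullet> (u - s *\<^sub>R w)"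
        by (simp add: dist_norm u_def dot_square_norm algebra_simps)
      also have "\<dots> = r\<^sup>2 + s * (s * (w \<bullet> w) - 2 * (w \<bullet> u))"
      proof -
        have "u \<bullet> u = r\<^sup>2" using u by (simp add: dot_square_norm)
        then show ?thesis
          by (simp add: inner_diff_left inner_diff_right inner_commute[of w u] algebra_simps)
      qed
      also have "\<dots> < r\<^sup>2" using elim by (simp add: mult_less_0_iff)
      finally show ?case using r(2) power2_less_imp_less[of "dist y (x + s *\<^sub>R w)" r] by simp
    qed
  qed
  have "sgn (- u) = sgn (if y \<in> A then p else - p)"
  proof (rule half_space_subset_imp_sgn_eq)
    show "- u \<noteq> 0" "(if y \<in> A then p else - p) \<noteq> 0" using u r(2) p(2) by auto
    fix w assume "w \<bullet> - u < 0"
    then have "0 < w \<bullet> u" by simp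
    note b = inball[OF this]
    show "w \<bullet> (if y \<in> A then p else - p) \<le> 0"
    proof (rule ccontr)
      assume neg: "\<not> w \<bullet> (if y \<in> A then p else - p) \<le> 0"
      have "\<forall>\<^sub>F s in at_right (0::real). False"
      proof (cases "y \<in> A")
        case True
        with neg have "0 < w \<bullet> p" by simp
        from conormal_eventually_notin[OF p(1) this] b show ?thesis
          by eventually_elim (use side True in blast)
      next
        case False
        with neg have "w \<bullet> p < 0" by simp
        from conormal_eventually_in[OF p(1) this] b show ?thesis
          by eventually_elim (use side False in blast)
      qed
      then show False by simp
    qed
  qed
  then have "- u = r *\<^sub>R (if y \<in> A then p else - p)"
    using u r(2) p(2) by (simp add: sgn_div_norm split: if_splits) (metis inverse_eq_divide
      mult.commute nonzero_divide_eq_eq scaleR_minus_right scaleR_one scaleR_scaleR less_irrefl)+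
  then show ?thesis by (auto simp: u_def algebra_simps)
qed

text \<open>
  Existence: a derivative within the surface remains one after its normal component is removed,
  because the defining function vanishes on the surface and so the normal component of an
  increment is of higher order. Uniqueness: every tangential direction is attained by points of the
  surface up to a small error (\<open>zero_set_direction\<close>).
\<close>

lemma surface_deriv_works:
  fixes f :: "real^3 \<Rightarrow> real"
  assumes n: "conormal A x (outer_normal A x)" "norm (outer_normal A x) = 1"
    and f: "f differentiable (at x within frontier A)"
  shows "(f has_derivative surface_deriv A f x) (at x within frontier A)"
proof -
  let ?n = "outer_normal A x"
  obtain V \<psi> where V: "open V" "x \<in> V" "continuous_on V \<psi>" "\<psi> x = 0"
    "(\<psi> has_derivative (\<lambda>h. h \<bullet> ?n)) (at x)" "\<forall>y\<in>V. (y \<in> frontier A \<longleftrightarrow> \<psi> y = 0)"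
    using n(1) unfolding conormal_def by blast
  obtain f' where f': "(f has_derivative f') (at x within frontier A)"
    using f unfolding differentiable_def by blast
  then interpret bounded_linear f' by (rule has_derivative_bounded_linear)
  define L where "L w = f' (w - (w \<bullet> ?n) *\<^sub>R ?n)" for w
  have "((\<lambda>y. f y - \<psi> y * f' ?n) has_derivative (\<lambda>h. f' h - (h \<bullet> ?n) * f' ?n)) (at x within frontier A)"
    by (rule has_derivative_diff[OF f' has_derivative_mult_left[OF has_derivative_at_withinI[OF V(5)]]])
  moreover have "(\<lambda>h. f' h - (h \<bullet> ?n) * f' ?n) = L" by (simp add: L_def fun_eq_iff diff scale)
  ultimately have "((\<lambda>y. f y - \<psi> y * f' ?n) has_derivative L) (at x within frontier A)" by simp
  moreover have "\<forall>\<^sub>F y in at x within frontier A. f y - \<psi> y * f' ?n = f y"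
    using eventually_at_in_open'[OF V(1,2)] V(6) unfolding eventually_at_filter
    by (auto elim!: eventually_mono)
  ultimately have L: "(f has_derivative L) (at x within frontier A)"
    by (rule has_derivative_transform_eventually) (use V(2,4,6) in auto)
  have Ln: "L ?n = 0" using n(2) by (simp add: L_def dot_square_norm zero)
  have unique: "M = L" if M: "(f has_derivative M) (at x within frontier A)" "M ?n = 0" for M
  proof -
    interpret M: bounded_linear M using M(1) by (rule has_derivative_bounded_linear)
    interpret L: bounded_linear L using L by (rule has_derivative_bounded_linear)
    have dirs: "\<forall>\<^sub>F s in at_right 0. \<exists>\<zeta>. norm (\<zeta> - w) \<le> \<eta> \<and> x + s *\<^sub>R \<zeta> \<in> frontier A \<and> (0::real) \<le> 0"
      if "w \<bullet> ?n = 0" "0 < \<eta>" for w \<eta>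
    proof -
      have "0 < ?n \<bullet> ?n" using n(2) by (simp add: dot_square_norm)
      from zero_set_direction[OF V(5,4,1,2,3) this that] show ?thesis
      proof eventually_elim
        case (elim s)
        then obtain c where "\<bar>c\<bar> \<le> \<eta>" "x + s *\<^sub>R (w + c *\<^sub>R ?n) \<in> frontier A" using V(6) by blast
        then show ?case using n(2) by (intro exI[of _ "w + c *\<^sub>R ?n"]) simp
      qed
    qed
    have eq: "M w = L w" if "w \<bullet> ?n = 0" for w
    proof -
      have d: "((\<lambda>y. 0) has_derivative (\<lambda>h. M h - L h)) (at x within frontier A)"
        "((\<lambda>y. 0) has_derivative (\<lambda>h. L h - M h)) (at x within frontier A)"
        using has_derivative_diff[OF M(1) L] has_derivative_diff[OF L M(1)] by simp_all
      show ?thesis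
        using derivative_le_0_along[OF d(1) dirs[OF that]] derivative_le_0_along[OF d(2) dirs[OF that]]
        by simp
    qed
    show "M = L"
    proof
      fix w
      let ?w = "w - (w \<bullet> ?n) *\<^sub>R ?n"
      have "?w \<bullet> ?n = 0" using n(2) by (simp add: inner_diff_left dot_square_norm)
      then have "M ?w = L ?w" by (rule eq)
      then show "M w = L w" using M(2) Ln by (simp add: M.diff L.diff M.scale L.scale)
    qed
  qed
  have "surface_deriv A f x = L"
    unfolding surface_deriv_def
  proof (rule the_equality)
    show "(f has_derivative L) (at x within frontier A) \<and> L ?n = 0" using L Ln by (rule conjI)
    show "M = L" if "(f has_derivative M) (at x within frontier A) \<and> M ?n = 0" for M
      using that by (intro unique) (rule conjunct1, assumption, rule conjunct2)
  qed
  with L show ?thesis by (simp only:)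
qed

section \<open>The tubular neighbourhood of the reference surface\<close>

text \<open>Partial derivatives are bounded on a compact ball, and they bound the whole derivative.\<close>

lemma C1_bounded_derivative:
  fixes f :: "'a::euclidean_space \<Rightarrow> 'b::real_normed_vector"
  assumes V: "open V" "x \<in> V" and f: "Ck_on (Suc k) V f"
  obtains u C where "0 < u" "cball x u \<subseteq> V" "C-lipschitz_on (cball x u) f"
proof -
  obtain u where u: "0 < u" "cball x u \<subseteq> V" using V by (meson open_contains_cball)
  have "continuous_on (cball x u) (\<lambda>y. frechet_derivative f (at y) b)" if "b \<in> Basis" for b
  proof -
    have "Ck_on k V (\<lambda>y. frechet_derivative f (at y) b)" using f that by simp
    then have "continuous_on V (\<lambda>y. frechet_derivative f (at y) b)"
      using Ck_on_mono[of k V _ 0] by simp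
    then show ?thesis using u(2) by (rule continuous_on_subset)
  qed
  then have "continuous_on (cball x u) (\<lambda>y. \<Sum>b\<in>Basis. norm (frechet_derivative f (at y) b))"
    by (intro continuous_on_sum continuous_on_norm)
  then have "bounded ((\<lambda>y. \<Sum>b\<in>Basis. norm (frechet_derivative f (at y) b)) ` cball x u)"
    by (intro compact_imp_bounded compact_continuous_image) auto
  then obtain C where C: "\<And>y. y \<in> cball x u \<Longrightarrow> (\<Sum>b\<in>Basis. norm (frechet_derivative f (at y) b)) \<le> C"
    unfolding bounded_iff by (force simp: sum_nonneg)
  have d: "(f has_derivative frechet_derivative f (at y)) (at y)" if "y \<in> cball x u" for y
    using f that u(2) by (auto simp: frechet_derivative_works[symmetric])
  have "C-lipschitz_on (cball x u) f"
  proof (rule bounded_derivative_imp_lipschitz)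
    have "0 \<le> (\<Sum>b\<in>Basis. norm (frechet_derivative f (at x) b))" by (simp add: sum_nonneg)
    also have "\<dots> \<le> C" using u(1) by (intro C) simp
    finally show "0 \<le> C" .
    fix y assume y: "y \<in> cball x u"
    let ?f' = "frechet_derivative f (at y)"
    show "(f has_derivative ?f') (at y within cball x u)"
      using d[OF y] by (rule has_derivative_at_withinI)
    show "onorm ?f' \<le> C"
    proof (rule onorm_bound)
      interpret bounded_linear ?f' using d[OF y] by (rule has_derivative_bounded_linear)
      fix h
      have "norm (?f' h) = norm (\<Sum>b\<in>Basis. (h \<bullet> b) *\<^sub>R ?f' b)"
        by (subst (1) euclidean_representation[symmetric]) (simp add: sum scaleR)
      also have "\<dots> \<le> (\<Sum>b\<in>Basis. norm ((h \<bullet> b) *\<^sub>R ?f' b))" by (rule norm_sum)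
      also have "\<dots> \<le> (\<Sum>b\<in>Basis. norm h * norm (?f' b))"
        by (intro sum_mono) (simp add: Basis_le_norm mult_right_mono)
      also have "\<dots> \<le> norm h * C" unfolding sum_distrib_left[symmetric] using C[OF y] by (rule mult_left_mono) simp
      finally show "norm (?f' h) \<le> C * norm h" by (simp add: mult.commute)
    qed (fact \<open>0 \<le> C\<close>)
  qed simp
  with u that show ?thesis by blast
qed

lemma Ck_map_lipschitz_on_compact:
  fixes f :: "'a::euclidean_space \<Rightarrow> 'b::real_normed_vector"
  assumes f: "Ck_map (Suc k) S f" and K: "compact K" "K \<subseteq> S"
  obtains L where "L-lipschitz_on K f"
proof -
  have "local_lipschitz {0::real} K (\<lambda>_. f)"
  proof (rule local_lipschitzI)
    fix t :: real and x assume "x \<in> K"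
    then obtain V g where V: "open V" "x \<in> V" "Ck_on (Suc k) V g" "\<forall>y\<in>S \<inter> V. g y = f y"
      using f K unfolding Ck_map_def by blast
    from C1_bounded_derivative[OF V(1-3)] obtain u C
      where u: "0 < u" "cball x u \<subseteq> V" "C-lipschitz_on (cball x u) g" .
    have "C-lipschitz_on (cball x u \<inter> K) g" using u(3) by (rule lipschitz_on_subset) simp
    then have "C-lipschitz_on (cball x u \<inter> K) f"
    proof (rule lipschitz_on_transform)
      fix y assume "y \<in> cball x u \<inter> K"
      then have "y \<in> S \<inter> V" using u(2) K(2) by blast
      with V(4) show "f y = g y" by simp
    qed
    then show "\<exists>u>0. \<exists>L. \<forall>t\<in>cball t u \<inter> {0}. L-lipschitz_on (cball x u \<inter> K) f"
      using u(1) by blast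
  qed
  note * = local_lipschitz_compact_implies_lipschitz[OF this K(1)]
  obtain L where "\<And>t. t \<in> {0::real} \<Longrightarrow> L-lipschitz_on K f"
    by (rule *) auto
  then show ?thesis by (intro that[of L]) blast
qed

locale reference_cell =
  fixes Y1 Y2 :: "(real^3) set" and a :: real
  assumes cell: "cell_geometry Y1 Y2 a"
begin

abbreviation "\<Gamma> \<equiv> frontier Y2"
abbreviation "n \<equiv> outer_normal Y2"
abbreviation "U \<equiv> tube Y2 a"

lemma a_pos: "0 < a" and open_Y2: "open Y2" and Y2_subset: "closure Y2 \<subseteq> unit_cell"
  and U_subset: "U \<subseteq> unit_cell"
  using cell by (auto simp: cell_geometry_def)

lemma Gamma_subset: "\<Gamma> \<subseteq> unit_cell"
  using Y2_subset by (auto simp: frontier_def)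

lemma unit_cell_eq_box: "unit_cell = box 0 One"
proof -
  have "y \<in> box 0 One \<longleftrightarrow> (\<forall>b\<in>Basis. 0 < y \<bullet> b \<and> y \<bullet> b < 1)" for y :: "real^3"
    by (simp add: mem_box)
  then show ?thesis by (auto simp: unit_cell_def Basis_vec_def inner_axis)
qed

lemma compact_Gamma: "compact \<Gamma>"
proof -
  have "bounded \<Gamma>" using Gamma_subset unit_cell_eq_box bounded_box bounded_subset by metis
  then show ?thesis by (simp add: compact_eq_bounded_closed)
qed

lemma normal: "\<gamma> \<in> \<Gamma> \<Longrightarrow> conormal Y2 \<gamma> (n \<gamma>)" "\<gamma> \<in> \<Gamma> \<Longrightarrow> norm (n \<gamma>) = 1"
  using cell outer_normal_conormal[of 3 Y2] by (auto simp: cell_geometry_def)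

lemma bij_tube_map: "bij_betw (tube_map Y2) (\<Gamma> \<times> {-a<..<a}) U"
  using cell by (simp add: cell_geometry_def Ck_diffeo_def)

lemma tube_coordinates_unique:
  assumes "\<gamma> \<in> \<Gamma>" "\<gamma>' \<in> \<Gamma>" "\<bar>r\<bar> < a" "\<bar>r'\<bar> < a" "\<gamma> + r *\<^sub>R n \<gamma> = \<gamma>' + r' *\<^sub>R n \<gamma>'"
  shows "\<gamma> = \<gamma>' \<and> r = r'"
proof -
  have "(\<gamma>, r) = (\<gamma>', r')"
    by (rule inj_onD[OF bij_betw_imp_inj_on[OF bij_tube_map]])
      (use assms in \<open>auto simp: tube_map_def abs_less_iff\<close>)
  then show ?thesis by simp
qed

text \<open>
  Every point, inside the tube or not, lies on the normal line through one of its nearest points. On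
  which side it lies decides the sign.
\<close>

lemma nearest_point:
  assumes "\<Gamma> \<noteq> {}"
  obtains \<gamma> where "\<gamma> \<in> \<Gamma>" "y = (if y \<in> Y2 then \<gamma> - infdist y \<Gamma> *\<^sub>R n \<gamma> else \<gamma> + infdist y \<Gamma> *\<^sub>R n \<gamma>)"
proof -
  obtain \<gamma> where \<gamma>: "\<gamma> \<in> \<Gamma>" "infdist y \<Gamma> = dist y \<gamma>"
    using infdist_attains_inf[OF frontier_closed assms] by blast
  show ?thesis
  proof (cases "y = \<gamma>")
    case False
    have "ball y (dist y \<gamma>) \<inter> \<Gamma> = {}" using \<gamma>(2) infdist_le[of _ \<Gamma> y] by force
    with nearest_point_normal[OF normal[OF \<gamma>(1)] refl, of y] False
    have "y = (if y \<in> Y2 then \<gamma> - dist y \<gamma> *\<^sub>R n \<gamma> else \<gamma> + dist y \<gamma> *\<^sub>R n \<gamma>)" by simp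
    then show ?thesis using that[OF \<gamma>(1)] by (simp only: \<gamma>(2))
  qed (use \<gamma> that in auto)
qed

text \<open>
  The nearest point of the surface provides second tube coordinates with radius \<open>\<plusminus>infdist\<close>; by
  uniqueness of the coordinates it is the given foot point.
\<close>

lemma infdist_tube:
  assumes "\<gamma> \<in> \<Gamma>" "\<bar>r\<bar> < a"
  shows "infdist (\<gamma> + r *\<^sub>R n \<gamma>) \<Gamma> = \<bar>r\<bar>"
proof -
  let ?y = "\<gamma> + r *\<^sub>R n \<gamma>"
  have "infdist ?y \<Gamma> \<le> \<bar>r\<bar>"
    using infdist_le[OF assms(1), of ?y] normal(2)[OF assms(1)] by (simp add: dist_norm)
  then have less: "\<bar>infdist ?y \<Gamma>\<bar> < a" "\<bar>- infdist ?y \<Gamma>\<bar> < a"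
    using assms(2) infdist_nonneg[of ?y \<Gamma>] by simp_all
  obtain \<gamma>' where \<gamma>': "\<gamma>' \<in> \<Gamma>"
    "?y = (if ?y \<in> Y2 then \<gamma>' - infdist ?y \<Gamma> *\<^sub>R n \<gamma>' else \<gamma>' + infdist ?y \<Gamma> *\<^sub>R n \<gamma>')"
    using nearest_point[of ?y] assms(1) by blast
  have "r = infdist ?y \<Gamma> \<or> r = - infdist ?y \<Gamma>"
  proof (cases "?y \<in> Y2")
    case True
    then have "?y = \<gamma>' + (- infdist ?y \<Gamma>) *\<^sub>R n \<gamma>'" using \<gamma>'(2) by simp
    from tube_coordinates_unique[OF assms(1) \<gamma>'(1) assms(2) less(2) this] show ?thesis by blast
  next
    case False
    then have "?y = \<gamma>' + infdist ?y \<Gamma> *\<^sub>R n \<gamma>'" using \<gamma>'(2) by simp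
    from tube_coordinates_unique[OF assms(1) \<gamma>'(1) assms(2) less(1) this] show ?thesis by blast
  qed
  then show ?thesis using infdist_nonneg[of ?y \<Gamma>] by auto
qed

text \<open>A point of \<open>Y2\<close> would have tube coordinates with a negative radius.\<close>

lemma tube_outside:
  assumes "\<gamma> \<in> \<Gamma>" "0 < r" "r < a"
  shows "\<gamma> + r *\<^sub>R n \<gamma> \<notin> closure Y2"
proof
  let ?y = "\<gamma> + r *\<^sub>R n \<gamma>"
  assume "?y \<in> closure Y2"
  have i: "infdist ?y \<Gamma> = r" using infdist_tube[OF assms(1), of r] assms by simp
  then have "?y \<notin> \<Gamma>" using assms(2) by auto
  with \<open>?y \<in> closure Y2\<close> have "?y \<in> Y2" using open_Y2 by (simp add: frontier_def interior_open)
  then obtain \<gamma>' where "\<gamma>' \<in> \<Gamma>" "?y = \<gamma>' + (- r) *\<^sub>R n \<gamma>'"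
    using nearest_point[of ?y] assms(1) i by (metis empty_iff diff_conv_add_uminus scaleR_minus_left)
  then show False
    using tube_coordinates_unique[OF assms(1), of \<gamma>' r "- r"] assms by simp
qed

lemma tube_cases:
  assumes "y \<in> U"
  obtains \<gamma> r where "\<gamma> \<in> \<Gamma>" "\<bar>r\<bar> < a" "y = \<gamma> + r *\<^sub>R n \<gamma>"
proof -
  obtain \<gamma> r where "\<gamma> \<in> \<Gamma>" "r \<in> {-a<..<a}" "y = \<gamma> + r *\<^sub>R n \<gamma>"
    using assms by (auto simp: tube_def tube_map_def)
  then show ?thesis by (intro that[of \<gamma> r]) auto
qed

text \<open>A point closer than \<open>a\<close> to the surface has tube coordinates by
  \<open>nearest_point\<close>. In particular the tube is open, without an appeal to invariance of domain.\<close>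

lemma tube_eq_infdist: "U = {y. \<Gamma> \<noteq> {} \<and> infdist y \<Gamma> < a}"
proof (intro equalityI subsetI)
  fix y assume "y \<in> U"
  then obtain \<gamma> r where "\<gamma> \<in> \<Gamma>" "\<bar>r\<bar> < a" "y = \<gamma> + r *\<^sub>R n \<gamma>"
    by (rule tube_cases)
  then show "y \<in> {y. \<Gamma> \<noteq> {} \<and> infdist y \<Gamma> < a}" using infdist_tube by auto
next
  fix y assume "y \<in> {y. \<Gamma> \<noteq> {} \<and> infdist y \<Gamma> < a}"
  then have y: "\<Gamma> \<noteq> {}" "infdist y \<Gamma> < a" by auto
  obtain \<gamma> where \<gamma>: "\<gamma> \<in> \<Gamma>" "y = (if y \<in> Y2 then \<gamma> - infdist y \<Gamma> *\<^sub>R n \<gamma> else \<gamma> + infdist y \<Gamma> *\<^sub>R n \<gamma>)"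
    using nearest_point[OF y(1)] .
  then have "y = tube_map Y2 (\<gamma>, if y \<in> Y2 then - infdist y \<Gamma> else infdist y \<Gamma>)"
    by (auto simp: tube_map_def split: if_splits)
  moreover have "(\<gamma>, if y \<in> Y2 then - infdist y \<Gamma> else infdist y \<Gamma>) \<in> \<Gamma> \<times> {-a<..<a}"
    using \<gamma>(1) y(2) infdist_nonneg[of y \<Gamma>] a_pos by (auto intro: less_le_trans)
  ultimately show "y \<in> U" unfolding tube_def by (rule image_eqI)
qed

lemma open_U: "open U"
proof (cases "\<Gamma> = {}")
  case False
  have "continuous_on UNIV (\<lambda>y. infdist y \<Gamma>)" by (intro continuous_intros)
  then have "open {y. infdist y \<Gamma> < a}" by (intro open_Collect_less) auto
  with False show ?thesis by (simp add: tube_eq_infdist)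
qed (simp add: tube_def)

text \<open>The coordinates of the inverse of the tube map, see \<open>inv_tube_map\<close>.\<close>

definition "foot y = tube_proj Y2 a y"
definition "sdist y = (y - foot y) \<bullet> n (foot y)"

lemma foot_tube: "\<gamma> \<in> \<Gamma> \<Longrightarrow> \<bar>r\<bar> < a \<Longrightarrow> foot (\<gamma> + r *\<^sub>R n \<gamma>) = \<gamma>"
  unfolding foot_def tube_proj_def
proof (rule the_equality)
  assume "\<gamma> \<in> \<Gamma>" "\<bar>r\<bar> < a"
  then show "\<gamma> \<in> \<Gamma> \<and> (\<exists>s\<in>{-a<..<a}. \<gamma> + r *\<^sub>R n \<gamma> = tube_map Y2 (\<gamma>, s))"
    by (intro conjI bexI[of _ r]) (auto simp: tube_map_def)
  fix \<gamma>' assume "\<gamma>' \<in> \<Gamma> \<and> (\<exists>s\<in>{-a<..<a}. \<gamma> + r *\<^sub>R n \<gamma> = tube_map Y2 (\<gamma>', s))"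
  then obtain s where s: "\<gamma>' \<in> \<Gamma>" "s \<in> {-a<..<a}" "\<gamma> + r *\<^sub>R n \<gamma> = \<gamma>' + s *\<^sub>R n \<gamma>'"
    by (auto simp: tube_map_def)
  then have "\<bar>s\<bar> < a" by auto
  from tube_coordinates_unique[OF \<open>\<gamma> \<in> \<Gamma>\<close> s(1) \<open>\<bar>r\<bar> < a\<close> this s(3)] show "\<gamma>' = \<gamma>" by simp
qed

lemma sdist_tube: "\<gamma> \<in> \<Gamma> \<Longrightarrow> \<bar>r\<bar> < a \<Longrightarrow> sdist (\<gamma> + r *\<^sub>R n \<gamma>) = r"
  using normal(2) by (simp add: sdist_def foot_tube dot_square_norm)

lemma
  assumes "y \<in> U"
  shows foot_in: "foot y \<in> \<Gamma>" and tube_decomp: "y = foot y + sdist y *\<^sub>R n (foot y)"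
    and sdist_less: "\<bar>sdist y\<bar> < a" and abs_sdist: "\<bar>sdist y\<bar> = infdist y \<Gamma>"
proof -
  obtain \<gamma> r where \<gamma>: "\<gamma> \<in> \<Gamma>" "\<bar>r\<bar> < a" "y = \<gamma> + r *\<^sub>R n \<gamma>"
    using assms by (rule tube_cases)
  then have "foot y = \<gamma>" "sdist y = r" using foot_tube sdist_tube by auto
  with \<gamma> infdist_tube show "foot y \<in> \<Gamma>" "y = foot y + sdist y *\<^sub>R n (foot y)"
    "\<bar>sdist y\<bar> < a" "\<bar>sdist y\<bar> = infdist y \<Gamma>" by auto
qed

lemma inv_tube_map: "y \<in> U \<Longrightarrow> inv_into (\<Gamma> \<times> {-a<..<a}) (tube_map Y2) y = (foot y, sdist y)"
proof -
  assume y: "y \<in> U"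
  have "tube_map Y2 (foot y, sdist y) = y" using tube_decomp[OF y] by (simp add: tube_map_def)
  then show ?thesis
    using inv_into_f_f[OF bij_betw_imp_inj_on[OF bij_tube_map], of "(foot y, sdist y)"] foot_in[OF y] sdist_less[OF y]
    by (simp add: abs_less_iff)
qed

lemma Ck_map_coordinates: "Ck_map 2 U (\<lambda>y. (foot y, sdist y))"
proof -
  have "Ck_map 2 U (inv_into (\<Gamma> \<times> {-a<..<a}) (tube_map Y2))"
    using cell by (simp add: cell_geometry_def Ck_diffeo_def)
  then show ?thesis unfolding Ck_map_def by (simp add: inv_tube_map)
qed

lemma Ck_map_tube_map: "Ck_map 2 (\<Gamma> \<times> {-a<..<a}) (tube_map Y2)"
  using cell by (simp add: cell_geometry_def Ck_diffeo_def)

lemma differentiable_coordinates: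
  assumes y: "y \<in> U"
  shows "foot differentiable (at y)" "sdist differentiable (at y)"
proof -
  obtain V g where V: "open V" "y \<in> V" "Ck_on 2 V g" "\<forall>z\<in>U \<inter> V. g z = (foot z, sdist z)"
    using Ck_map_coordinates y unfolding Ck_map_def by blast
  have "g differentiable (at y)" using V(2,3) by (simp add: numeral_2_eq_2)
  then obtain g' where g': "(g has_derivative g') (at y)" by (auto simp: differentiable_def)
  have "((\<lambda>z. (foot z, sdist z)) has_derivative g') (at y)"
    by (rule has_derivative_transform_within_open[OF g', of "U \<inter> V"]) (use V y open_U in auto)
  from has_derivative_fst[OF this] has_derivative_snd[OF this]
  show "foot differentiable (at y)" "sdist differentiable (at y)"
    by (auto intro: differentiableI)
qed

lemma continuous_on_foot: "continuous_on U foot" and continuous_on_sdist: "continuous_on U sdist"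
  using differentiable_coordinates
  by (auto intro!: differentiable_imp_continuous_on differentiable_at_imp_differentiable_on)

definition "unit_normal y = n (foot y)"

lemma norm_unit_normal: "y \<in> U \<Longrightarrow> norm (unit_normal y) = 1"
  by (simp add: unit_normal_def foot_in normal)

lemma normal_eq_tube_map: "n \<gamma> = (2 / a) *\<^sub>R (tube_map Y2 (\<gamma>, a / 2) - \<gamma>)"
  using a_pos by (simp add: tube_map_def)

text \<open>
  The normal is a difference of two values of the tube map, which is locally the restriction of a
  differentiable function; composing this function with the foot point projection gives the claim.
\<close>

lemma differentiable_unit_normal:
  assumes y: "y \<in> U"
  shows "unit_normal differentiable (at y)"
proof -
  let ?S = "\<Gamma> \<times> {-a<..<a}"
  have "(foot y, a/2) \<in> ?S" using foot_in[OF y] a_pos by simp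
  then obtain V g where V: "open V" "(foot y, a/2) \<in> V" "Ck_on 2 V g" "\<forall>z\<in>?S \<inter> V. g z = tube_map Y2 z"
    using Ck_map_tube_map unfolding Ck_map_def by blast
  have g: "g differentiable (at (foot y, a/2))" using V(2,3) by (simp add: numeral_2_eq_2)
  have "(g \<circ> (\<lambda>z. (foot z, a/2))) differentiable (at y)"
  proof (rule differentiable_chain_at)
    obtain F where "(foot has_derivative F) (at y)"
      using differentiable_coordinates(1)[OF y] by (auto simp: differentiable_def)
    from has_derivative_Pair[OF this has_derivative_const]
    show "(\<lambda>z. (foot z, a/2)) differentiable (at y)" by (rule differentiableI)
  qed (use g in simp)
  then have "(\<lambda>z. (2 / a) *\<^sub>R (g (foot z, a / 2) - foot z)) differentiable (at y)"
    using differentiable_coordinates[OF y] by (intro differentiable_scaleR differentiable_diff) (auto simp: o_def)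
  then obtain D where D: "((\<lambda>z. (2 / a) *\<^sub>R (g (foot z, a / 2) - foot z)) has_derivative D) (at y)"
    by (auto simp: differentiable_def)
  have "continuous_on U (\<lambda>z. (foot z, a/2))" by (intro continuous_intros continuous_on_foot)
  then have "open ((\<lambda>z. (foot z, a/2)) -` V \<inter> U)"
    using V(1) open_U by (simp add: continuous_on_open_vimage)
  from has_derivative_transform_within_open[OF D this] have "(unit_normal has_derivative D) (at y)"
    using V(2,4) y a_pos foot_in by (auto simp: unit_normal_def normal_eq_tube_map)
  then show ?thesis by (rule differentiableI)
qed

lemma normal_lipschitz: obtains L where "L-lipschitz_on \<Gamma> n"
proof -
  have "compact (\<Gamma> \<times> {a/2})" by (intro compact_Times compact_Gamma) simp
  moreover have "\<Gamma> \<times> {a/2} \<subseteq> \<Gamma> \<times> {-a<..<a}" using a_pos by auto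
  ultimately obtain L where L: "L-lipschitz_on (\<Gamma> \<times> {a/2}) (tube_map Y2)"
    by (rule Ck_map_lipschitz_on_compact[OF Ck_map_tube_map[unfolded numeral_2_eq_2]])
  have "L-lipschitz_on \<Gamma> (\<lambda>\<gamma>. tube_map Y2 (\<gamma>, a/2))"
  proof (rule lipschitz_onI)
    fix x y assume "x \<in> \<Gamma>" "y \<in> \<Gamma>"
    then have "dist (tube_map Y2 (x, a/2)) (tube_map Y2 (y, a/2)) \<le> L * dist (x, a/2) (y, a/2)"
      by (intro lipschitz_onD[OF L]) auto
    then show "dist (tube_map Y2 (x, a/2)) (tube_map Y2 (y, a/2)) \<le> L * dist x y"
      by (simp add: dist_Pair_Pair)
  qed (rule lipschitz_on_nonneg[OF L])
  then have "(\<bar>2/a\<bar> * (L + 1))-lipschitz_on \<Gamma> (\<lambda>\<gamma>. (2 / a) *\<^sub>R (tube_map Y2 (\<gamma>, a / 2) - \<gamma>))"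
    by (intro lipschitz_intros)
  then have "(\<bar>2/a\<bar> * (L + 1))-lipschitz_on \<Gamma> n"
    by (simp only: normal_eq_tube_map[symmetric])
  then show ?thesis by (rule that)
qed

text \<open>A compact part of the tube, large enough to contain the support of the cut-off.\<close>

definition "inner_tube = {y \<in> U. infdist y \<Gamma> \<le> 3 * a / 4}"

lemma compact_inner_tube: "compact inner_tube"
proof (cases "\<Gamma> = {}")
  case False
  have eq: "inner_tube = {y. infdist y \<Gamma> \<le> 3 * a / 4}"
    using False a_pos by (auto simp: inner_tube_def tube_eq_infdist)
  have "continuous_on UNIV (\<lambda>y. infdist y \<Gamma>)" by (intro continuous_intros)
  then have "closed inner_tube" unfolding eq by (intro closed_Collect_le) auto
  moreover have "bounded inner_tube"
    using U_subset unit_cell_eq_box by (intro bounded_subset[OF bounded_box[of 0 "One::real^3"]]) (auto simp: inner_tube_def)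
  ultimately show ?thesis by (simp add: compact_eq_bounded_closed)
qed (simp add: inner_tube_def tube_def)

lemma foot_lipschitz: obtains L where "L-lipschitz_on inner_tube foot"
proof -
  obtain L where L: "L-lipschitz_on inner_tube (\<lambda>y. (foot y, sdist y))"
    by (rule Ck_map_lipschitz_on_compact[OF Ck_map_coordinates[unfolded numeral_2_eq_2] compact_inner_tube])
      (auto simp: inner_tube_def)
  have "dist (foot x) (foot y) \<le> L * dist x y" if "x \<in> inner_tube" "y \<in> inner_tube" for x y
    using lipschitz_onD[OF L that] dist_fst_le[of "(foot x, sdist x)" "(foot y, sdist y)"] by simp
  then show ?thesis using that lipschitz_on_nonneg[OF L] by (meson lipschitz_onI)
qed

lemma unit_normal_lipschitz: obtains L where "L-lipschitz_on inner_tube unit_normal"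
proof -
  obtain C D where "C-lipschitz_on inner_tube foot" "D-lipschitz_on \<Gamma> n"
    using foot_lipschitz normal_lipschitz by metis
  moreover have "foot ` inner_tube \<subseteq> \<Gamma>" by (auto simp: inner_tube_def foot_in)
  ultimately have "(D * C)-lipschitz_on inner_tube (\<lambda>y. n (foot y))"
    by (intro lipschitz_on_compose2) (auto elim: lipschitz_on_subset)
  then show ?thesis using that unfolding unit_normal_def[abs_def] by blast
qed

text \<open>The signed distance has slope 1 along the normal lines and is locally 1-Lipschitz; hence its
  gradient is the unit normal.\<close>

lemma sdist_has_derivative:
  assumes y: "y \<in> U"
  shows "(sdist has_derivative (\<lambda>h. h \<bullet> unit_normal y)) (at y)"
proof -
  have d: "(sdist has_derivative (\<lambda>h. h \<bullet> grad sdist y)) (at y)"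
    by (rule differentiable_grad) (rule differentiable_coordinates[OF y])
  have inf: "\<bar>infdist z \<Gamma> - infdist y \<Gamma>\<bar> \<le> norm (z - y)" for z
    using infdist_triangle_abs[of z \<Gamma> y] by (simp add: dist_norm)
  have inU: "\<forall>\<^sub>F z in at y. z \<in> U" by (rule eventually_at_in_open'[OF open_U y])
  have cont: "(sdist \<longlongrightarrow> sdist y) (at y)"
    using continuous_on_sdist open_U y by (simp add: continuous_on_eq_continuous_at isCont_def)
  have "\<forall>\<^sub>F z in at y. norm (sdist z - sdist y) \<le> 1 * norm (z - y)"
  proof -
    consider "sdist y = 0" | "0 < sdist y" | "sdist y < 0" by linarith
    then show ?thesis
    proof cases
      case 1
      from inU show ?thesis
      proof eventually_elim
        case (elim z)
        then show ?case using inf[of z] abs_sdist[OF y] abs_sdist[of z] 1 by simp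
      qed
    next
      case 2
      from inU order_tendstoD(1)[OF cont 2] show ?thesis
      proof eventually_elim
        case (elim z)
        then show ?case using inf[of z] abs_sdist[OF y] abs_sdist[of z] 2 by simp
      qed
    next
      case 3
      from inU order_tendstoD(2)[OF cont 3] show ?thesis
      proof eventually_elim
        case (elim z)
        then show ?case using inf[of z] abs_sdist[OF y] abs_sdist[of z] 3 by simp
      qed
    qed
  qed
  from derivative_bound_of_local_bound[OF d this, of "grad sdist y"]
  have le1: "norm (grad sdist y) \<le> 1"
    by (cases "norm (grad sdist y) = 0") (auto simp: dot_square_norm power2_eq_square)
  let ?N = "unit_normal y"
  have "((\<lambda>s. y + s *\<^sub>R ?N) has_derivative (\<lambda>s. s *\<^sub>R ?N)) (at 0)"
    by (auto intro!: derivative_eq_intros)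
  from diff_chain_at[OF this, of sdist "\<lambda>h. h \<bullet> grad sdist y"] d
  have "((\<lambda>s. sdist (y + s *\<^sub>R ?N)) has_real_derivative (?N \<bullet> grad sdist y)) (at 0)"
    by (simp add: o_def has_field_derivative_def mult_commute_abs)
  moreover have "((\<lambda>s. sdist (y + s *\<^sub>R ?N)) has_real_derivative 1) (at 0)"
  proof (rule has_field_derivative_transform_within_open)
    show "((\<lambda>s. sdist y + s) has_real_derivative 1) (at 0)" by (auto intro!: derivative_eq_intros)
    show "open {- (a - \<bar>sdist y\<bar>)<..<a - \<bar>sdist y\<bar>}" "0 \<in> {- (a - \<bar>sdist y\<bar>)<..<a - \<bar>sdist y\<bar>}"
      using sdist_less[OF y] by auto
    fix s assume "s \<in> {- (a - \<bar>sdist y\<bar>)<..<a - \<bar>sdist y\<bar>}"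
    then have "\<bar>sdist y + s\<bar> < a" by auto
    from sdist_tube[OF foot_in[OF y] this]
    have "sdist ((foot y + sdist y *\<^sub>R n (foot y)) + s *\<^sub>R n (foot y)) = sdist y + s"
      by (simp add: scaleR_add_left add.assoc)
    then show "sdist y + s = sdist (y + s *\<^sub>R ?N)"
      unfolding tube_decomp[OF y, symmetric] unit_normal_def by simp
  qed
  ultimately have "?N \<bullet> grad sdist y = 1" by (rule DERIV_unique)
  moreover have "?N \<bullet> ?N = 1" using norm_unit_normal[OF y] by (simp add: dot_square_norm)
  ultimately have "norm (grad sdist y - ?N) ^ 2 \<le> 0"
    using power_mono[OF le1, of 2]
    by (simp add: power2_norm_eq_inner inner_diff_left inner_diff_right inner_commute)
  then have "grad sdist y = ?N" by simp
  with d show ?thesis by simp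
qed

end

section \<open>Fronts moving with a small and slowly varying normal velocity\<close>

text \<open>
  A front in the unit cell, given as the zero set of \<open>u\<close> and as a graph over \<open>\<Gamma>\<close>. In the equation
  of motion \<open>p\<close> is the space gradient of \<open>u\<close>, and \<open>u\<close> is negative outside the inclusion; the front
  moves with speed \<open>V\<close> in the direction \<open>-p\<close>, that is, outwards if \<open>V\<close> is positive. One constant
  \<open>K\<close> serves as bound and as Lipschitz constant of the speed.
\<close>

locale moving_front = reference_cell +
  fixes \<tau> K :: real and u V :: "real \<times> (real^3) \<Rightarrow> real" and g :: "real \<Rightarrow> real^3 \<Rightarrow> real"
  assumes K: "0 < K"
    and continuous_u: "continuous_on ({0..<\<tau>} \<times> unit_cell) u"
    and differentiable_u: "\<And>z. z \<in> {0<..<\<tau>} \<times> unit_cell \<Longrightarrow> u differentiable (at z)"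
    and front_motion: "\<And>t y. t \<in> {0<..<\<tau>} \<Longrightarrow> y \<in> unit_cell \<Longrightarrow> u (t, y) = 0 \<Longrightarrow>
      \<exists>p. p \<noteq> 0 \<and> (u has_derivative (\<lambda>(r, w). r * (norm p * V (t, y)) + w \<bullet> p)) (at (t, y))"
    and zero_set: "\<And>t. t \<in> {0..<\<tau>} \<Longrightarrow>
      {y \<in> unit_cell. u (t, y) = 0} = (\<lambda>\<gamma>. \<gamma> + g t \<gamma> *\<^sub>R n \<gamma>) ` \<Gamma>"
    and height_bound: "\<And>t \<gamma>. t \<in> {0..<\<tau>} \<Longrightarrow> \<gamma> \<in> \<Gamma> \<Longrightarrow> \<bar>g t \<gamma>\<bar> \<le> a / 10"
    and initial_zero: "\<And>\<gamma>. \<gamma> \<in> \<Gamma> \<Longrightarrow> u (0, \<gamma>) = 0"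
    and initial_sign: "\<And>y. y \<in> unit_cell - closure Y2 \<Longrightarrow> u (0, y) < 0"
    and speed_bound: "\<And>t y. t \<in> {0<..<\<tau>} \<Longrightarrow> y \<in> unit_cell \<Longrightarrow> \<bar>V (t, y)\<bar> \<le> K"
    and speed_lipschitz: "\<And>t x y. t \<in> {0<..<\<tau>} \<Longrightarrow> x \<in> unit_cell \<Longrightarrow> y \<in> unit_cell \<Longrightarrow>
      \<bar>V (t, x) - V (t, y)\<bar> \<le> K * norm (x - y)"
begin

definition "front t = {y \<in> unit_cell. u (t, y) = 0}"

lemma front_cases:
  assumes "t \<in> {0..<\<tau>}" "y \<in> front t"
  shows "y \<in> U" "\<bar>sdist y\<bar> \<le> a / 10" "sdist y = g t (foot y)" "y \<in> inner_tube"
proof -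
  obtain \<gamma> where \<gamma>: "\<gamma> \<in> \<Gamma>" "y = \<gamma> + g t \<gamma> *\<^sub>R n \<gamma>"
    using assms zero_set by (auto simp: front_def)
  have h: "\<bar>g t \<gamma>\<bar> < a" "\<bar>g t \<gamma>\<bar> \<le> a/10" using height_bound[OF assms(1) \<gamma>(1)] a_pos by auto
  show s: "\<bar>sdist y\<bar> \<le> a / 10" "sdist y = g t (foot y)"
    using \<gamma> h sdist_tube foot_tube by auto
  have "infdist y \<Gamma> \<le> a/10" using infdist_tube[OF \<gamma>(1) h(1)] \<gamma>(2) h(2) by simp
  then show "y \<in> U" "y \<in> inner_tube" using \<gamma>(1) a_pos by (auto simp: inner_tube_def tube_eq_infdist)
qed

lemma front_point: "t \<in> {0..<\<tau>} \<Longrightarrow> \<gamma> \<in> \<Gamma> \<Longrightarrow> \<gamma> + g t \<gamma> *\<^sub>R n \<gamma> \<in> front t"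
  using zero_set by (auto simp: front_def)

lemma sdist_front_0: "0 < \<tau> \<Longrightarrow> y \<in> front 0 \<Longrightarrow> sdist y = 0"
proof -
  assume "0 < \<tau>" "y \<in> front 0"
  then have y: "y \<in> U" "sdist y = g 0 (foot y)" using front_cases[of 0 y] by auto
  have "foot y \<in> front 0" using foot_in[OF y(1)] initial_zero Gamma_subset by (auto simp: front_def)
  then have "sdist (foot y) = g 0 (foot (foot y))" using front_cases[of 0 "foot y"] \<open>0 < \<tau>\<close> by auto
  then show ?thesis
    using foot_tube[OF foot_in[OF y(1)], of 0] sdist_tube[OF foot_in[OF y(1)], of 0] a_pos y(2) by simp
qed

text \<open>
  On the normal line through \<open>\<gamma>\<close> the function \<open>u(t, \<cdot>)\<close> has no zero but the height. At radius
  \<open>a/2\<close>, which the front never reaches, the sign is preserved in time from the initial sign, and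
  from there it extends along the line down to the front.
\<close>

lemma u_negative_beyond:
  assumes t: "t \<in> {0..<\<tau>}" and \<gamma>: "\<gamma> \<in> \<Gamma>" and r: "g t \<gamma> < r" "r \<le> a / 2"
  shows "u (t, \<gamma> + r *\<^sub>R n \<gamma>) < 0"
proof -
  have inU: "\<gamma> + s *\<^sub>R n \<gamma> \<in> unit_cell" if "\<bar>s\<bar> < a" for s
    using infdist_tube[OF \<gamma> that] \<gamma> that U_subset by (auto simp: tube_eq_infdist)
  have nz: "u (t', \<gamma> + s *\<^sub>R n \<gamma>) \<noteq> 0" if "t' \<in> {0..<\<tau>}" "\<bar>s\<bar> < a" "s \<noteq> g t' \<gamma>" for t' s
  proof
    assume "u (t', \<gamma> + s *\<^sub>R n \<gamma>) = 0"
    then have "\<gamma> + s *\<^sub>R n \<gamma> \<in> front t'" using inU[OF that(2)] by (simp add: front_def)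
    from front_cases(3)[OF that(1) this] show False
      using that foot_tube[OF \<gamma> that(2)] sdist_tube[OF \<gamma> that(2)] by simp
  qed
  have end_neg: "u (t, \<gamma> + (a/2) *\<^sub>R n \<gamma>) < 0"
  proof (rule ccontr)
    assume "\<not> ?thesis"
    moreover have "u (0, \<gamma> + (a/2) *\<^sub>R n \<gamma>) < 0"
      using tube_outside[OF \<gamma>, of "a/2"] inU[of "a/2"] a_pos by (intro initial_sign) auto
    moreover have "continuous_on {0..t} (\<lambda>t. u (t, \<gamma> + (a/2) *\<^sub>R n \<gamma>))"
      by (rule continuous_on_compose2[OF continuous_u])
        (use t inU[of "a/2"] a_pos in \<open>auto intro!: continuous_intros\<close>)
    ultimately obtain t' where "t' \<in> {0..t}" "u (t', \<gamma> + (a/2) *\<^sub>R n \<gamma>) = 0"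
      using IVT'[of "\<lambda>t. u (t, \<gamma> + (a/2) *\<^sub>R n \<gamma>)" 0 0 t] t by auto
    moreover have "a/2 \<noteq> g t' \<gamma>" using height_bound[of t' \<gamma>] \<gamma> \<open>t' \<in> {0..t}\<close> t a_pos by auto
    ultimately show False using nz[of t' "a/2"] t a_pos by auto
  qed
  show ?thesis
  proof (rule ccontr)
    assume "\<not> ?thesis"
    moreover have "continuous_on {r..a/2} (\<lambda>s. u (t, \<gamma> + s *\<^sub>R n \<gamma>))"
    proof (rule continuous_on_compose2[OF continuous_u])
      show "(\<lambda>s. (t, \<gamma> + s *\<^sub>R n \<gamma>)) ` {r..a/2} \<subseteq> {0..<\<tau>} \<times> unit_cell"
        using t r height_bound[OF t \<gamma>] a_pos by (auto intro!: inU)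
    qed (intro continuous_intros)
    ultimately obtain s where "s \<in> {r..a/2}" "u (t, \<gamma> + s *\<^sub>R n \<gamma>) = 0"
      using IVT2'[of "\<lambda>s. u (t, \<gamma> + s *\<^sub>R n \<gamma>)" "a/2" 0 r] end_neg r by auto
    moreover from this have "\<bar>s\<bar> < a" "s \<noteq> g t \<gamma>"
      using r height_bound[OF t \<gamma>] a_pos by (auto simp: abs_le_iff abs_less_iff)
    ultimately show False using nz[OF t, of s] by blast
  qed
qed

text \<open>
  By \<open>u_negative_beyond\<close> the function \<open>u\<close> does not increase along the outward normal of the
  reference surface. This fixes the orientation of the gradient of \<open>u\<close> in the estimate of the slope.
\<close>

lemma conormal_inner_le_0:
  assumes t: "t \<in> {0<..<\<tau>}" and y: "y \<in> front t"
    and p: "(u has_derivative (\<lambda>(r, w). r * c + w \<bullet> p)) (at (t, y))"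
  shows "unit_normal y \<bullet> p \<le> 0"
proof -
  have t': "t \<in> {0..<\<tau>}" using t by auto
  note f = front_cases[OF t' y]
  let ?N = "unit_normal y"
  have "((\<lambda>s. (t, y + s *\<^sub>R ?N)) has_derivative (\<lambda>s. (0, s *\<^sub>R ?N))) (at 0)"
    by (auto intro!: derivative_eq_intros)
  from diff_chain_at[OF this, of u "\<lambda>(r, w). r * c + w \<bullet> p"] p
  have d: "((\<lambda>s. u (t, y + s *\<^sub>R ?N)) has_real_derivative (?N \<bullet> p)) (at 0)"
    by (simp add: o_def has_field_derivative_def mult_commute_abs)
  show ?thesis
  proof (rule ccontr)
    assume "\<not> ?thesis"
    then have "0 < ?N \<bullet> p" by simp
    from DERIV_pos_inc_right[OF d this] y obtain \<delta> where \<delta>: "0 < \<delta>"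
      "\<And>s. 0 < s \<Longrightarrow> s < \<delta> \<Longrightarrow> 0 < u (t, y + s *\<^sub>R ?N)"
      by (auto simp: front_def)
    define s where "s = min (\<delta> / 2) (a / 4)"
    have s: "0 < s" "s < \<delta>" "s \<le> a/4" using \<delta>(1) a_pos by (auto simp: s_def)
    have "u (t, foot y + (g t (foot y) + s) *\<^sub>R n (foot y)) < 0"
      using u_negative_beyond[OF t' foot_in[OF f(1)], of "g t (foot y) + s"] s f a_pos by auto
    also have "foot y + (g t (foot y) + s) *\<^sub>R n (foot y) = y + s *\<^sub>R ?N"
      using tube_decomp[OF f(1)] f(3) by (simp add: unit_normal_def scaleR_add_left add.assoc[symmetric])
    finally show False using \<delta>(2)[OF s(1,2)] by simp
  qed
qed

text \<open>
  Points of the moving front in any space-time direction \<open>(r, w)\<close> tangential to it. Fixing \<open>r\<close>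
  exactly and perturbing only \<open>w\<close> allows two points of the front to be moved simultaneously.
\<close>

lemma front_direction:
  assumes t: "t \<in> {0<..<\<tau>}" and y: "y \<in> unit_cell" "u (t, y) = 0" and p: "p \<noteq> 0"
    and d: "(u has_derivative (\<lambda>(r, w). r * c + w \<bullet> p)) (at (t, y))"
    and w: "r * c + w \<bullet> p = 0" and \<eta>: "0 < \<eta>"
  shows "\<forall>\<^sub>F s in at_right 0. t + s * r \<in> {0<..<\<tau>} \<and>
     (\<exists>\<zeta>. norm (\<zeta> - w) \<le> \<eta> \<and> y + s *\<^sub>R \<zeta> \<in> front (t + s * r))"
proof -
  have o: "open ({0<..<\<tau>} \<times> unit_cell)" unfolding unit_cell_eq_box by (intro open_Times) auto
  have cont: "continuous_on ({0<..<\<tau>} \<times> unit_cell) u"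
    using continuous_u by (rule continuous_on_subset) auto
  have "\<forall>\<^sub>F s in at_right 0. \<exists>c. \<bar>c\<bar> \<le> \<eta> / norm p \<and>
      (t, y) + s *\<^sub>R ((r, w) + c *\<^sub>R (0, p)) \<in> {0<..<\<tau>} \<times> unit_cell \<and>
      u ((t, y) + s *\<^sub>R ((r, w) + c *\<^sub>R (0, p))) = 0"
    by (rule zero_set_direction[OF d y(2) o _ cont]) (use t y w p \<eta> in \<open>auto simp: dot_square_norm\<close>)
  then show ?thesis
  proof eventually_elim
    case (elim s)
    then obtain c where c: "\<bar>c\<bar> \<le> \<eta> / norm p" "t + s * r \<in> {0<..<\<tau>}"
      "y + s *\<^sub>R (w + c *\<^sub>R p) \<in> front (t + s * r)"
      by (auto simp: front_def)
    then have "norm ((w + c *\<^sub>R p) - w) \<le> \<eta>" using p by (simp add: field_simps)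
    with c show ?case by blast
  qed
qed

lemma compact_front_graph:
  assumes "t1 < \<tau>"
  shows "compact {(t, y). t \<in> {0..t1} \<and> y \<in> front t}"
proof -
  have sub: "{0..t1} \<times> inner_tube \<subseteq> {0..<\<tau>} \<times> unit_cell"
    using assms U_subset by (auto simp: inner_tube_def)
  have "compact ({0..t1} \<times> inner_tube)" by (intro compact_Times compact_inner_tube) simp
  moreover have "closedin (top_of_set ({0..t1} \<times> inner_tube)) {z \<in> {0..t1} \<times> inner_tube. u z = 0}"
    by (rule continuous_closedin_preimage_constant) (rule continuous_on_subset[OF continuous_u sub])
  ultimately have "compact {z \<in> {0..t1} \<times> inner_tube. u z = 0}"
    by (rule closedin_compact)
  also have "{z \<in> {0..t1} \<times> inner_tube. u z = 0} = {(t, y). t \<in> {0..t1} \<and> y \<in> front t}"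
    using assms sub front_cases(4) by (fastforce simp: front_def)
  finally show ?thesis .
qed

text \<open>
  At a positive maximum of \<open>\<sigma> d(x) - 2 K t\<close> over the front up to time \<open>t\<close>, follow the front
  backwards in time in the direction \<open>(-1, V p / |p|)\<close>; this cannot increase the function, but its
  derivative is at least \<open>2 K - K\<close>.
\<close>

lemma sdist_front_le:
  assumes \<sigma>: "\<sigma> = 1 \<or> \<sigma> = (-1::real)" and t: "t \<in> {0<..<\<tau>}" and y: "y \<in> front t"
  shows "\<sigma> * sdist y \<le> 2 * K * t"
proof (rule ccontr)
  assume neg: "\<not> ?thesis"
  define Q where "Q = {(t', y). t' \<in> {0..t} \<and> y \<in> front t'}"
  define G where "G z = \<sigma> * sdist (snd z) - 2 * K * fst z" for z
  have "compact Q" unfolding Q_def using t by (intro compact_front_graph) auto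
  moreover have "(t, y) \<in> Q" using t y by (simp add: Q_def)
  moreover have "continuous_on Q G" unfolding G_def
    by (intro continuous_intros continuous_on_compose2[OF continuous_on_sdist])
      (use t front_cases(1) in \<open>fastforce simp: Q_def\<close>)
  ultimately obtain z where z: "z \<in> Q" "\<And>z'. z' \<in> Q \<Longrightarrow> G z' \<le> G z"
    using continuous_attains_sup[of Q G] by blast
  obtain t0 y0 where z_eq: "z = (t0, y0)" by (cases z)
  have pos: "0 < G (t0, y0)" using z(2)[OF \<open>(t, y) \<in> Q\<close>] neg by (simp add: z_eq G_def)
  have t0: "t0 \<in> {0..t}" and y0: "y0 \<in> front t0" using z(1) by (auto simp: z_eq Q_def)
  have "t0 \<noteq> 0" using pos y0 sdist_front_0 t by (auto simp: G_def)
  then have t0': "t0 \<in> {0<..<\<tau>}" using t0 t by auto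
  have y0c: "y0 \<in> unit_cell" "u (t0, y0) = 0" using y0 by (auto simp: front_def)
  have y0U: "y0 \<in> U" using front_cases(1)[of t0 y0] t0' y0 by auto
  obtain p where p: "p \<noteq> 0"
    "(u has_derivative (\<lambda>(r, w). r * (norm p * V (t0, y0)) + w \<bullet> p)) (at (t0, y0))"
    using front_motion[OF t0' y0c] by blast
  have dG: "(G has_derivative (\<lambda>(r, w). \<sigma> * (w \<bullet> unit_normal y0) - 2 * K * r)) (at (t0, y0))"
  proof -
    have "((\<lambda>z. sdist (snd z)) has_derivative (\<lambda>h. snd h \<bullet> unit_normal y0)) (at (t0, y0))"
      using diff_chain_at[of snd snd "(t0, y0)" sdist "\<lambda>h. h \<bullet> unit_normal y0"] sdist_has_derivative[OF y0U]
      by (simp add: o_def has_derivative_snd[OF has_derivative_ident])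
    then have "(G has_derivative (\<lambda>h. \<sigma> * (snd h \<bullet> unit_normal y0) - 2 * K * fst h)) (at (t0, y0))"
      unfolding G_def by (intro has_derivative_diff has_derivative_mult_right has_derivative_fst has_derivative_ident)
    then show ?thesis by (simp add: case_prod_unfold)
  qed
  have le: "\<sigma> * (w \<bullet> unit_normal y0) - 2 * K * r \<le> 0"
    if "r \<le> 0" "r * (norm p * V (t0, y0)) + w \<bullet> p = 0" for r w
  proof -
    have "(case (r, w) of (r, w) \<Rightarrow> \<sigma> * (w \<bullet> unit_normal y0) - 2 * K * r) \<le> 0"
    proof (rule derivative_le_0_along[OF dG])
      fix \<eta> :: real assume "0 < \<eta>"
      from front_direction[OF t0' y0c p that(2) this] eventually_at_right_less[of "0::real"]
      show "\<forall>\<^sub>F s in at_right 0. \<exists>\<zeta>. norm (\<zeta> - (r, w)) \<le> \<eta> \<and>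
          (t0, y0) + s *\<^sub>R \<zeta> \<in> UNIV \<and> G ((t0, y0) + s *\<^sub>R \<zeta>) \<le> G (t0, y0)"
      proof eventually_elim
        case (elim s)
        then obtain \<zeta> where \<zeta>: "norm (\<zeta> - w) \<le> \<eta>" "y0 + s *\<^sub>R \<zeta> \<in> front (t0 + s * r)" by blast
        have "s * r \<le> 0" using elim that(1) by (simp add: mult_nonneg_nonpos)
        then have "(t0 + s * r, y0 + s *\<^sub>R \<zeta>) \<in> Q" using \<zeta> elim t0 by (auto simp: Q_def)
        from z(2)[OF this] \<zeta>(1) show ?case
          by (intro exI[of _ "(r, \<zeta>)"]) (simp add: z_eq norm_Pair)
      qed
    qed
    then show ?thesis by simp
  qed
  let ?N = "unit_normal y0"
  have N: "norm ?N = 1" by (rule norm_unit_normal[OF y0U])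
  let ?w = "(V (t0, y0) / norm p) *\<^sub>R p"
  have "\<sigma> * (?w \<bullet> ?N) - 2 * K * (-1) \<le> 0"
    by (rule le) (use p(1) in \<open>simp_all add: dot_square_norm power2_eq_square\<close>)
  moreover have "\<bar>\<sigma> * (?w \<bullet> ?N)\<bar> \<le> K"
  proof -
    have "\<bar>\<sigma> * (?w \<bullet> ?N)\<bar> = \<bar>?w \<bullet> ?N\<bar>" using \<sigma> by auto
    also have "\<dots> \<le> norm ?w * norm ?N" by (rule Cauchy_Schwarz_ineq2)
    also have "\<dots> = \<bar>V (t0, y0)\<bar>" using p(1) N by simp
    also have "\<dots> \<le> K" by (rule speed_bound[OF t0' y0c(1)])
    finally show ?thesis .
  qed
  ultimately show False using K by linarith
qed

lemma height_le: "t \<in> {0<..<\<tau>} \<Longrightarrow> \<gamma> \<in> \<Gamma> \<Longrightarrow> \<bar>g t \<gamma>\<bar> \<le> 2 * K * t"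
proof -
  assume t: "t \<in> {0<..<\<tau>}" and \<gamma>: "\<gamma> \<in> \<Gamma>"
  then have t': "t \<in> {0..<\<tau>}" by auto
  have "sdist (\<gamma> + g t \<gamma> *\<^sub>R n \<gamma>) = g t \<gamma>"
    using height_bound[OF t' \<gamma>] a_pos \<gamma> by (intro sdist_tube) auto
  with sdist_front_le[of 1, OF _ t front_point[OF t' \<gamma>]] sdist_front_le[of "-1", OF _ t front_point[OF t' \<gamma>]]
  show ?thesis by (simp add: abs_le_iff)
qed

text \<open>
  Doubling of variables: at a positive maximum of \<open>d(x) - d(y) - L t |x - y|\<close> with \<open>L = K (2 + B)\<close>,
  vary \<open>x\<close> and \<open>y\<close> independently and tangentially. The partial gradients
  \<open>\<nabla>d(x) - L t e\<close> and \<open>\<nabla>d(y) - L t e\<close> are then multiples of the gradients of \<open>u\<close>, with a negative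
  factor as long as \<open>L t \<le> 1/4\<close>, which is why \<open>K\<close> has to be small. Following both points
  backwards in time bounds \<open>L |x - y|\<close> by the difference of the speeds weighted with the lengths of
  these gradients.
\<close>

lemma sdist_front_lipschitz:
  assumes B: "B-lipschitz_on inner_tube unit_normal" and small: "K * (2 + B) * \<tau> \<le> 1 / 4"
    and t: "t \<in> {0<..<\<tau>}" and x: "x \<in> front t" and y: "y \<in> front t"
  shows "sdist x - sdist y \<le> K * (2 + B) * t * norm (x - y)"
proof (rule ccontr)
  assume neg: "\<not> ?thesis"
  define L where "L = K * (2 + B)"
  have B0: "0 \<le> B" using B by (rule lipschitz_on_nonneg)
  have L0: "0 < L" unfolding L_def using K B0 by simp
  define Q0 where "Q0 = {(t', y). t' \<in> {0..t} \<and> y \<in> front t'}"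
  define Q where "Q = {(t', x, y). t' \<in> {0..t} \<and> x \<in> front t' \<and> y \<in> front t'}"
  define G where "G z = sdist (fst (snd z)) - sdist (snd (snd z)) - L * fst z * norm (fst (snd z) - snd (snd z))"
    for z :: "real \<times> (real^3) \<times> (real^3)"
  have "compact Q0" unfolding Q0_def using t by (intro compact_front_graph) auto
  have "compact Q"
  proof -
    have "compact (Q0 \<times> Q0)" using \<open>compact Q0\<close> by (intro compact_Times)
    moreover have "closed {w :: (real \<times> (real^3)) \<times> (real \<times> (real^3)). fst (fst w) = fst (snd w)}"
      by (intro closed_Collect_eq continuous_intros)
    ultimately have "compact (Q0 \<times> Q0 \<inter> {w. fst (fst w) = fst (snd w)})" (is "compact ?W")
      by (rule compact_Int_closed)
    then have "compact ((\<lambda>w. (fst (fst w), snd (fst w), snd (snd w))) ` ?W)"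
      by (intro compact_continuous_image continuous_intros)
    also have "(\<lambda>w. (fst (fst w), snd (fst w), snd (snd w))) ` ?W = Q"
      by (force simp: Q_def Q0_def image_iff)
    finally show ?thesis .
  qed
  moreover have "(t, x, y) \<in> Q" using t x y by (simp add: Q_def)
  moreover have "continuous_on Q G" unfolding G_def
    by (intro continuous_intros continuous_on_compose2[OF continuous_on_sdist])
      (use t front_cases(1) in \<open>fastforce simp: Q_def\<close>)+
  ultimately obtain z where z: "z \<in> Q" "\<And>z'. z' \<in> Q \<Longrightarrow> G z' \<le> G z"
    using continuous_attains_sup[of Q G] by blast
  obtain t0 x0 y0 where z_eq: "z = (t0, x0, y0)" by (cases z)
  have pos: "0 < G (t0, x0, y0)" using z(2)[OF \<open>(t, x, y) \<in> Q\<close>] neg by (simp add: z_eq G_def L_def)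
  have t0: "t0 \<in> {0..t}" and x0: "x0 \<in> front t0" and y0: "y0 \<in> front t0"
    using z(1) by (auto simp: z_eq Q_def)
  have "t0 \<noteq> 0" using pos x0 y0 sdist_front_0 t by (auto simp: G_def)
  then have t0': "t0 \<in> {0<..<\<tau>}" using t0 t by auto
  have t0'': "t0 \<in> {0..<\<tau>}" using t0' by auto
  have xy: "x0 \<noteq> y0" using pos by (auto simp: G_def)
  have x0c: "x0 \<in> unit_cell" "u (t0, x0) = 0" and y0c: "y0 \<in> unit_cell" "u (t0, y0) = 0"
    using x0 y0 by (auto simp: front_def)
  note x0f = front_cases[OF t0'' x0] and y0f = front_cases[OF t0'' y0]
  let ?N = "unit_normal x0" and ?M = "unit_normal y0"
  have N: "norm ?N = 1" "norm ?M = 1" using norm_unit_normal x0f(1) y0f(1) by auto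
  obtain p where p: "p \<noteq> 0"
    "(u has_derivative (\<lambda>(r, w). r * (norm p * V (t0, x0)) + w \<bullet> p)) (at (t0, x0))"
    using front_motion[OF t0' x0c] by blast
  obtain q where q: "q \<noteq> 0"
    "(u has_derivative (\<lambda>(r, w). r * (norm q * V (t0, y0)) + w \<bullet> q)) (at (t0, y0))"
    using front_motion[OF t0' y0c] by blast
  define \<rho> where "\<rho> = norm (x0 - y0)"
  have \<rho>: "0 < \<rho>" using xy by (simp add: \<rho>_def)
  define e where "e = (x0 - y0) /\<^sub>R \<rho>"
  have e: "norm e = 1" using \<rho> by (simp add: e_def \<rho>_def)
  define l where "l = L * t0"
  have l: "0 \<le> l" "l \<le> 1/4"
  proof -
    show "0 \<le> l" using L0 t0' by (simp add: l_def)
    have "l \<le> L * \<tau>" unfolding l_def using L0 t0' by (intro mult_left_mono) auto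
    also have "\<dots> \<le> 1/4" using small by (simp add: L_def)
    finally show "l \<le> 1/4" .
  qed
  define A where "A = ?N - l *\<^sub>R e"
  define B' where "B' = ?M - l *\<^sub>R e"
  have dG: "(G has_derivative (\<lambda>(r, w, w'). w \<bullet> A - w' \<bullet> B' - L * r * \<rho>)) (at (t0, x0, y0))"
  proof -
    have 1: "((\<lambda>z. sdist (fst (snd z))) has_derivative (\<lambda>h. fst (snd h) \<bullet> ?N)) (at (t0, x0, y0))"
      using diff_chain_at[of "\<lambda>z. fst (snd z)" "\<lambda>z. fst (snd z)" "(t0, x0, y0)" sdist "\<lambda>h. h \<bullet> ?N"]
        sdist_has_derivative[OF x0f(1)]
      by (simp add: o_def has_derivative_snd[OF has_derivative_ident]
          has_derivative_fst[OF has_derivative_snd[OF has_derivative_ident]]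
          has_derivative_snd[OF has_derivative_snd[OF has_derivative_ident]])
    have 2: "((\<lambda>z. sdist (snd (snd z))) has_derivative (\<lambda>h. snd (snd h) \<bullet> ?M)) (at (t0, x0, y0))"
      using diff_chain_at[of "\<lambda>z. snd (snd z)" "\<lambda>z. snd (snd z)" "(t0, x0, y0)" sdist "\<lambda>h. h \<bullet> ?M"]
        sdist_has_derivative[OF y0f(1)]
      by (simp add: o_def has_derivative_snd[OF has_derivative_ident]
          has_derivative_fst[OF has_derivative_snd[OF has_derivative_ident]]
          has_derivative_snd[OF has_derivative_snd[OF has_derivative_ident]])
    have 3: "((\<lambda>z. norm (fst (snd z) - snd (snd z))) has_derivative (\<lambda>h. (fst (snd h) - snd (snd h)) \<bullet> e)) (at (t0, x0, y0))"
    proof -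
      have d: "((\<lambda>z. fst (snd z) - snd (snd z)) has_derivative (\<lambda>z. fst (snd z) - snd (snd z))) (at (t0, x0, y0))"
        by (auto intro!: derivative_eq_intros)
      have "(norm has_derivative (\<lambda>h. h \<bullet> sgn (x0 - y0))) (at (x0 - y0))"
        using xy has_derivative_norm[of "x0 - y0"] by (simp add: gderiv_def)
      moreover have "sgn (x0 - y0) = e" by (simp add: e_def \<rho>_def sgn_div_norm)
      ultimately show ?thesis
        using diff_chain_at[OF d, of norm "\<lambda>h. h \<bullet> e"] by (simp add: o_def)
    qed
    have 4: "((\<lambda>z. L * fst z) has_derivative (\<lambda>h. L * fst h)) (at (t0, x0, y0))"
      by (auto intro!: derivative_eq_intros)
    have "(G has_derivative (\<lambda>h. fst (snd h) \<bullet> ?N - snd (snd h) \<bullet> ?M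
        - (L * t0 * ((fst (snd h) - snd (snd h)) \<bullet> e) + L * fst h * \<rho>))) (at (t0, x0, y0))"
      unfolding G_def using has_derivative_diff[OF has_derivative_diff[OF 1 2] has_derivative_mult[OF 4 3]]
      by (simp add: \<rho>_def)
    then show ?thesis
      by (simp add: A_def B'_def l_def case_prod_unfold inner_diff_left inner_diff_right algebra_simps)
  qed
  have le: "w \<bullet> A - w' \<bullet> B' - L * r * \<rho> \<le> 0"
    if "r \<le> 0" "r * (norm p * V (t0, x0)) + w \<bullet> p = 0" "r * (norm q * V (t0, y0)) + w' \<bullet> q = 0" for r w w'
  proof -
    have "(case (r, w, w') of (r, w, w') \<Rightarrow> w \<bullet> A - w' \<bullet> B' - L * r * \<rho>) \<le> 0"
    proof (rule derivative_le_0_along[OF dG])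
      fix \<eta> :: real assume "0 < \<eta>"
      then have "0 < \<eta> / 2" by simp
      from front_direction[OF t0' x0c p that(2) this] front_direction[OF t0' y0c q that(3) this]
        eventually_at_right_less[of "0::real"]
      show "\<forall>\<^sub>F s in at_right 0. \<exists>\<zeta>. norm (\<zeta> - (r, w, w')) \<le> \<eta> \<and>
          (t0, x0, y0) + s *\<^sub>R \<zeta> \<in> UNIV \<and> G ((t0, x0, y0) + s *\<^sub>R \<zeta>) \<le> G (t0, x0, y0)"
      proof eventually_elim
        case (elim s)
        then obtain \<zeta> \<zeta>' where \<zeta>: "norm (\<zeta> - w) \<le> \<eta>/2" "x0 + s *\<^sub>R \<zeta> \<in> front (t0 + s * r)"
          "norm (\<zeta>' - w') \<le> \<eta>/2" "y0 + s *\<^sub>R \<zeta>' \<in> front (t0 + s * r)" by blast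
        have "s * r \<le> 0" using elim that(1) by (simp add: mult_nonneg_nonpos)
        then have "(t0 + s * r, x0 + s *\<^sub>R \<zeta>, y0 + s *\<^sub>R \<zeta>') \<in> Q" using \<zeta> elim t0 by (auto simp: Q_def)
        from z(2)[OF this] have "G ((t0, x0, y0) + s *\<^sub>R (r, \<zeta>, \<zeta>')) \<le> G (t0, x0, y0)"
          by (simp add: z_eq)
        moreover have "norm ((r, \<zeta>, \<zeta>') - (r, w, w')) \<le> \<eta>"
          using norm_Pair_le[of "\<zeta> - w" "\<zeta>' - w'"] \<zeta>(1,3) by (simp add: norm_Pair)
        ultimately show ?case by blast
      qed
    qed
    then show ?thesis by simp
  qed
  \<comment> \<open>A vector orthogonal to the tangent space is a multiple of the gradient \<open>s\<close> of \<open>u\<close>. The factor is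
    negative: \<open>X\<close> differs from the unit vector \<open>M\<close> by at most 1/4, and \<open>M\<close> does not point to the side
    of \<open>s\<close>.\<close>
  have par: "X = - norm X *\<^sub>R (s /\<^sub>R norm s)"
    if orth: "\<And>w. w \<bullet> s = 0 \<Longrightarrow> w \<bullet> X \<le> 0" and s: "s \<noteq> 0" and neg: "M \<bullet> s \<le> 0" "norm M = 1"
      and X: "X = M - l *\<^sub>R e" for X s M :: "real^3"
  proof -
    define c where "c = (X \<bullet> s) / (norm s)\<^sup>2"
    have ss: "s \<bullet> s = (norm s)\<^sup>2" by (simp add: dot_square_norm)
    define w where "w = X - c *\<^sub>R s"
    have ws: "w \<bullet> s = 0" unfolding w_def c_def using s ss by (simp add: inner_diff_left)
    have "w \<bullet> X = w \<bullet> w" using ws by (simp add: w_def inner_diff_right inner_diff_left)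
    then have "w = 0" using orth[OF ws] by (metis inner_gt_zero_iff not_less)
    then have Xc: "X = c *\<^sub>R s" by (simp add: w_def)
    then have nX: "norm X = \<bar>c\<bar> * norm s" by simp
    have "norm M \<le> norm X + norm (l *\<^sub>R e)" using norm_triangle_ineq[of X "l *\<^sub>R e"] by (simp add: X)
    then have big: "3/4 \<le> norm X" using neg(2) e l by simp
    have "c < 0"
    proof (rule ccontr)
      assume "\<not> c < 0"
      then have c: "0 \<le> c" "norm X = c * norm s" using nX by auto
      then have "norm X * norm s = X \<bullet> s" using ss unfolding Xc by (simp add: power2_eq_square)
      also have "\<dots> = M \<bullet> s - l * (e \<bullet> s)" by (simp add: X inner_diff_left)
      also have "\<dots> \<le> l * norm s"
      proof -
        have "- (e \<bullet> s) \<le> norm s" using Cauchy_Schwarz_ineq2[of e s] e by (simp add: abs_le_iff)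
        from mult_left_mono[OF this l(1)] show ?thesis using neg(1) by simp
      qed
      finally show False using s big l(2) by simp
    qed
    then show ?thesis using Xc nX s by simp
  qed
    have A: "A = - norm A *\<^sub>R (p /\<^sub>R norm p)"
  proof (rule par[OF _ p(1)])
    show "w \<bullet> A \<le> 0" if "w \<bullet> p = 0" for w using le[of 0 w 0] that by simp
  qed (use conormal_inner_le_0[OF t0' x0 p(2)] N in \<open>auto simp: A_def\<close>)
  have B': "B' = - norm B' *\<^sub>R (q /\<^sub>R norm q)"
  proof (rule par[OF _ q(1)])
    show "w \<bullet> B' \<le> 0" if "w \<bullet> q = 0" for w using le[of 0 0 "- w"] that by simp
  qed (use conormal_inner_le_0[OF t0' y0 q(2)] N in \<open>auto simp: B'_def\<close>)
  have "norm A * V (t0, x0) = - (((V (t0, x0) / norm p) *\<^sub>R p) \<bullet> A)"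
    using p(1) by (subst A) (simp add: dot_square_norm power2_eq_square)
  moreover have "norm B' * V (t0, y0) = - (((V (t0, y0) / norm q) *\<^sub>R q) \<bullet> B')"
    using q(1) by (subst B') (simp add: dot_square_norm power2_eq_square)
  moreover have "((V (t0, x0) / norm p) *\<^sub>R p) \<bullet> A - ((V (t0, y0) / norm q) *\<^sub>R q) \<bullet> B' - L * (-1) * \<rho> \<le> 0"
    by (rule le) (use p(1) q(1) in \<open>simp_all add: dot_square_norm power2_eq_square\<close>)
  ultimately have "L * \<rho> \<le> norm A * V (t0, x0) - norm B' * V (t0, y0)" by simp
  also have "\<dots> = norm A * (V (t0, x0) - V (t0, y0)) + (norm A - norm B') * V (t0, y0)"
    by (simp add: algebra_simps)
  also have "\<dots> \<le> (3/2) * (K * \<rho>) + (B * \<rho>) * K"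
  proof (rule add_mono)
    have "norm A \<le> 3/2" using norm_triangle_ineq4[of ?N "l *\<^sub>R e"] N e l by (simp add: A_def)
    then have "norm A * \<bar>V (t0, x0) - V (t0, y0)\<bar> \<le> (3/2) * (K * \<rho>)"
      using speed_lipschitz[OF t0' x0c(1) y0c(1)] by (intro mult_mono) (auto simp: \<rho>_def)
    then show "norm A * (V (t0, x0) - V (t0, y0)) \<le> (3/2) * (K * \<rho>)"
      using mult_left_mono[OF abs_ge_self[of "V (t0, x0) - V (t0, y0)"] norm_ge_zero[of A]] by linarith
    have "\<bar>norm A - norm B'\<bar> \<le> norm (A - B')" by (rule norm_triangle_ineq3)
    also have "\<dots> = dist ?N ?M" by (simp add: A_def B'_def dist_norm)
    also have "\<dots> \<le> B * \<rho>" using lipschitz_onD[OF B x0f(4) y0f(4)] by (simp add: \<rho>_def dist_norm)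
    finally have "\<bar>norm A - norm B'\<bar> * \<bar>V (t0, y0)\<bar> \<le> (B * \<rho>) * K"
      using speed_bound[OF t0' y0c(1)] B0 \<rho> by (intro mult_mono) auto
    then show "(norm A - norm B') * V (t0, y0) \<le> (B * \<rho>) * K"
      by (metis abs_ge_self abs_mult order_trans)
  qed
  also have "\<dots> = (K * (3/2 + B)) * \<rho>" by (simp add: algebra_simps)
  finally have "L \<le> K * (3/2 + B)" using \<rho> by simp
  then show False using K by (simp add: L_def)
qed

text \<open>
  The estimate of the signed distance in terms of points of the front becomes one in terms of foot
  points: the distance of the points contains the difference of the heights only with the factor
  \<open>L \<le> 1/2\<close>, so this part can be absorbed.
\<close>

lemma height_lipschitz:
  assumes B: "B-lipschitz_on inner_tube unit_normal" and small: "K * (2 + B) * \<tau> \<le> 1 / 4"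
    and C: "C-lipschitz_on \<Gamma> n" and t: "t \<in> {0<..<\<tau>}" and \<gamma>: "\<gamma> \<in> \<Gamma>" "\<gamma>' \<in> \<Gamma>"
  shows "\<bar>g t \<gamma> - g t \<gamma>'\<bar> \<le> 2 * (K * (2 + B) * \<tau>) * (1 + a * C) * norm (\<gamma> - \<gamma>')"
proof -
  have t': "t \<in> {0..<\<tau>}" using t by auto
  let ?x = "\<gamma> + g t \<gamma> *\<^sub>R n \<gamma>" and ?y = "\<gamma>' + g t \<gamma>' *\<^sub>R n \<gamma>'"
  have s: "sdist ?x = g t \<gamma>" "sdist ?y = g t \<gamma>'"
    using height_bound[OF t'] a_pos \<gamma> by (intro sdist_tube; force)+
  have f: "?x \<in> front t" "?y \<in> front t" using front_point[OF t'] \<gamma> by auto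
  define L where "L = K * (2 + B) * \<tau>"
  have B0: "0 \<le> B" using B by (rule lipschitz_on_nonneg)
  have C0: "0 \<le> C" using C by (rule lipschitz_on_nonneg)
  have tL: "K * (2 + B) * t \<le> L" unfolding L_def using K B0 t by (intro mult_left_mono) auto
  have L: "0 \<le> L" "L \<le> 1/2" "0 \<le> K * (2 + B) * \<tau>" using small K B0 t by (auto simp: L_def)
  define d where "d = \<bar>g t \<gamma> - g t \<gamma>'\<bar>"
  have "d \<le> K * (2 + B) * t * norm (?x - ?y)"
    using sdist_front_lipschitz[OF B small t f] sdist_front_lipschitz[OF B small t f(2,1)] s
    by (simp add: d_def abs_le_iff norm_minus_commute)
  also have "\<dots> \<le> L * norm (?x - ?y)" using tL by (rule mult_right_mono) simp
  also have "norm (?x - ?y) \<le> norm (\<gamma> - \<gamma>') + (d + a * (C * norm (\<gamma> - \<gamma>')))"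
  proof -
    have "?x - ?y = (\<gamma> - \<gamma>') + ((g t \<gamma> - g t \<gamma>') *\<^sub>R n \<gamma> + g t \<gamma>' *\<^sub>R (n \<gamma> - n \<gamma>'))"
      by (simp add: algebra_simps)
    also have "norm \<dots> \<le> norm (\<gamma> - \<gamma>') + (norm ((g t \<gamma> - g t \<gamma>') *\<^sub>R n \<gamma>) + norm (g t \<gamma>' *\<^sub>R (n \<gamma> - n \<gamma>')))"
      by (intro norm_triangle_mono order_refl norm_triangle_ineq)
    also have "norm ((g t \<gamma> - g t \<gamma>') *\<^sub>R n \<gamma>) = d" using normal(2)[OF \<gamma>(1)] by (simp add: d_def)
    also have "norm (g t \<gamma>' *\<^sub>R (n \<gamma> - n \<gamma>')) \<le> a * (C * norm (\<gamma> - \<gamma>'))"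
      using height_bound[OF t' \<gamma>(2)] lipschitz_onD[OF C \<gamma>] a_pos
      by (simp add: dist_norm) (intro mult_mono, auto)
    finally show ?thesis by simp
  qed
  finally have "d \<le> L * (norm (\<gamma> - \<gamma>') + (d + a * (C * norm (\<gamma> - \<gamma>'))))"
    using L(1) by (simp add: mult_left_mono)
  also have "\<dots> = L * d + L * (1 + a * C) * norm (\<gamma> - \<gamma>')" by (simp add: algebra_simps)
  also have "L * d \<le> (1/2) * d" using L(2) by (rule mult_right_mono) (simp add: d_def)
  finally have "d \<le> 2 * L * (1 + a * C) * norm (\<gamma> - \<gamma>')" by simp
  then show ?thesis by (simp add: d_def L_def)
qed

end

section \<open>The displacement of the motion function in the reference cell\<close>

lemma cutoff_differentiable:
  assumes "cutoff \<eta>" "0 < r"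
  shows "(\<eta> has_real_derivative deriv \<eta> r) (at r)" "\<bar>deriv \<eta> r\<bar> \<le> 4"
proof -
  have "Ck_map 1 {0..} \<eta>" using assms by (simp add: cutoff_def)
  then obtain V g where V: "open V" "r \<in> V" "Ck_on 1 V g" "\<forall>y\<in>{0..} \<inter> V. g y = \<eta> y"
    unfolding Ck_map_def using assms(2) by (meson atLeast_iff less_imp_le)
  have "g differentiable (at r)" using V(2,3) by simp
  then obtain D where "(g has_real_derivative D) (at r)" by (auto simp: real_differentiable_def)
  then have "(\<eta> has_real_derivative D) (at r)"
    by (rule has_field_derivative_transform_within_open[of _ _ _ "V \<inter> {0<..}"]) (use V assms in auto)
  then show "(\<eta> has_real_derivative deriv \<eta> r) (at r)" by (simp add: DERIV_deriv_iff_has_field_derivative DERIV_imp_deriv)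
  show "\<bar>deriv \<eta> r\<bar> \<le> 4" using assms by (simp add: cutoff_def)
qed

lemma onorm_le_norm:
  assumes "bounded_linear f" "onorm f \<le> C" shows "norm (f x) \<le> C * norm x"
  using onorm[OF assms(1), of x] mult_right_mono[OF assms(2) norm_ge_zero[of x]] by linarith

context reference_cell
begin

text \<open>
  The rescaled motion function minus the identity, for the height function \<open>h\<close> of a fixed time.
\<close>

definition displacement :: "(real \<Rightarrow> real) \<Rightarrow> (real^3 \<Rightarrow> real) \<Rightarrow> real^3 \<Rightarrow> real^3" where
  "displacement \<eta> h y = (if y \<in> U then (h (foot y) * \<eta> (infdist y \<Gamma> / a)) *\<^sub>R unit_normal y else 0)"

text \<open>
  Two open sets that cover the space: on \<open>far\<close> the cut-off vanishes, on \<open>near\<close> all factors of the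
  displacement are differentiable.
\<close>

definition "far = {y. \<Gamma> = {} \<or> 2 * a / 3 < infdist y \<Gamma>}"

lemma open_far: "open far"
proof (cases "\<Gamma> = {}")
  case False
  have "continuous_on UNIV (\<lambda>y. infdist y \<Gamma>)" by (intro continuous_intros)
  then have "open {y. 2 * a / 3 < infdist y \<Gamma>}" by (intro open_Collect_less) auto
  with False show ?thesis by (simp add: far_def)
qed (simp add: far_def)

lemma displacement_far: "cutoff \<eta> \<Longrightarrow> y \<in> far \<Longrightarrow> displacement \<eta> h y = 0"
proof -
  assume "cutoff \<eta>" "y \<in> far"
  moreover have "2/3 < infdist y \<Gamma> / a" if "2 * a / 3 < infdist y \<Gamma>"
    using that a_pos by (simp add: field_simps)
  ultimately show ?thesis by (auto simp: far_def displacement_def cutoff_def tube_eq_infdist)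
qed

definition "near = {y \<in> U. infdist y \<Gamma> < 3 * a / 4}"

lemma open_near: "open near"
proof -
  have "continuous_on UNIV (\<lambda>y. infdist y \<Gamma>)" by (intro continuous_intros)
  then have "open {y. infdist y \<Gamma> < 3 * a / 4}" by (intro open_Collect_less) auto
  moreover have "near = U \<inter> {y. infdist y \<Gamma> < 3 * a / 4}" by (auto simp: near_def)
  ultimately show ?thesis using open_U by auto
qed

lemma near_subset: "near \<subseteq> U" "near \<subseteq> inner_tube"
  by (auto simp: near_def inner_tube_def)

lemma near_or_far: "y \<in> near \<or> y \<in> far"
  using a_pos by (auto simp: near_def far_def tube_eq_infdist)

lemma derivative_bound_of_lipschitz_near:
  assumes f: "L-lipschitz_on inner_tube f" and y: "y \<in> near" and f': "(f has_derivative f') (at y)"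
  shows "norm (f' v) \<le> L * norm v"
proof (rule derivative_bound_of_local_bound[OF f'])
  have "\<forall>\<^sub>F z in at y. z \<in> near" by (rule eventually_at_in_open'[OF open_near y])
  then show "\<forall>\<^sub>F z in at y. norm (f z - f y) \<le> L * norm (z - y)"
    by eventually_elim (use lipschitz_onD[OF f] y near_subset in \<open>auto simp: dist_norm\<close>)
qed

text \<open>
  The distance is not differentiable on the surface, but there the cut-off is constant. Elsewhere the
  distance is the signed distance up to a locally constant sign.
\<close>

lemma cutoff_dist_derivative:
  assumes \<eta>: "cutoff \<eta>" and y: "y \<in> U"
  obtains D where "((\<lambda>y. \<eta> (infdist y \<Gamma> / a)) has_derivative D) (at y)"
    "\<And>v. \<bar>D v\<bar> \<le> 4 / a * norm v"
proof (cases "infdist y \<Gamma> < a / 3")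
  case True
  have "continuous_on UNIV (\<lambda>y. infdist y \<Gamma>)" by (intro continuous_intros)
  then have "open {y. infdist y \<Gamma> < a / 3}" by (intro open_Collect_less) auto
  moreover have "1 = \<eta> (infdist z \<Gamma> / a)" if "z \<in> {y. infdist y \<Gamma> < a / 3}" for z
    using \<eta> a_pos that infdist_nonneg[of z \<Gamma>] by (auto simp: cutoff_def field_simps)
  ultimately have "((\<lambda>y. \<eta> (infdist y \<Gamma> / a)) has_derivative (\<lambda>v. 0)) (at y)"
    using True by (intro has_derivative_transform_within_open[OF has_derivative_const]) auto
  then show ?thesis using a_pos by (intro that[of "\<lambda>v. 0"]) auto
next
  case False
  define \<sigma> where "\<sigma> = sgn (sdist y)"
  have pos: "0 < \<sigma> * sdist y" using False abs_sdist[OF y] a_pos by (auto simp: \<sigma>_def sgn_if split: if_splits)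
  have \<sigma>: "\<sigma> = 1 \<or> \<sigma> = -1" using pos by (auto simp: \<sigma>_def sgn_if)
  define W where "W = U \<inter> (\<lambda>z. \<sigma> * sdist z) -` {0<..}"
  have "continuous_on U (\<lambda>z. \<sigma> * sdist z)" by (intro continuous_intros continuous_on_sdist)
  then have W: "open W" "y \<in> W"
    unfolding W_def using open_U y pos by (auto simp: continuous_on_open_vimage Int_commute)
  have eq: "\<eta> (\<sigma> * sdist z / a) = \<eta> (infdist z \<Gamma> / a)" if "z \<in> W" for z
  proof -
    have "\<sigma> * sdist z = \<bar>sdist z\<bar>" using that \<sigma> by (auto simp: W_def)
    then show ?thesis using that abs_sdist[of z] by (simp add: W_def)
  qed
  let ?r = "\<sigma> * sdist y / a"
  have r: "0 < ?r" using pos a_pos by simp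
  have "((\<lambda>z. \<sigma> * sdist z / a) has_derivative (\<lambda>v. \<sigma> * (v \<bullet> unit_normal y) / a)) (at y)"
    using sdist_has_derivative[OF y] a_pos by (auto intro!: derivative_eq_intros)
  from diff_chain_at[OF this, of \<eta> "(*) (deriv \<eta> ?r)"] cutoff_differentiable(1)[OF \<eta> r]
  have "((\<lambda>z. \<eta> (\<sigma> * sdist z / a)) has_derivative (\<lambda>v. deriv \<eta> ?r * (\<sigma> * (v \<bullet> unit_normal y) / a))) (at y)"
    by (simp add: o_def has_field_derivative_def)
  then have "((\<lambda>z. \<eta> (infdist z \<Gamma> / a)) has_derivative (\<lambda>v. deriv \<eta> ?r * (\<sigma> * (v \<bullet> unit_normal y) / a))) (at y)"
    by (rule has_derivative_transform_within_open[OF _ W eq])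
  moreover have "\<bar>deriv \<eta> ?r * (\<sigma> * (v \<bullet> unit_normal y) / a)\<bar> \<le> 4 / a * norm v" for v
  proof -
    have "\<bar>deriv \<eta> ?r * (\<sigma> * (v \<bullet> unit_normal y) / a)\<bar> = \<bar>deriv \<eta> ?r\<bar> * (\<bar>v \<bullet> unit_normal y\<bar> / a)"
      using \<sigma> a_pos by (auto simp: abs_mult)
    also have "\<dots> \<le> 4 * (norm v / a)"
    proof (intro mult_mono cutoff_differentiable(2)[OF \<eta> r] divide_right_mono)
      show "\<bar>v \<bullet> unit_normal y\<bar> \<le> norm v"
        using Cauchy_Schwarz_ineq2[of v "unit_normal y"] norm_unit_normal[OF y] by simp
    qed (use a_pos in auto)
    finally show ?thesis by simp
  qed
  ultimately show ?thesis by (rule that)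
qed

lemma height_foot_derivative:
  assumes h: "\<And>\<gamma>. \<gamma> \<in> \<Gamma> \<Longrightarrow> (h has_derivative h' \<gamma>) (at \<gamma> within \<Gamma>)" and y: "y \<in> U"
    and D: "(foot has_derivative D) (at y)"
  shows "((\<lambda>z. h (foot z)) has_derivative (\<lambda>v. h' (foot y) (D v))) (at y)"
proof -
  have "((\<lambda>z. h (foot z)) has_derivative (\<lambda>v. h' (foot y) (D v))) (at y within U)"
  proof (rule has_derivative_in_compose[OF has_derivative_at_withinI[OF D]])
    show "(h has_derivative h' (foot y)) (at (foot y) within foot ` U)"
      by (rule has_derivative_subset[OF h]) (use foot_in y in auto)
  qed
  then show ?thesis unfolding at_within_open[OF y open_U] .
qed

text \<open>
  Product rule. The bound \<open>S\<close> for the slope of the height is kept abstract, since it comes from two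
  sources: the bound on the surface derivative (uniform for all fronts) and the Lipschitz estimate
  (small for slow fronts).
\<close>

lemma displacement_derivative:
  assumes \<eta>: "cutoff \<eta>" and h: "\<And>\<gamma>. \<gamma> \<in> \<Gamma> \<Longrightarrow> (h has_derivative h' \<gamma>) (at \<gamma> within \<Gamma>)"
    and C: "C-lipschitz_on inner_tube unit_normal"
    and b: "\<And>\<gamma>. \<gamma> \<in> \<Gamma> \<Longrightarrow> \<bar>h \<gamma>\<bar> \<le> b" "0 \<le> b" and S: "0 \<le> S"
    and hS: "\<And>y D v. y \<in> near \<Longrightarrow> ((\<lambda>z. h (foot z)) has_derivative D) (at y) \<Longrightarrow> \<bar>D v\<bar> \<le> S * norm v"
  obtains D where "(displacement \<eta> h has_derivative D) (at y)"
    "\<And>v. norm (D v) \<le> (S + b * (4 / a + C)) * norm v"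
proof -
  have C0: "0 \<le> C" using C by (rule lipschitz_on_nonneg)
  have const: "0 \<le> S + b * (4 / a + C)" using S b(2) a_pos C0 by simp
  show ?thesis
  proof (cases "y \<in> near")
    case False
    then have "y \<in> far" using near_or_far by blast
    then have "(displacement \<eta> h has_derivative (\<lambda>v. 0)) (at y)"
      by (rule has_derivative_transform_within_open[OF has_derivative_const open_far])
        (simp add: displacement_far[OF \<eta>])
    then show ?thesis using const by (intro that[of "\<lambda>v. 0"]) auto
  next
    case True
    then have y: "y \<in> U" using near_subset by blast
    obtain F where F: "(foot has_derivative F) (at y)"
      using differentiable_coordinates(1)[OF y] by (auto simp: differentiable_def)
    note dh = height_foot_derivative[OF h y F]
    obtain Z where Z: "((\<lambda>y. \<eta> (infdist y \<Gamma> / a)) has_derivative Z) (at y)" "\<And>v. \<bar>Z v\<bar> \<le> 4 / a * norm v"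
      using cutoff_dist_derivative[OF \<eta> y] by blast
    obtain N where N: "(unit_normal has_derivative N) (at y)"
      using differentiable_unit_normal[OF y] by (auto simp: differentiable_def)
    let ?h = "h (foot y)" and ?\<eta> = "\<eta> (infdist y \<Gamma> / a)" and ?h' = "\<lambda>v. h' (foot y) (F v)"
    let ?D = "\<lambda>v. (?h * ?\<eta>) *\<^sub>R N v + (?h * Z v + ?h' v * ?\<eta>) *\<^sub>R unit_normal y"
    have "((\<lambda>y. (h (foot y) * \<eta> (infdist y \<Gamma> / a)) *\<^sub>R unit_normal y) has_derivative ?D) (at y)"
      by (rule has_derivative_scaleR[OF has_derivative_mult[OF dh Z(1)] N])
    then have "(displacement \<eta> h has_derivative ?D) (at y)"
      by (rule has_derivative_transform_within_open[OF _ open_U y]) (simp add: displacement_def)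
    moreover have "norm (?D v) \<le> (S + b * (4 / a + C)) * norm v" for v
    proof -
      have \<eta>1: "\<bar>?\<eta>\<bar> \<le> 1" using \<eta> a_pos infdist_nonneg[of y \<Gamma>] by (auto simp: cutoff_def abs_le_iff)
      have hb: "\<bar>?h\<bar> \<le> b" using b(1) foot_in[OF y] by blast
      have "norm (?D v) \<le> norm ((?h * ?\<eta>) *\<^sub>R N v) + (norm ((?h * Z v) *\<^sub>R unit_normal y) + norm ((?h' v * ?\<eta>) *\<^sub>R unit_normal y))"
        unfolding scaleR_add_left by (intro norm_triangle_mono order_refl norm_triangle_ineq)
      also have "\<dots> = \<bar>?h\<bar> * \<bar>?\<eta>\<bar> * norm (N v) + (\<bar>?h\<bar> * \<bar>Z v\<bar> + \<bar>?h' v\<bar> * \<bar>?\<eta>\<bar>)"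
        using norm_unit_normal[OF y] by (simp add: abs_mult)
      also have "\<dots> \<le> b * 1 * (C * norm v) + (b * (4 / a * norm v) + (S * norm v) * 1)"
      proof (intro add_mono mult_mono hb \<eta>1 Z(2))
        show "norm (N v) \<le> C * norm v" by (rule derivative_bound_of_lipschitz_near[OF C True N])
        show "\<bar>?h' v\<bar> \<le> S * norm v" by (rule hS[OF True dh])
      qed (use b(2) S C0 a_pos in auto)
      also have "\<dots> = (S + b * (4 / a + C)) * norm v" by (simp add: algebra_simps)
      finally show ?thesis .
    qed
    ultimately show ?thesis by (rule that)
  qed
qed

lemma height_foot_bound_of_lipschitz:
  assumes P: "P-lipschitz_on inner_tube foot" and h: "L-lipschitz_on \<Gamma> h" and y: "y \<in> near"
    and D: "((\<lambda>z. h (foot z)) has_derivative D) (at y)"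
  shows "\<bar>D v\<bar> \<le> (L * P) * norm v"
proof -
  have "foot ` inner_tube \<subseteq> \<Gamma>" by (auto simp: inner_tube_def foot_in)
  then have "(L * P)-lipschitz_on inner_tube (\<lambda>z. h (foot z))"
    by (intro lipschitz_on_compose2 P lipschitz_on_subset[OF h])
  from derivative_bound_of_lipschitz_near[OF this y D] show ?thesis by simp
qed

lemma height_foot_bound_of_onorm:
  assumes P: "P-lipschitz_on inner_tube foot"
    and h: "\<And>\<gamma>. \<gamma> \<in> \<Gamma> \<Longrightarrow> (h has_derivative h' \<gamma>) (at \<gamma> within \<Gamma>)"
    and S: "\<And>\<gamma>. \<gamma> \<in> \<Gamma> \<Longrightarrow> onorm (h' \<gamma>) \<le> S" and y: "y \<in> near"
    and D: "((\<lambda>z. h (foot z)) has_derivative D) (at y)"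
  shows "\<bar>D v\<bar> \<le> (S * P) * norm v"
proof -
  have yU: "y \<in> U" using y near_subset by blast
  obtain F where F: "(foot has_derivative F) (at y)"
    using differentiable_coordinates(1)[OF yU] by (auto simp: differentiable_def)
  have \<gamma>: "foot y \<in> \<Gamma>" by (rule foot_in[OF yU])
  have bl: "bounded_linear (h' (foot y))" by (rule has_derivative_bounded_linear[OF h[OF \<gamma>]])
  have S0: "0 \<le> S" using onorm_pos_le[OF bl] S[OF \<gamma>] by linarith
  have "D = (\<lambda>v. h' (foot y) (F v))"
    by (rule has_derivative_unique[OF D height_foot_derivative[OF h yU F]])
  then have "\<bar>D v\<bar> \<le> S * norm (F v)" using onorm_le_norm[OF bl S[OF \<gamma>], of "F v"] by simp
  also have "\<dots> \<le> S * (P * norm v)"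
    using derivative_bound_of_lipschitz_near[OF P y F] S0 by (rule mult_left_mono)
  finally show ?thesis by simp
qed

lemma continuous_displacement:
  assumes \<eta>: "cutoff \<eta>" and T: "open T"
    and g: "continuous_on (T \<times> \<Gamma>) (\<lambda>(t, \<gamma>). g t \<gamma>)"
  shows "continuous_on (T \<times> UNIV) (\<lambda>(t, y). displacement \<eta> (g t) y)"
proof -
  have "continuous_on (T \<times> U \<union> T \<times> far) (\<lambda>(t, y). displacement \<eta> (g t) y)"
  proof (rule continuous_on_open_Un)
    show "open (T \<times> U)" "open (T \<times> far)" using T open_U open_far by (auto intro: open_Times)
    have g': "continuous_on (T \<times> U) (\<lambda>z. g (fst z) (foot (snd z)))"
    proof -
      have "continuous_on (T \<times> U) ((\<lambda>(t, \<gamma>). g t \<gamma>) \<circ> (\<lambda>z. (fst z, foot (snd z))))"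
      proof (intro continuous_on_compose continuous_on_Pair continuous_intros)
        show "continuous_on (T \<times> U) (\<lambda>z. foot (snd z))"
          by (rule continuous_on_compose2[OF continuous_on_foot]) (auto intro!: continuous_intros)
        show "continuous_on ((\<lambda>z. (fst z, foot (snd z))) ` (T \<times> U)) (\<lambda>(t, \<gamma>). g t \<gamma>)"
          by (rule continuous_on_subset[OF g]) (auto intro: foot_in)
      qed
      then show ?thesis by (simp add: o_def case_prod_unfold)
    qed
    have N: "continuous_on U unit_normal"
      using differentiable_unit_normal
      by (auto intro!: differentiable_imp_continuous_on differentiable_at_imp_differentiable_on)
    have Z: "continuous_on U (\<lambda>y. \<eta> (infdist y \<Gamma> / a))"
    proof (rule differentiable_imp_continuous_on, rule differentiable_at_imp_differentiable_on)
      show "(\<lambda>y. \<eta> (infdist y \<Gamma> / a)) differentiable (at y)" if "y \<in> U" for y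
        using cutoff_dist_derivative[OF \<eta> that] by (metis differentiableI)
    qed
    have "continuous_on (T \<times> U) (\<lambda>z. (g (fst z) (foot (snd z)) * \<eta> (infdist (snd z) \<Gamma> / a)) *\<^sub>R unit_normal (snd z))"
      by (intro continuous_on_scaleR continuous_on_mult g' continuous_on_compose2[OF N]
          continuous_on_compose2[OF Z]) (auto intro!: continuous_intros)
    then show "continuous_on (T \<times> U) (\<lambda>(t, y). displacement \<eta> (g t) y)"
      by (rule continuous_on_eq) (auto simp: displacement_def)
    show "continuous_on (T \<times> far) (\<lambda>(t, y). displacement \<eta> (g t) y)"
      by (rule continuous_on_eq[OF continuous_on_const[of _ 0]]) (auto simp: displacement_far[OF \<eta>])
  qed
  moreover have "T \<times> U \<union> T \<times> far = T \<times> UNIV" using near_or_far near_subset by blast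
  ultimately show ?thesis by simp
qed

end

text \<open>Each entry is a limit of difference quotients, which are continuous in time and space.\<close>

lemma measurable_jacobian:
  fixes f :: "real \<Rightarrow> real^3 \<Rightarrow> real^3"
  assumes T: "open T" and f: "continuous_on (T \<times> UNIV) (\<lambda>(t, y). f t y)"
    and d: "\<And>t y. t \<in> T \<Longrightarrow> f t differentiable (at y)"
  shows "(\<lambda>(t, y). if t \<in> T then matrix (frechet_derivative (f t) (at y)) else 0) \<in> borel_measurable borel"
    (is "?J \<in> _")
proof -
  have entry: "(\<lambda>z. ?J z $ i $ j) \<in> borel_measurable borel" for i j
  proof (rule borel_measurable_LIMSEQ_real)
    let ?q = "\<lambda>m (t, y). if t \<in> T then real (Suc m) * (f t (y + (1 / real (Suc m)) *\<^sub>R axis j 1) - f t y) $ i else 0"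
    show "?q m \<in> borel_measurable borel" for m
    proof -
      have 1: "continuous_on (T \<times> UNIV) (\<lambda>z. f (fst z) (snd z + c))" for c
      proof -
        have "continuous_on (T \<times> UNIV) ((\<lambda>(t, y). f t y) \<circ> (\<lambda>z. (fst z, snd z + c)))"
          by (intro continuous_on_compose continuous_intros continuous_on_subset[OF f]) auto
        then show ?thesis by (simp add: o_def case_prod_unfold)
      qed
      have "continuous_on (T \<times> UNIV) (\<lambda>z. real (Suc m) * (f (fst z) (snd z + (1 / real (Suc m)) *\<^sub>R axis j 1) - f (fst z) (snd z)) $ i)"
        using 1 1[of 0] by (intro continuous_intros) auto
      then have "(\<lambda>z. if z \<in> T \<times> UNIV then real (Suc m) * (f (fst z) (snd z + (1 / real (Suc m)) *\<^sub>R axis j 1) - f (fst z) (snd z)) $ i else 0)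
          \<in> borel_measurable borel"
        using T by (intro borel_measurable_continuous_on_if continuous_on_const) (auto intro: borel_open open_Times)
      then show ?thesis by (simp add: case_prod_unfold mem_Times_iff)
    qed
    fix z :: "real \<times> (real^3)"
    obtain t y where z: "z = (t, y)" by (cases z)
    show "(\<lambda>m. ?q m z) \<longlonglongrightarrow> ?J z $ i $ j"
    proof (cases "t \<in> T")
      case True
      let ?f' = "frechet_derivative (f t) (at y)"
      have df: "(f t has_derivative ?f') (at y)" using d[OF True] by (simp add: frechet_derivative_works)
      have "((\<lambda>s. y + s *\<^sub>R axis j 1) has_derivative (\<lambda>s. s *\<^sub>R axis j 1)) (at 0)"
        by (auto intro!: derivative_eq_intros)
      from diff_chain_at[OF this, of "f t" ?f'] df
      have "((\<lambda>s. f t (y + s *\<^sub>R axis j 1)) has_derivative (\<lambda>s. ?f' (s *\<^sub>R axis j 1))) (at 0)"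
        by (simp add: o_def)
      then have "((\<lambda>s. f t (y + s *\<^sub>R axis j 1) $ i) has_derivative (\<lambda>s. ?f' (s *\<^sub>R axis j 1) $ i)) (at 0)"
        by (rule bounded_linear.has_derivative[OF bounded_linear_vec_nth])
      moreover have "?f' (s *\<^sub>R axis j 1) $ i = s * (?f' (axis j 1) $ i)" for s
        using linear_cmul[OF has_derivative_linear[OF df]] by simp
      ultimately have "((\<lambda>s. f t (y + s *\<^sub>R axis j 1) $ i) has_real_derivative ?f' (axis j 1) $ i) (at 0)"
        by (simp add: has_field_derivative_def mult_commute_abs)
      then have lim: "((\<lambda>s. (f t (y + s *\<^sub>R axis j 1) $ i - f t y $ i) / s) \<longlongrightarrow> ?f' (axis j 1) $ i) (at 0)"
        by (simp add: has_field_derivative_iff)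
      have seq: "filterlim (\<lambda>m. 1 / real (Suc m)) (at 0) sequentially"
        unfolding filterlim_at using LIMSEQ_Suc[OF lim_1_over_n] by (auto intro!: eventuallyI)
      from filterlim_compose[OF lim seq] show ?thesis
        using True by (simp add: z matrix_def mult.commute)
    qed (simp add: z)
  qed
  show ?thesis
    unfolding borel_measurable_euclidean_space[where 'c = "real^3^3"]
  proof
    fix b :: "real^3^3" assume "b \<in> Basis"
    then obtain i j where "b = axis i (axis j 1)" by (auto simp: Basis_vec_def)
    then show "(\<lambda>z. ?J z \<bullet> b) \<in> borel_measurable borel" using entry[of i j] by (simp add: inner_axis)
  qed
qed

context moving_front
begin

text \<open>
  The graph of the height function over \<open>[0, t1] \<times> \<Gamma>\<close> is the zero set of a continuous function on a
  compact set, hence compact, and a function with compact graph is continuous.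
\<close>

lemma continuous_height: "continuous_on ({0<..<\<tau>} \<times> \<Gamma>) (\<lambda>(t, \<gamma>). g t \<gamma>)"
proof -
  obtain L where L: "L-lipschitz_on \<Gamma> n" by (rule normal_lipschitz)
  then have n: "continuous_on \<Gamma> n" by (rule lipschitz_on_continuous_on)
  have compact: "continuous_on ({0..t1} \<times> \<Gamma>) (\<lambda>(t, \<gamma>). g t \<gamma>)" if t1: "t1 < \<tau>" for t1
  proof -
    let ?K = "{0..t1} \<times> \<Gamma> \<times> {-(a/10)..a/10}"
    let ?f = "\<lambda>w. (fst w, fst (snd w) + snd (snd w) *\<^sub>R n (fst (snd w)))"
    have inU: "\<gamma> + r *\<^sub>R n \<gamma> \<in> unit_cell" if "\<gamma> \<in> \<Gamma>" "\<bar>r\<bar> \<le> a/10" for \<gamma> r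
    proof -
      have "\<bar>r\<bar> < a" using that(2) a_pos by simp
      then have "\<gamma> + r *\<^sub>R n \<gamma> \<in> U" using infdist_tube[OF that(1)] that(1) by (auto simp: tube_eq_infdist)
      then show ?thesis using U_subset by blast
    qed
    have sub: "?f ` ?K \<subseteq> {0..<\<tau>} \<times> unit_cell"
      using t1 inU by (auto simp: abs_le_iff)
    have "continuous_on ?K (\<lambda>w. n (fst (snd w)))"
      by (rule continuous_on_compose2[OF n]) (auto intro!: continuous_intros)
    then have "continuous_on ?K ?f" by (intro continuous_intros)
    then have "continuous_on ?K (u \<circ> ?f)"
      by (intro continuous_on_compose continuous_on_subset[OF continuous_u sub])
    then have "closedin (top_of_set ?K) {w \<in> ?K. (u \<circ> ?f) w = 0}"
      by (rule continuous_closedin_preimage_constant)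
    moreover have "compact ?K" by (intro compact_Times compact_Gamma) auto
    ultimately have "compact {w \<in> ?K. (u \<circ> ?f) w = 0}" by (rule closedin_compact[rotated])
    also have "{w \<in> ?K. (u \<circ> ?f) w = 0} = (\<lambda>(t, \<gamma>). (t, \<gamma>, g t \<gamma>)) ` ({0..t1} \<times> \<Gamma>)" (is "?Z = ?G")
    proof (intro equalityI subsetI)
      fix w assume w: "w \<in> ?Z"
      then obtain t \<gamma> r where wd: "w = (t, \<gamma>, r)" "t \<in> {0..t1}" "\<gamma> \<in> \<Gamma>" "\<bar>r\<bar> \<le> a/10" "u (t, \<gamma> + r *\<^sub>R n \<gamma>) = 0"
        by (cases w) (auto simp: abs_le_iff)
      then have "\<gamma> + r *\<^sub>R n \<gamma> \<in> front t" using inU by (simp add: front_def)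
      moreover have "t \<in> {0..<\<tau>}" "\<bar>r\<bar> < a" using wd t1 a_pos by auto
      ultimately have "r = g t \<gamma>" using front_cases(3)[of t] foot_tube[OF wd(3)] sdist_tube[OF wd(3)] by metis
      with wd show "w \<in> ?G" by auto
    next
      fix w assume "w \<in> ?G"
      then obtain t \<gamma> where wd: "w = (t, \<gamma>, g t \<gamma>)" "t \<in> {0..t1}" "\<gamma> \<in> \<Gamma>" by auto
      then have t: "t \<in> {0..<\<tau>}" using t1 by auto
      have "u (t, \<gamma> + g t \<gamma> *\<^sub>R n \<gamma>) = 0" using front_point[OF t wd(3)] by (simp add: front_def)
      with wd show "w \<in> ?Z" using height_bound[OF t wd(3)] by (auto simp: abs_le_iff)
    qed
    finally have "compact ?G" .
    then have "continuous_on ((\<lambda>w. (fst w, fst (snd w))) ` ?G) (\<lambda>(t, \<gamma>). (t, \<gamma>, g t \<gamma>))"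
      by (rule continuous_on_inv[rotated]) (auto intro!: continuous_intros)
    also have "(\<lambda>w. (fst w, fst (snd w))) ` ?G = {0..t1} \<times> \<Gamma>" by (force simp: image_iff)
    finally have "continuous_on ({0..t1} \<times> \<Gamma>) (\<lambda>z. snd (snd ((\<lambda>(t, \<gamma>). (t, \<gamma>, g t \<gamma>)) z)))"
      by (intro continuous_on_snd)
    then show ?thesis by (simp add: case_prod_unfold)
  qed
  show ?thesis
    unfolding continuous_on_eq_continuous_within
  proof
    fix z assume z: "z \<in> {0<..<\<tau>} \<times> \<Gamma>"
    define t1 where "t1 = (fst z + \<tau>) / 2"
    have t1: "fst z < t1" "t1 < \<tau>" using z by (auto simp: t1_def)
    have "continuous (at z within {0..t1} \<times> \<Gamma>) (\<lambda>(t, \<gamma>). g t \<gamma>)"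
      using compact[OF t1(2)] z t1(1) by (auto simp: continuous_on_eq_continuous_within)
    moreover have "at z within {0..t1} \<times> \<Gamma> = at z within {0<..<\<tau>} \<times> \<Gamma>"
      by (rule at_within_nhd[of _ "{0<..<t1} \<times> UNIV"]) (use z t1 in \<open>auto intro: open_Times\<close>)
    ultimately show "continuous (at z within {0<..<\<tau>} \<times> \<Gamma>) (\<lambda>(t, \<gamma>). g t \<gamma>)" by simp
  qed
qed

end

section \<open>The periodic geometry\<close>

text \<open>
  The scaled geometry is transported to the reference cell by the maps \<open>place k\<close>; \<open>cells\<close> are the
  indices of the cells inside \<open>\<Omega>\<close>.
\<close>

locale perforated_domain = reference_cell +
  fixes \<epsilon> :: real and \<Omega> :: "(real^3) set"
  assumes eps_pos: "0 < \<epsilon>" and open_Omega: "open \<Omega>" and bounded_Omega: "bounded \<Omega>"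
begin

definition place :: "real^3 \<Rightarrow> real^3 \<Rightarrow> real^3" where "place k y = \<epsilon> *\<^sub>R (y + k)"

definition cells :: "(real^3) set" where
  "cells = {k. (\<forall>i. k $ i \<in> \<int>) \<and> scaled_cell \<epsilon> unit_cell k \<subseteq> \<Omega>}"

abbreviation "A \<equiv> inclusions \<epsilon> \<Omega> Y2"

lemma scaled_cell_place: "scaled_cell \<epsilon> S k = place k ` S"
  by (simp add: scaled_cell_def place_def)

lemma place_iff: "place k y = x \<longleftrightarrow> y = x /\<^sub>R \<epsilon> - k"
proof
  assume "place k y = x"
  then have "x /\<^sub>R \<epsilon> = y + k" using eps_pos by (auto simp: place_def)
  then show "y = x /\<^sub>R \<epsilon> - k" by simp
next
  assume "y = x /\<^sub>R \<epsilon> - k"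
  then show "place k y = x" using eps_pos by (simp add: place_def)
qed

lemma place_unplace [simp]: "place k (x /\<^sub>R \<epsilon> - k) = x"
  by (simp add: place_iff)

lemma unplace_place [simp]: "place k y /\<^sub>R \<epsilon> - k = y"
  using place_iff[of k y "place k y"] by simp

lemma place_inj [simp]: "place k y = place k y' \<longleftrightarrow> y = y'"
  using eps_pos by (auto simp: place_def)

lemma dist_place [simp]: "dist (place k y) (place k y') = \<epsilon> * dist y y'"
proof -
  have "place k y - place k y' = \<epsilon> *\<^sub>R (y - y')" by (simp add: place_def algebra_simps)
  then show ?thesis using eps_pos by (simp add: dist_norm)
qed

lemma place_add: "place k (y + r *\<^sub>R w) = place k y + (\<epsilon> * r) *\<^sub>R w"
  by (simp add: place_def algebra_simps)

lemma place_in_Omega: "k \<in> cells \<Longrightarrow> y \<in> unit_cell \<Longrightarrow> place k y \<in> \<Omega>"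
  by (auto simp: cells_def scaled_cell_place)

lemma place_cells_unique:
  assumes "k \<in> cells" "k' \<in> cells" "y \<in> unit_cell" "y' \<in> unit_cell" "place k y = place k' y'"
  shows "k = k' \<and> y = y'"
proof -
  have yk: "y + k = y' + k'" using assms(5) eps_pos by (simp add: place_def)
  have "k $ i = k' $ i" for i
  proof -
    have "k $ i \<in> \<int>" "k' $ i \<in> \<int>" using assms(1,2) by (auto simp: cells_def)
    then obtain m m' :: int where m: "k $ i = of_int m" "k' $ i = of_int m'"
      by (auto elim!: Ints_cases)
    have "\<bar>y $ i - y' $ i\<bar> < 1"
    proof -
      have "0 < y $ i" "y $ i < 1" "0 < y' $ i" "y' $ i < 1" using assms(3,4) by (auto simp: unit_cell_def)
      then show ?thesis by linarith
    qed
    moreover have "y $ i - y' $ i = of_int (m' - m)"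
      using arg_cong[OF yk, of "\<lambda>z. z $ i"] m by simp
    ultimately have "m' - m = 0" by linarith
    then show ?thesis using m by simp
  qed
  then have "k = k'" by (simp add: vec_eq_iff)
  with yk show ?thesis by simp
qed

lemma open_unit_cell: "open unit_cell"
  by (simp add: unit_cell_eq_box open_box)

lemma open_place: "open S \<Longrightarrow> open (place k ` S)"
proof -
  assume "open S"
  have "place k ` S = (\<lambda>x. x /\<^sub>R \<epsilon> - k) -` S"
  proof (intro equalityI subsetI)
    fix x assume "x \<in> (\<lambda>x. x /\<^sub>R \<epsilon> - k) -` S"
    then show "x \<in> place k ` S" by (intro image_eqI[of _ _ "x /\<^sub>R \<epsilon> - k"]) auto
  qed auto
  moreover have "continuous_on UNIV (\<lambda>x. x /\<^sub>R \<epsilon> - k)" by (intro continuous_intros) (use eps_pos in auto)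
  ultimately show ?thesis using \<open>open S\<close> by (simp add: continuous_on_open_vimage)
qed

lemma finite_cells: "finite cells"
proof -
  obtain M where M: "\<And>x. x \<in> \<Omega> \<Longrightarrow> norm x \<le> M"
    using bounded_Omega by (auto simp: bounded_iff)
  define N where "N = \<lceil>M / \<epsilon> + 1\<rceil>"
  have "cells \<subseteq> (\<lambda>f. \<chi> i. of_int (f i)) ` (PiE UNIV (\<lambda>_. {-N..N}))"
  proof
    fix k assume k: "k \<in> cells"
    \<comment> \<open>the centres of the cells lie in the bounded set \<open>\<Omega>\<close>\<close>
    let ?h = "(\<chi> i. 1/2) :: real^3"
    have "?h \<in> unit_cell" by (simp add: unit_cell_def)
    then have "norm (place k ?h) \<le> M" using k by (intro M place_in_Omega)
    then have b: "\<bar>(?h + k) $ i\<bar> \<le> M / \<epsilon>" for i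
    proof -
      have "\<epsilon> * \<bar>(?h + k) $ i\<bar> = \<bar>place k ?h $ i\<bar>" using eps_pos by (simp add: place_def abs_mult)
      also have "\<dots> \<le> M" using component_le_norm_cart[of "place k ?h" i] \<open>norm (place k ?h) \<le> M\<close> by linarith
      finally show ?thesis using eps_pos by (simp add: field_simps)
    qed
    have kf: "k $ i = of_int \<lfloor>k $ i\<rfloor>" for i
    proof -
      have "k $ i \<in> \<int>" using k by (simp add: cells_def)
      then show ?thesis by (auto elim!: Ints_cases)
    qed
    have "\<lfloor>k $ i\<rfloor> \<in> {-N..N}" for i
    proof -
      have "\<bar>k $ i\<bar> \<le> M / \<epsilon> + 1" using b[of i] by simp
      then have "\<bar>k $ i\<bar> \<le> of_int N" unfolding N_def by linarith
      then show ?thesis using kf[of i] by (metis abs_le_iff atLeastAtMost_iff minus_le_iff of_int_le_iff of_int_minus)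
    qed
    then have P: "(\<lambda>i. \<lfloor>k $ i\<rfloor>) \<in> PiE UNIV (\<lambda>_. {-N..N})" by (intro PiE_I) auto
    have "k = (\<chi> i. of_int \<lfloor>k $ i\<rfloor>)" using kf by (simp add: vec_eq_iff)
    then show "k \<in> (\<lambda>f. \<chi> i. of_int (f i)) ` (PiE UNIV (\<lambda>_. {-N..N}))" by (rule image_eqI[OF _ P])
  qed
  moreover have "finite (PiE (UNIV :: 3 set) (\<lambda>_. {-N..N}))" by (intro finite_PiE) auto
  ultimately show ?thesis using finite_surj by blast
qed

lemma inclusions_eq: "A = (\<Union>k\<in>cells. place k ` Y2)"
  by (simp add: inclusions_def cells_def scaled_cell_place)

lemma Y2_unit_cell: "Y2 \<subseteq> unit_cell"
  using Y2_subset closure_subset by blast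

lemma place_in_inclusions: "k \<in> cells \<Longrightarrow> y \<in> unit_cell \<Longrightarrow> place k y \<in> A \<longleftrightarrow> y \<in> Y2"
  unfolding inclusions_eq using place_cells_unique Y2_unit_cell by blast

text \<open>Closures can be computed cell by cell since the cells are open. Applied to a set and to its
  complement this gives the frontier.\<close>

lemma place_in_closure:
  assumes S: "\<And>y. y \<in> unit_cell \<Longrightarrow> place k y \<in> S \<longleftrightarrow> y \<in> S'" and y: "y \<in> unit_cell"
  shows "place k y \<in> closure S \<longleftrightarrow> y \<in> closure S'"
proof -
  obtain r where r: "0 < r" "ball y r \<subseteq> unit_cell" using open_unit_cell y by (meson openE)
  show ?thesis
    unfolding closure_approachable
  proof (intro iffI allI impI)
    fix e :: real assume *: "\<forall>e>0. \<exists>x\<in>S. dist x (place k y) < e" and e: "0 < e"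
    obtain x where x: "x \<in> S" "dist x (place k y) < \<epsilon> * min r e"
      using * eps_pos r e by (metis min_less_iff_conj mult_pos_pos)
    let ?z = "x /\<^sub>R \<epsilon> - k"
    have "dist (place k ?z) (place k y) < \<epsilon> * min r e" using x by simp
    then have "dist ?z y < min r e" using eps_pos unfolding dist_place by simp
    moreover from this have "?z \<in> unit_cell" using r(2) by (auto simp: dist_commute)
    ultimately show "\<exists>z\<in>S'. dist z y < e" using S[of ?z] x(1) by auto
  next
    fix e :: real assume *: "\<forall>e>0. \<exists>x\<in>S'. dist x y < e" and e: "0 < e"
    obtain z where z: "z \<in> S'" "dist z y < min r (e / \<epsilon>)"
      using * eps_pos r e by (metis divide_pos_pos min_less_iff_conj)
    then have "z \<in> unit_cell" using r(2) by (auto simp: dist_commute)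
    moreover have "dist (place k z) (place k y) < e" using z(2) eps_pos by (simp add: field_simps)
    ultimately show "\<exists>x\<in>S. dist x (place k y) < e" using S z(1) by blast
  qed
qed

lemma place_in_closure_inclusions:
  "k \<in> cells \<Longrightarrow> y \<in> unit_cell \<Longrightarrow> place k y \<in> closure A \<longleftrightarrow> y \<in> closure Y2"
  by (rule place_in_closure) (use place_in_inclusions in auto)

lemma place_in_frontier:
  "k \<in> cells \<Longrightarrow> y \<in> unit_cell \<Longrightarrow> place k y \<in> frontier A \<longleftrightarrow> y \<in> \<Gamma>"
  unfolding frontier_closures
  using place_in_closure_inclusions place_in_closure[of k "- A" "- Y2" y] place_in_inclusions by simp

text \<open>As \<open>\<Omega>\<close> is bounded there are finitely many inclusions, so that no further points appear in the
  closure of their union.\<close>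

lemma frontier_inclusions: "frontier A = (\<Union>k\<in>cells. place k ` \<Gamma>)"
proof (intro equalityI subsetI)
  fix x assume x: "x \<in> frontier A"
  have "closure A \<subseteq> (\<Union>k\<in>cells. place k ` closure Y2)"
  proof (rule closure_minimal)
    have "compact (closure Y2)"
      using Y2_subset unit_cell_eq_box bounded_box bounded_subset by (metis closed_closure compact_eq_bounded_closed)
    moreover have "continuous_on (closure Y2) (place k)" for k unfolding place_def by (intro continuous_intros)
    ultimately have "closed (place k ` closure Y2)" for k by (intro compact_imp_closed compact_continuous_image)
    then show "closed (\<Union>k\<in>cells. place k ` closure Y2)" using finite_cells by (intro closed_UN) auto
  qed (use closure_subset in \<open>auto simp: inclusions_eq\<close>)
  then obtain k y where k: "k \<in> cells" "y \<in> closure Y2" "x = place k y"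
    using x by (auto simp: frontier_def)
  moreover have "y \<in> unit_cell" using k Y2_subset by blast
  ultimately show "x \<in> (\<Union>k\<in>cells. place k ` \<Gamma>)" using x place_in_frontier by blast
next
  fix x assume "x \<in> (\<Union>k\<in>cells. place k ` \<Gamma>)"
  then show "x \<in> frontier A" using place_in_frontier Gamma_subset by blast
qed

lemma place_has_derivative: "(place k has_derivative (\<lambda>w. \<epsilon> *\<^sub>R w)) (at y within S)"
  unfolding place_def by (auto intro!: derivative_eq_intros simp: algebra_simps)

lemma unplace_has_derivative: "((\<lambda>x. x /\<^sub>R \<epsilon> - k) has_derivative (\<lambda>w. w /\<^sub>R \<epsilon>)) (at x within S)"
  by (auto intro!: derivative_eq_intros)

lemma defining_function_place:
  assumes k: "k \<in> cells" and d: "defining_function 1 Y2 W \<psi>"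
  shows "defining_function 1 A (place k ` (W \<inter> unit_cell)) (\<lambda>x. \<psi> (x /\<^sub>R \<epsilon> - k))"
    and "y \<in> W \<Longrightarrow> grad (\<lambda>x. \<psi> (x /\<^sub>R \<epsilon> - k)) (place k y) = grad \<psi> y /\<^sub>R \<epsilon>"
proof -
  let ?\<psi> = "\<lambda>x. \<psi> (x /\<^sub>R \<epsilon> - k)" and ?V = "place k ` (W \<inter> unit_cell)"
  have W: "open W" "Ck_on 1 W \<psi>" "\<forall>y\<in>W. grad \<psi> y \<noteq> 0" "Y2 \<inter> W = {y \<in> W. \<psi> y < 0}"
    "\<Gamma> \<inter> W = {y \<in> W. \<psi> y = 0}"
    using d by (auto simp: defining_function_def)
  have d\<psi>: "(\<psi> has_derivative frechet_derivative \<psi> (at y)) (at y)" if "y \<in> W" for y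
    using W(2) that by (simp add: frechet_derivative_works)
  have d': "(?\<psi> has_derivative (\<lambda>w. frechet_derivative \<psi> (at y) (w /\<^sub>R \<epsilon>))) (at (place k y))" if "y \<in> W" for y
    using diff_chain_at[OF unplace_has_derivative, of \<psi> "frechet_derivative \<psi> (at y)" "place k y" k] d\<psi>[OF that]
    by (simp add: o_def)
  show grad': "grad ?\<psi> (place k y) = grad \<psi> y /\<^sub>R \<epsilon>" if "y \<in> W" for y
  proof (rule grad_unique)
    have "frechet_derivative \<psi> (at y) = (\<lambda>h. h \<bullet> grad \<psi> y)" by (rule has_derivative_grad[OF d\<psi>[OF that]])
    then show "(?\<psi> has_derivative (\<lambda>h. h \<bullet> (grad \<psi> y /\<^sub>R \<epsilon>))) (at (place k y))"
      using d'[OF that] by simp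
  qed
  have fd: "frechet_derivative ?\<psi> (at x) b = frechet_derivative \<psi> (at (x /\<^sub>R \<epsilon> - k)) (b /\<^sub>R \<epsilon>)"
    if "x \<in> ?V" for x b
    using that fun_cong[OF frechet_derivative_at[OF d'], of "x /\<^sub>R \<epsilon> - k" b] by auto
  have "Ck_on 1 ?V ?\<psi>"
    unfolding One_nat_def Ck_on.simps
  proof (intro conjI ballI)
    show "?\<psi> differentiable (at x)" if "x \<in> ?V" for x
      using that d' by (auto intro: differentiableI)
    fix b :: "real^3" assume b: "b \<in> Basis"
    have "continuous_on ?V ((\<lambda>y. frechet_derivative \<psi> (at y) b) \<circ> (\<lambda>x. x /\<^sub>R \<epsilon> - k))"
    proof (intro continuous_on_compose continuous_intros)
      show "continuous_on ((\<lambda>x. x /\<^sub>R \<epsilon> - k) ` ?V) (\<lambda>y. frechet_derivative \<psi> (at y) b)"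
        using W(2) b by (auto intro: continuous_on_subset)
    qed
    then have "continuous_on ?V (\<lambda>x. (1 / \<epsilon>) * frechet_derivative \<psi> (at (x /\<^sub>R \<epsilon> - k)) b)"
      by (intro continuous_intros) (simp add: o_def)
    then show "continuous_on ?V (\<lambda>x. frechet_derivative ?\<psi> (at x) b)"
    proof (rule continuous_on_eq)
      fix x assume x: "x \<in> ?V"
      then have "linear (frechet_derivative \<psi> (at (x /\<^sub>R \<epsilon> - k)))"
        using d\<psi> by (auto intro!: has_derivative_linear[OF d\<psi>])
      then show "(1 / \<epsilon>) * frechet_derivative \<psi> (at (x /\<^sub>R \<epsilon> - k)) b = frechet_derivative ?\<psi> (at x) b"
        unfolding fd[OF x] by (simp add: linear_cmul inverse_eq_divide)
    qed
  qed
  moreover have "open ?V" using W(1) open_unit_cell by (intro open_place open_Int)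
  moreover have "\<forall>x\<in>?V. grad ?\<psi> x \<noteq> 0" using grad' W(3) eps_pos by auto
  moreover have "A \<inter> ?V = {x \<in> ?V. ?\<psi> x < 0}"
    using place_in_inclusions[OF k] W(4) by auto
  moreover have "frontier A \<inter> ?V = {x \<in> ?V. ?\<psi> x = 0}"
    using place_in_frontier[OF k] W(5) by auto
  ultimately show "defining_function 1 A ?V ?\<psi>" unfolding defining_function_def by blast
qed

lemma normal_place:
  assumes k: "k \<in> cells" and \<gamma>: "\<gamma> \<in> \<Gamma>"
  shows "outer_normal A (place k \<gamma>) = n \<gamma>" "conormal A (place k \<gamma>) (n \<gamma>)"
proof -
  have "Ck_boundary 3 Y2" using cell by (simp add: cell_geometry_def)
  then obtain W \<psi> where "\<gamma> \<in> W" "defining_function 3 Y2 W \<psi>" using \<gamma> unfolding Ck_boundary_def by blast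
  then have W: "\<gamma> \<in> W" "defining_function 1 Y2 W \<psi>" using defining_function_mono[of 3 Y2 W \<psi> 1] by auto
  have mem: "place k \<gamma> \<in> place k ` (W \<inter> unit_cell)" "place k \<gamma> \<in> frontier A"
    using W(1) \<gamma> Gamma_subset place_in_frontier[OF k] by auto
  note d = defining_function_place(1)[OF k W(2)]
  have "outer_normal A (place k \<gamma>) = sgn (grad \<psi> \<gamma> /\<^sub>R \<epsilon>)"
    unfolding outer_normal_eq[OF d mem] defining_function_place(2)[OF k W(2,1)] ..
  also have "\<dots> = n \<gamma>" using eps_pos by (simp add: outer_normal_eq[OF W(2,1) \<gamma>] sgn_scaleR)
  finally show eq: "outer_normal A (place k \<gamma>) = n \<gamma>" .
  have c: "conormal A (place k \<gamma>) (grad (\<lambda>x. \<psi> (x /\<^sub>R \<epsilon> - k)) (place k \<gamma>))" (is "conormal A _ ?g")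
    by (rule defining_function_imp_conormal[OF d mem])
  then have "?g \<noteq> 0" by (simp add: conormal_def)
  then have "conormal A (place k \<gamma>) (sgn ?g)" using conormal_scale[OF c, of "inverse (norm ?g)"] by (simp add: sgn_div_norm)
  then show "conormal A (place k \<gamma>) (n \<gamma>)" using outer_normal_eq[OF d mem] eq by simp
qed

lemma tube_map_place:
  "k \<in> cells \<Longrightarrow> \<gamma> \<in> \<Gamma> \<Longrightarrow> tube_map A (place k \<gamma>, \<epsilon> * r) = place k (\<gamma> + r *\<^sub>R n \<gamma>)"
  by (simp add: tube_map_def normal_place place_add)

lemma tube_inclusions: "tube A (\<epsilon> * a) = (\<Union>k\<in>cells. place k ` U)"
proof (intro equalityI subsetI)
  fix x assume "x \<in> tube A (\<epsilon> * a)"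
  then obtain k \<gamma> r where k: "k \<in> cells" "\<gamma> \<in> \<Gamma>" "r \<in> {-(\<epsilon> * a)<..<\<epsilon> * a}" "x = tube_map A (place k \<gamma>, r)"
    by (auto simp: tube_def frontier_inclusions)
  then have "x = place k (tube_map Y2 (\<gamma>, r / \<epsilon>))"
    using tube_map_place[of k \<gamma> "r / \<epsilon>"] eps_pos by (simp add: tube_map_def)
  moreover have "r / \<epsilon> \<in> {-a<..<a}" using k(3) eps_pos by (simp add: field_simps)
  moreover have "tube_map Y2 (\<gamma>, r / \<epsilon>) \<in> U" unfolding tube_def
    using k(2) \<open>r / \<epsilon> \<in> {-a<..<a}\<close> by (intro imageI) simp
  ultimately show "x \<in> (\<Union>k\<in>cells. place k ` U)" using k(1) by blast
next
  fix x assume "x \<in> (\<Union>k\<in>cells. place k ` U)"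
  then obtain k y where k: "k \<in> cells" "y \<in> U" "x = place k y" by blast
  from k(2) obtain \<gamma> r where \<gamma>: "\<gamma> \<in> \<Gamma>" "\<bar>r\<bar> < a" "y = \<gamma> + r *\<^sub>R n \<gamma>" by (rule tube_cases)
  have "x = tube_map A (place k \<gamma>, \<epsilon> * r)" using tube_map_place[OF k(1) \<gamma>(1)] k(3) \<gamma>(3) by simp
  moreover have "place k \<gamma> \<in> frontier A" using k(1) \<gamma>(1) by (auto simp: frontier_inclusions)
  moreover have "\<epsilon> * r \<in> {-(\<epsilon> * a)<..<\<epsilon> * a}"
  proof -
    have "\<bar>\<epsilon> * r\<bar> < \<epsilon> * a" using \<gamma>(2) eps_pos by (simp add: abs_mult)
    then show ?thesis by auto
  qed
  ultimately show "x \<in> tube A (\<epsilon> * a)" unfolding tube_def by blast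
qed

lemma place_in_tube: "k \<in> cells \<Longrightarrow> y \<in> unit_cell \<Longrightarrow> place k y \<in> tube A (\<epsilon> * a) \<longleftrightarrow> y \<in> U"
  unfolding tube_inclusions using place_cells_unique U_subset by blast

lemma tube_proj_place:
  assumes k: "k \<in> cells" and y: "y \<in> U"
  shows "tube_proj A (\<epsilon> * a) (place k y) = place k (foot y)"
  unfolding tube_proj_def
proof (rule the_equality)
  have "place k y = tube_map A (place k (foot y), \<epsilon> * sdist y)"
    using tube_map_place[OF k foot_in[OF y]] tube_decomp[OF y] by simp
  moreover have "\<epsilon> * sdist y \<in> {-(\<epsilon> * a)<..<\<epsilon> * a}"
  proof -
    have "\<bar>\<epsilon> * sdist y\<bar> < \<epsilon> * a" using sdist_less[OF y] eps_pos by (simp add: abs_mult)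
    then show ?thesis by auto
  qed
  ultimately show "place k (foot y) \<in> frontier A \<and>
      (\<exists>r\<in>{- (\<epsilon> * a)<..<\<epsilon> * a}. place k y = tube_map A (place k (foot y), r))"
    using k foot_in[OF y] by (auto simp: frontier_inclusions)
  fix x assume "x \<in> frontier A \<and> (\<exists>r\<in>{- (\<epsilon> * a)<..<\<epsilon> * a}. place k y = tube_map A (x, r))"
  then obtain r where x: "x \<in> frontier A" "r \<in> {- (\<epsilon> * a)<..<\<epsilon> * a}" "place k y = tube_map A (x, r)" by blast
  from x(1) obtain k' \<gamma> where k': "k' \<in> cells" "\<gamma> \<in> \<Gamma>" "x = place k' \<gamma>" by (auto simp: frontier_inclusions)
  have r: "\<bar>r / \<epsilon>\<bar> < a" using x(2) eps_pos by (auto simp: abs_less_iff field_simps)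
  have eq: "place k y = place k' (\<gamma> + (r / \<epsilon>) *\<^sub>R n \<gamma>)"
    using x(3) k' tube_map_place[OF k'(1,2), of "r / \<epsilon>"] eps_pos by simp
  have "\<gamma> + (r / \<epsilon>) *\<^sub>R n \<gamma> \<in> U" using infdist_tube[OF k'(2) r] k'(2) r by (auto simp: tube_eq_infdist)
  with eq have "k = k'" "y = \<gamma> + (r / \<epsilon>) *\<^sub>R n \<gamma>"
    using place_cells_unique[OF k k'(1)] y U_subset by blast+
  then show "x = place k (foot y)" using foot_tube[OF k'(2) r] k'(3) by simp
qed

text \<open>Inside the tube of one cell, the surfaces in the other cells are not closer: a point of
  another cell within distance \<open>a\<close> of its surface would lie in the tube of that cell.\<close>

lemma infdist_place:
  assumes k: "k \<in> cells" and y: "y \<in> U"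
  shows "infdist (place k y) (frontier A) = \<epsilon> * infdist y \<Gamma>"
proof (rule antisym)
  have ne: "\<Gamma> \<noteq> {}" and less: "infdist y \<Gamma> < a" using y by (auto simp: tube_eq_infdist)
  obtain \<gamma> where \<gamma>: "\<gamma> \<in> \<Gamma>" "infdist y \<Gamma> = dist y \<gamma>"
    using infdist_attains_inf[OF frontier_closed ne] by blast
  have "place k \<gamma> \<in> frontier A" using k \<gamma>(1) by (auto simp: frontier_inclusions)
  from infdist_le[OF this, of "place k y"] show "infdist (place k y) (frontier A) \<le> \<epsilon> * infdist y \<Gamma>"
    using \<gamma>(2) by simp
  have nf: "frontier A \<noteq> {}" using \<open>place k \<gamma> \<in> frontier A\<close> by blast
  obtain x where x: "x \<in> frontier A" "infdist (place k y) (frontier A) = dist (place k y) x"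
    using infdist_attains_inf[OF frontier_closed nf] by blast
  then obtain k' \<gamma>' where k': "k' \<in> cells" "\<gamma>' \<in> \<Gamma>" "x = place k' \<gamma>'" by (auto simp: frontier_inclusions)
  have pl: "place k y = place k' (y + k - k')" by (simp add: place_def)
  have d: "dist (place k y) x = \<epsilon> * dist (y + k - k') \<gamma>'" unfolding k'(3) pl by simp
  have "infdist y \<Gamma> \<le> dist (y + k - k') \<gamma>'"
  proof (rule ccontr)
    assume "\<not> ?thesis"
    then have lt: "dist (y + k - k') \<gamma>' < infdist y \<Gamma>" by simp
    then have "infdist (y + k - k') \<Gamma> < a" using infdist_le[OF k'(2), of "y + k - k'"] less by simp
    then have "y + k - k' \<in> U" using ne by (simp add: tube_eq_infdist)
    then have "k = k'" using place_cells_unique[OF k k'(1) _ _ pl] y U_subset by blast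
    then show False using lt infdist_le[OF k'(2), of y] by simp
  qed
  then show "\<epsilon> * infdist y \<Gamma> \<le> infdist (place k y) (frontier A)" using eps_pos by (simp add: x(2) d)
qed

lemma motion_function_place:
  assumes k: "k \<in> cells" and y: "y \<in> unit_cell"
  shows "motion_function \<epsilon> a A \<eta> h t (place k y)
    = place k y + \<epsilon> *\<^sub>R displacement \<eta> (\<lambda>\<gamma>. h t (place k \<gamma>) / \<epsilon>) y"
proof (cases "y \<in> U")
  case True
  have "infdist (place k y) (frontier A) / (\<epsilon> * a) = infdist y \<Gamma> / a"
    using infdist_place[OF k True] eps_pos by simp
  then show ?thesis
    using True place_in_tube[OF k y] tube_proj_place[OF k True] normal_place(1)[OF k foot_in[OF True]] eps_pos
    by (simp add: motion_function_def displacement_def Let_def unit_normal_def)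
qed (use place_in_tube[OF k y] in \<open>simp add: motion_function_def displacement_def\<close>)

lemma space_jacobian_place:
  assumes k: "k \<in> cells" and y: "y \<in> unit_cell"
    and D: "(displacement \<eta> (\<lambda>\<gamma>. h t (place k \<gamma>) / \<epsilon>) has_derivative D) (at y)"
  shows "space_jacobian (motion_function \<epsilon> a A \<eta> h) (t, place k y) = mat 1 + matrix D"
proof -
  let ?w = "displacement \<eta> (\<lambda>\<gamma>. h t (place k \<gamma>) / \<epsilon>)"
  have "((\<lambda>x. ?w (x /\<^sub>R \<epsilon> - k)) has_derivative (\<lambda>v. D (v /\<^sub>R \<epsilon>))) (at (place k y))"
    using diff_chain_at[OF unplace_has_derivative, of ?w D "place k y" k] D by (simp add: o_def)
  then have "((\<lambda>x. x + \<epsilon> *\<^sub>R ?w (x /\<^sub>R \<epsilon> - k)) has_derivative (\<lambda>v. v + \<epsilon> *\<^sub>R D (v /\<^sub>R \<epsilon>))) (at (place k y))"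
    by (intro has_derivative_add has_derivative_ident has_derivative_scaleR_right)
  moreover have "(\<lambda>v. v + \<epsilon> *\<^sub>R D (v /\<^sub>R \<epsilon>)) = (\<lambda>v. v + D v)"
    using linear_cmul[OF has_derivative_linear[OF D]] eps_pos by (simp add: fun_eq_iff)
  ultimately have "((\<lambda>x. x + \<epsilon> *\<^sub>R ?w (x /\<^sub>R \<epsilon> - k)) has_derivative (\<lambda>v. v + D v)) (at (place k y))"
    by simp
  then have "(motion_function \<epsilon> a A \<eta> h t has_derivative (\<lambda>v. v + D v)) (at (place k y))"
  proof (rule has_derivative_transform_within_open)
    show "open (place k ` unit_cell)" by (intro open_place open_unit_cell)
    show "place k y \<in> place k ` unit_cell" using y by blast
    show "x + \<epsilon> *\<^sub>R ?w (x /\<^sub>R \<epsilon> - k) = motion_function \<epsilon> a A \<eta> h t x" if "x \<in> place k ` unit_cell" for x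
      using that motion_function_place[OF k] by (auto simp del: scaleR_right_diff_distrib)
  qed
  then have "space_jacobian (motion_function \<epsilon> a A \<eta> h) (t, place k y) = matrix (\<lambda>v. v + D v)"
    unfolding space_jacobian_def by (simp flip: frechet_derivative_at)
  also have "\<dots> = mat 1 + matrix D"
    by (auto simp: matrix_def mat_def vec_eq_iff axis_def)
  finally show ?thesis .
qed

context
  fixes \<tau> :: real and \<Gamma>t and h :: "real \<Rightarrow> real^3 \<Rightarrow> real"
  assumes height: "height_function \<epsilon> a A \<tau> \<Gamma>t h"
begin

text \<open>
  The factors \<open>\<epsilon>\<close> from the height and from the position cancel in the surface derivative. The
  inequality for the suprema splits into the two bounds because both of its terms are nonnegative.
\<close>

lemma rescaled_height_derivative:
  assumes t: "t \<in> {0..\<tau>}" and k: "k \<in> cells" and \<gamma>: "\<gamma> \<in> \<Gamma>"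
  shows "((\<lambda>\<gamma>. h t (place k \<gamma>) / \<epsilon>) has_derivative surface_deriv A (h t) (place k \<gamma>)) (at \<gamma> within \<Gamma>)"
    and "onorm (surface_deriv A (h t) (place k \<gamma>)) \<le> 1 / 4"
    and "\<bar>h t (place k \<gamma>) / \<epsilon>\<bar> \<le> a / 10"
proof -
  let ?x = "place k \<gamma>" and ?L = "surface_deriv A (h t) (place k \<gamma>)"
  have x: "?x \<in> frontier A" using k \<gamma> by (auto simp: frontier_inclusions)
  have bd: "5 / (\<epsilon> * a) * \<bar>h t ?x\<bar> + 2 * onorm ?L \<le> 1 / 2"
    and diff: "h t differentiable (at ?x within frontier A)"
    using height t x unfolding height_function_def by blast+
  have L: "(h t has_derivative ?L) (at ?x within frontier A)"
    by (rule surface_deriv_works) (use normal_place[OF k \<gamma>] normal(2)[OF \<gamma>] diff in auto)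
  have "((\<lambda>\<gamma>. h t (place k \<gamma>)) has_derivative (\<lambda>v. ?L (\<epsilon> *\<^sub>R v))) (at \<gamma> within \<Gamma>)"
    by (rule has_derivative_in_compose[OF place_has_derivative])
      (rule has_derivative_subset[OF L], use k in \<open>auto simp: frontier_inclusions\<close>)
  from has_derivative_mult_right[OF this, of "1 / \<epsilon>"] eps_pos
  show "((\<lambda>\<gamma>. h t (place k \<gamma>) / \<epsilon>) has_derivative ?L) (at \<gamma> within \<Gamma>)"
    using linear_cmul[OF has_derivative_linear[OF L]] by simp
  have on: "0 \<le> onorm ?L" by (rule onorm_pos_le[OF has_derivative_bounded_linear[OF L]])
  have "0 \<le> 5 / (\<epsilon> * a) * \<bar>h t ?x\<bar>" using eps_pos a_pos by simp
  then show "onorm ?L \<le> 1 / 4" using bd by linarith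
  have "5 / (\<epsilon> * a) * \<bar>h t ?x\<bar> \<le> 1 / 2" using bd on by linarith
  then show "\<bar>h t ?x / \<epsilon>\<bar> \<le> a / 10" using eps_pos a_pos by (simp add: field_simps)
qed

lemma rescaled_zero_set:
  assumes t: "t \<in> {0..<\<tau>}" and k: "k \<in> cells" and y: "y \<in> unit_cell"
  shows "place k y \<in> \<Gamma>t t \<longleftrightarrow> y \<in> (\<lambda>\<gamma>. \<gamma> + (h t (place k \<gamma>) / \<epsilon>) *\<^sub>R n \<gamma>) ` \<Gamma>"
proof -
  have \<Gamma>t: "\<Gamma>t t = (\<lambda>\<gamma>. \<gamma> + h t \<gamma> *\<^sub>R outer_normal A \<gamma>) ` frontier A"
    using height t by (simp add: height_function_def)
  have pt: "place k' \<gamma> + h t (place k' \<gamma>) *\<^sub>R outer_normal A (place k' \<gamma>)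
      = place k' (\<gamma> + (h t (place k' \<gamma>) / \<epsilon>) *\<^sub>R n \<gamma>)"
    if "k' \<in> cells" "\<gamma> \<in> \<Gamma>" for k' \<gamma>
    using that eps_pos by (simp add: normal_place place_add)
  have inc: "\<gamma> + (h t (place k' \<gamma>) / \<epsilon>) *\<^sub>R n \<gamma> \<in> unit_cell" if "k' \<in> cells" "\<gamma> \<in> \<Gamma>" for k' \<gamma>
  proof -
    have b: "\<bar>h t (place k' \<gamma>) / \<epsilon>\<bar> < a"
      by (rule order.strict_trans1[OF rescaled_height_derivative(3)[OF _ that]]) (use t a_pos in auto)
    then have "\<gamma> + (h t (place k' \<gamma>) / \<epsilon>) *\<^sub>R n \<gamma> \<in> U"
      using infdist_tube[OF that(2) b] that(2) by (auto simp: tube_eq_infdist)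
    then show ?thesis using U_subset by blast
  qed
  show ?thesis
  proof
    assume "place k y \<in> \<Gamma>t t"
    then obtain k' \<gamma> where k': "k' \<in> cells" "\<gamma> \<in> \<Gamma>"
      "place k y = place k' (\<gamma> + (h t (place k' \<gamma>) / \<epsilon>) *\<^sub>R n \<gamma>)"
      unfolding \<Gamma>t frontier_inclusions using pt by auto
    from place_cells_unique[OF k k'(1) y inc[OF k'(1,2)] k'(3)] k'(2)
    show "y \<in> (\<lambda>\<gamma>. \<gamma> + (h t (place k \<gamma>) / \<epsilon>) *\<^sub>R n \<gamma>) ` \<Gamma>" by blast
  next
    assume "y \<in> (\<lambda>\<gamma>. \<gamma> + (h t (place k \<gamma>) / \<epsilon>) *\<^sub>R n \<gamma>) ` \<Gamma>"
    then obtain \<gamma> where \<gamma>: "\<gamma> \<in> \<Gamma>" "y = \<gamma> + (h t (place k \<gamma>) / \<epsilon>) *\<^sub>R n \<gamma>" by blast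
    then have "place k y = place k \<gamma> + h t (place k \<gamma>) *\<^sub>R outer_normal A (place k \<gamma>)"
      using pt[OF k \<gamma>(1)] by simp
    moreover have "place k \<gamma> \<in> frontier A" using k \<gamma>(1) by (auto simp: frontier_inclusions)
    ultimately show "place k y \<in> \<Gamma>t t" unfolding \<Gamma>t by blast
  qed
qed

end

text \<open>
  The normal velocity is \<open>\<epsilon> v\<close>; rescaling space by \<open>\<epsilon>\<close> turns the speed into \<open>v\<close>, the factor \<open>\<epsilon>\<close>
  becoming part of the gradient of the rescaled level set function.
\<close>

lemma moving_front_place:
  assumes motion: "motion_levelset \<epsilon> \<Omega> A v \<tau> \<phi>"
    and height: "height_function \<epsilon> a A \<tau> (zero_surface \<Omega> \<phi>) h"
    and k: "k \<in> cells" and K: "0 < K"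
    and speed: "\<And>t y. t \<in> {0<..<\<tau>} \<Longrightarrow> y \<in> unit_cell \<Longrightarrow> \<bar>v (t, place k y)\<bar> \<le> K"
      "\<And>t x y. t \<in> {0<..<\<tau>} \<Longrightarrow> x \<in> unit_cell \<Longrightarrow> y \<in> unit_cell \<Longrightarrow>
        \<bar>v (t, place k x) - v (t, place k y)\<bar> \<le> K * norm (x - y)"
  shows "moving_front Y1 Y2 a \<tau> K (\<lambda>(t, y). \<phi> (t, place k y)) (\<lambda>(t, y). v (t, place k y))
    (\<lambda>t \<gamma>. h t (place k \<gamma>) / \<epsilon>)"
proof unfold_locales
  let ?D = "{0<..<\<tau>} \<times> \<Omega>"
  have \<phi>: "Ck_on 1 ?D \<phi>" "continuous_on ({0..<\<tau>} \<times> \<Omega>) \<phi>"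
    "frontier A = {x\<in>\<Omega>. \<phi> (0, x) = 0}" "\<Omega> - closure A = {x\<in>\<Omega>. \<phi> (0, x) < 0}"
    "\<And>t x. t \<in> {0<..<\<tau>} \<Longrightarrow> x \<in> \<Omega> \<Longrightarrow> \<phi> (t, x) = 0 \<Longrightarrow>
       deriv (\<lambda>s. \<phi> (s, x)) t = \<epsilon> * norm (grad (\<lambda>y. \<phi> (t, y)) x) * v (t, x) \<and>
       norm (grad (\<lambda>y. \<phi> (t, y)) x) > 0"
    using motion by (simp_all add: motion_levelset_def Let_def)
  note in\<Omega> = place_in_Omega[OF k]
  have d\<phi>: "(\<phi> has_derivative frechet_derivative \<phi> (at (t, place k y))) (at (t, place k y))"
    if "t \<in> {0<..<\<tau>}" "y \<in> unit_cell" for t y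
    using \<phi>(1) that in\<Omega> by (simp add: frechet_derivative_works)
  have pl: "((\<lambda>z. (fst z, place k (snd z))) has_derivative (\<lambda>w. (fst w, \<epsilon> *\<^sub>R snd w))) (at z)" for z :: "real \<times> (real^3)"
    using diff_chain_at[OF has_derivative_snd[OF has_derivative_ident, of "at z"] place_has_derivative, of k]
    by (intro has_derivative_Pair has_derivative_fst has_derivative_ident) (simp add: o_def)
  have du: "((\<lambda>(t, y). \<phi> (t, place k y)) has_derivative
      (\<lambda>w. frechet_derivative \<phi> (at (t, place k y)) (fst w, \<epsilon> *\<^sub>R snd w))) (at (t, y))"
    if "t \<in> {0<..<\<tau>}" "y \<in> unit_cell" for t y
    using diff_chain_at[OF pl[of "(t, y)"], of \<phi> "frechet_derivative \<phi> (at (t, place k y))"] d\<phi>[OF that]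
    by (simp add: o_def case_prod_unfold)
  show "0 < K" by (fact K)
  show "continuous_on ({0..<\<tau>} \<times> unit_cell) (\<lambda>(t, y). \<phi> (t, place k y))"
  proof -
    have "continuous_on ({0..<\<tau>} \<times> unit_cell) (\<phi> \<circ> (\<lambda>z. (fst z, place k (snd z))))"
    proof (intro continuous_on_compose)
      show "continuous_on ({0..<\<tau>} \<times> unit_cell) (\<lambda>z. (fst z, place k (snd z)))"
        unfolding place_def by (intro continuous_intros)
      show "continuous_on ((\<lambda>z. (fst z, place k (snd z))) ` ({0..<\<tau>} \<times> unit_cell)) \<phi>"
        by (rule continuous_on_subset[OF \<phi>(2)]) (use in\<Omega> in auto)
    qed
    then show ?thesis by (simp add: o_def case_prod_unfold)
  qed
  show "(\<lambda>(t, y). \<phi> (t, place k y)) differentiable at z" if "z \<in> {0<..<\<tau>} \<times> unit_cell" for z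
  proof -
    obtain t y where "z = (t, y)" "t \<in> {0<..<\<tau>}" "y \<in> unit_cell"
      using \<open>z \<in> {0<..<\<tau>} \<times> unit_cell\<close> by blast
    then show ?thesis using differentiableI[OF du] by simp
  qed
  show "\<exists>p. p \<noteq> 0 \<and> ((\<lambda>(t, y). \<phi> (t, place k y)) has_derivative
      (\<lambda>(r, w). r * (norm p * (case (t, y) of (t, y) \<Rightarrow> v (t, place k y))) + w \<bullet> p)) (at (t, y))"
    if t: "t \<in> {0<..<\<tau>}" and y: "y \<in> unit_cell" and z: "(case (t, y) of (t, y) \<Rightarrow> \<phi> (t, place k y)) = 0" for t y
  proof -
    let ?x = "place k y" and ?F = "frechet_derivative \<phi> (at (t, place k y))"
    let ?g = "grad (\<lambda>y. \<phi> (t, y)) ?x"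
    interpret F: bounded_linear ?F using d\<phi>[OF t y] by (rule has_derivative_bounded_linear)
    have "((\<lambda>s. (s, ?x)) has_derivative (\<lambda>s. (s, 0))) (at t)" by (auto intro!: derivative_eq_intros)
    from diff_chain_at[OF this, of \<phi> ?F] d\<phi>[OF t y]
    have "((\<lambda>s. \<phi> (s, ?x)) has_derivative (\<lambda>s. ?F (s, 0))) (at t)" by (simp add: o_def)
    moreover have "(\<lambda>s. ?F (s, 0)) = (*) (?F (1, 0))"
    proof
      show "?F (s, 0) = ?F (1, 0) * s" for s using F.scaleR[of s "(1, 0)"] by simp
    qed
    ultimately have "((\<lambda>s. \<phi> (s, ?x)) has_real_derivative ?F (1, 0)) (at t)"
      unfolding has_field_derivative_def by (rule back_subst)
    then have dt: "?F (1, 0) = deriv (\<lambda>s. \<phi> (s, ?x)) t" by (simp add: DERIV_imp_deriv)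
    have "((\<lambda>x. (t, x)) has_derivative (\<lambda>w. (0, w))) (at ?x)" by (auto intro!: derivative_eq_intros)
    from diff_chain_at[OF this, of \<phi> ?F] d\<phi>[OF t y]
    have "((\<lambda>x. \<phi> (t, x)) has_derivative (\<lambda>w. ?F (0, w))) (at ?x)" by (simp add: o_def)
    from has_derivative_grad[OF this] have dx: "?F (0, w) = w \<bullet> ?g" for w by (rule fun_cong)
    have F: "?F (r, w) = r * ?F (1, 0) + ?F (0, w)" for r w
    proof -
      have "?F (r, w) = ?F (r, 0) + ?F (0, w)" using F.add[of "(r, 0)" "(0, w)"] by simp
      moreover have "?F (r, 0) = r * ?F (1, 0)" using F.scaleR[of r "(1, 0)"] by simp
      ultimately show ?thesis by (simp only:)
    qed
    have m: "deriv (\<lambda>s. \<phi> (s, ?x)) t = \<epsilon> * norm ?g * v (t, ?x)" "0 < norm ?g"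
      using \<phi>(5)[OF t in\<Omega>[OF y]] z by auto
    have "(\<lambda>w. ?F (fst w, \<epsilon> *\<^sub>R snd w)) = (\<lambda>(r, w). r * (norm (\<epsilon> *\<^sub>R ?g) * v (t, ?x)) + w \<bullet> (\<epsilon> *\<^sub>R ?g))"
    proof
      fix z :: "real \<times> (real^3)"
      have "?F (fst z, \<epsilon> *\<^sub>R snd z) = fst z * (\<epsilon> * norm ?g * v (t, ?x)) + (\<epsilon> *\<^sub>R snd z) \<bullet> ?g"
        by (subst F) (simp only: dt dx m(1))
      then show "?F (fst z, \<epsilon> *\<^sub>R snd z)
          = (case z of (r, w) \<Rightarrow> r * (norm (\<epsilon> *\<^sub>R ?g) * v (t, ?x)) + w \<bullet> (\<epsilon> *\<^sub>R ?g))"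
        using eps_pos by (simp add: case_prod_unfold)
    qed
    with du[OF t y] have "((\<lambda>(t, y). \<phi> (t, place k y)) has_derivative
       (\<lambda>(r, w). r * (norm (\<epsilon> *\<^sub>R ?g) * v (t, ?x)) + w \<bullet> (\<epsilon> *\<^sub>R ?g))) (at (t, y))" by simp
    moreover have "\<epsilon> *\<^sub>R ?g \<noteq> 0" using m(2) eps_pos by auto
    ultimately show ?thesis by (intro exI[of _ "\<epsilon> *\<^sub>R ?g"]) simp
  qed
  show "{y \<in> unit_cell. (case (t, y) of (t, y) \<Rightarrow> \<phi> (t, place k y)) = 0}
      = (\<lambda>\<gamma>. \<gamma> + (h t (place k \<gamma>) / \<epsilon>) *\<^sub>R n \<gamma>) ` \<Gamma>" if t: "t \<in> {0..<\<tau>}" for t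
  proof -
    have "(\<lambda>\<gamma>. \<gamma> + (h t (place k \<gamma>) / \<epsilon>) *\<^sub>R n \<gamma>) ` \<Gamma> \<subseteq> unit_cell"
    proof clarify
      fix \<gamma> assume \<gamma>: "\<gamma> \<in> \<Gamma>"
      have b: "\<bar>h t (place k \<gamma>) / \<epsilon>\<bar> < a"
        by (rule order.strict_trans1[OF rescaled_height_derivative(3)[OF height _ k \<gamma>]]) (use t a_pos in auto)
      then have "\<gamma> + (h t (place k \<gamma>) / \<epsilon>) *\<^sub>R n \<gamma> \<in> U"
        using infdist_tube[OF \<gamma> b] \<gamma> by (auto simp: tube_eq_infdist)
      then show "\<gamma> + (h t (place k \<gamma>) / \<epsilon>) *\<^sub>R n \<gamma> \<in> unit_cell" using U_subset by blast
    qed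
    moreover have "y \<in> unit_cell \<Longrightarrow> \<phi> (t, place k y) = 0 \<longleftrightarrow> y \<in> (\<lambda>\<gamma>. \<gamma> + (h t (place k \<gamma>) / \<epsilon>) *\<^sub>R n \<gamma>) ` \<Gamma>" for y
      using rescaled_zero_set[OF height t k, of y] in\<Omega>[of y] by (simp add: zero_surface_def)
    ultimately show ?thesis by auto
  qed
  show "\<bar>h t (place k \<gamma>) / \<epsilon>\<bar> \<le> a / 10" if "t \<in> {0..<\<tau>}" "\<gamma> \<in> \<Gamma>" for t \<gamma>
    using rescaled_height_derivative(3)[OF height _ k that(2), of t] that(1) by auto
  show "(case (0, \<gamma>) of (t, y) \<Rightarrow> \<phi> (t, place k y)) = 0" if "\<gamma> \<in> \<Gamma>" for \<gamma>
    using that k \<phi>(3) by (auto simp: frontier_inclusions)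
  show "(case (0, y) of (t, y) \<Rightarrow> \<phi> (t, place k y)) < 0" if "y \<in> unit_cell - closure Y2" for y
  proof -
    have "place k y \<in> \<Omega> - closure A" using that in\<Omega> place_in_closure_inclusions[OF k] by auto
    then show ?thesis unfolding \<phi>(4) by simp
  qed
  show "\<bar>case (t, y) of (t, y) \<Rightarrow> v (t, place k y)\<bar> \<le> K" if "t \<in> {0<..<\<tau>}" "y \<in> unit_cell" for t y
    using speed(1)[OF that] by simp
  show "\<bar>(case (t, x) of (t, y) \<Rightarrow> v (t, place k y)) - (case (t, y) of (t, y) \<Rightarrow> v (t, place k y))\<bar> \<le> K * norm (x - y)"
    if "t \<in> {0<..<\<tau>}" "x \<in> unit_cell" "y \<in> unit_cell" for t x y
    using speed(2)[OF that] by simp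
qed

end

section \<open>The velocity is small and slowly varying in each cell\<close>

text \<open>The first order term of the norm bounds each weak derivative in space almost everywhere.\<close>

lemma A1_gradient_bound:
  assumes A1: "assumption_A1 \<epsilon> a T \<Omega> Y2 v"
  defines "D \<equiv> {0<..<T} \<times> \<Omega>" and "dv \<equiv> \<lambda>i w. wderiv ({0<..<T} \<times> \<Omega>) [(0, axis i 1)] w"
  obtains M where "0 \<le> M" "\<And>n i. weak_deriv D [(0, axis i 1)] (v n) (dv i (v n))"
    "\<And>n i. AE z in lebesgue_on D. \<bar>dv i (v n) z\<bar> \<le> M"
proof -
  let ?S = "SUP n. W1_inf_norm D (v n) + ennreal (\<epsilon> n) * Dx_norm D 2 (v n) + ennreal ((\<epsilon> n)\<^sup>2) * Dx_norm D 3 (v n)"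
  have fin: "?S < \<infinity>" and W: "in_W_inf 1 3 D (v n)" for n
    using A1 by (auto simp: assumption_A1_def Let_def D_def)
  have dir: "[(0, axis i 1)] \<in> space_dirs 1" for i by (auto simp: space_dirs_def)
  have weak: "weak_deriv D [(0, axis i 1)] (v n) (dv i (v n))" for n i
  proof -
    have "\<exists>g. weak_deriv D [(0, axis i 1)] (v n) g"
      using W[of n] dir[of i] by (force simp: in_W_inf_def)
    then show ?thesis unfolding dv_def wderiv_def D_def by (rule someI_ex)
  qed
  have finite_dirs: "finite (space_dirs 1)"
  proof -
    have "space_dirs 1 = {bs. set bs \<subseteq> range (\<lambda>i. (0, axis i 1)) \<and> length bs = 1}"
      by (auto simp: space_dirs_def)
    then show ?thesis by (simp add: finite_lists_length_eq)
  qed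
  have "AE z in lebesgue_on D. \<bar>dv i (v n) z\<bar> \<le> enn2real ?S" for n i
  proof -
    let ?g = "\<lambda>z. sqrt (\<Sum>bs\<in>space_dirs 1. (wderiv D bs (v n) z)\<^sup>2)"
    have "Dx_norm D 1 (v n) \<le> W1_inf_norm D (v n)" by (simp add: W1_inf_norm_def)
    also have "\<dots> \<le> W1_inf_norm D (v n) + (ennreal (\<epsilon> n) * Dx_norm D 2 (v n) + ennreal ((\<epsilon> n)\<^sup>2) * Dx_norm D 3 (v n))"
      by simp
    also have "\<dots> \<le> ?S" unfolding add.assoc[symmetric] by (rule SUP_upper) simp
    finally have le: "esssup (lebesgue_on D) (\<lambda>z. ennreal (norm (?g z))) \<le> ennreal (enn2real ?S)"
      using fin by (simp add: Dx_norm_def Linf_norm_def)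
    have "AE z in lebesgue_on D. ennreal (norm (?g z)) \<le> esssup (lebesgue_on D) (\<lambda>z. ennreal (norm (?g z)))"
      by (rule esssup_AE)
    then show ?thesis
    proof eventually_elim
      case (elim z)
      then have "ennreal (norm (?g z)) \<le> ennreal (enn2real ?S)" using le by (rule order_trans)
      then have "?g z \<le> enn2real ?S" by (simp add: sum_nonneg)
      moreover have "(dv i (v n) z)\<^sup>2 \<le> (\<Sum>bs\<in>space_dirs 1. (wderiv D bs (v n) z)\<^sup>2)"
        unfolding dv_def D_def[symmetric] using member_le_sum[OF dir, of _ "\<lambda>bs. (wderiv D bs (v n) z)\<^sup>2"] finite_dirs by simp
      then have "\<bar>dv i (v n) z\<bar> \<le> ?g z" by (rule real_le_rsqrt[of "\<bar>_\<bar>", unfolded power2_abs])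
      ultimately show ?case by simp
    qed
  qed
  with weak show ?thesis using that[of "enn2real ?S"] by simp
qed

text \<open>Change the coordinates one after the other; the intermediate points stay in the cube.\<close>

lemma coordinatewise_lipschitz_unit_cell:
  fixes f :: "real^3 \<Rightarrow> real"
  assumes step: "\<And>x i s. x \<in> unit_cell \<Longrightarrow> x + s *\<^sub>R axis i 1 \<in> unit_cell \<Longrightarrow> 0 \<le> s \<Longrightarrow>
      \<bar>f (x + s *\<^sub>R axis i 1) - f x\<bar> \<le> M * s"
    and M: "0 \<le> M" and x: "x \<in> unit_cell" and y: "y \<in> unit_cell"
  shows "\<bar>f x - f y\<bar> \<le> 3 * M * norm (x - y)"
proof -
  define z where "z S = (\<chi> i. if i \<in> S then x $ i else y $ i)" for S
  have zc: "z S \<in> unit_cell" for S using x y by (auto simp: z_def unit_cell_def)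
  have step': "\<bar>f (w + s *\<^sub>R axis i 1) - f w\<bar> \<le> M * \<bar>s\<bar>"
    if "w \<in> unit_cell" "w + s *\<^sub>R axis i 1 \<in> unit_cell" for w s i
  proof (cases "0 \<le> s")
    case False
    then show ?thesis using step[of "w + s *\<^sub>R axis i 1" "- s" i] that by (simp add: abs_minus_commute)
  qed (use step that in simp)
  have "\<bar>f (z S) - f y\<bar> \<le> (\<Sum>i\<in>S. M * \<bar>x $ i - y $ i\<bar>)" if "finite S" for S
    using that
  proof (induction S)
    case empty
    have "z {} = y" by (simp add: z_def vec_eq_iff)
    then show ?case by simp
  next
    case (insert j S)
    have zj: "z (insert j S) = z S + (x $ j - y $ j) *\<^sub>R axis j 1"
      using insert.hyps by (auto simp: z_def vec_eq_iff axis_def)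
    have "\<bar>f (z (insert j S)) - f (z S)\<bar> \<le> M * \<bar>x $ j - y $ j\<bar>"
      using step'[of "z S" "x $ j - y $ j" j] zc[of S] zc[of "insert j S"] zj by simp
    then show ?case using insert by simp
  qed
  from this[of UNIV] have "\<bar>f (z UNIV) - f y\<bar> \<le> (\<Sum>i\<in>UNIV. M * \<bar>x $ i - y $ i\<bar>)" by simp
  also have "\<dots> \<le> (\<Sum>i\<in>(UNIV::3 set). M * norm (x - y))"
    using component_le_norm_cart[of "x - y"] M by (intro sum_mono mult_left_mono) auto
  finally show ?thesis by (simp add: z_def)
qed

lemma diameter_unit_cell: "x \<in> unit_cell \<Longrightarrow> y \<in> unit_cell \<Longrightarrow> norm (x - y) \<le> 3"
proof -
  assume xy: "x \<in> unit_cell" "y \<in> unit_cell"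
  have "\<bar>(x - y) $ i\<bar> \<le> 1" for i
  proof -
    have "0 < x $ i" "x $ i < 1" "0 < y $ i" "y $ i < 1" using xy by (auto simp: unit_cell_def)
    then show ?thesis by simp
  qed
  then have "(\<Sum>i\<in>UNIV. \<bar>(x - y) $ i\<bar>) \<le> (\<Sum>i\<in>(UNIV::3 set). 1)" by (intro sum_mono) auto
  with norm_le_l1_cart[of "x - y"] show ?thesis by simp
qed

lemma norm_matrix_le:
  fixes D :: "real^3 \<Rightarrow> real^3"
  assumes "\<And>v. norm (D v) \<le> c * norm v"
  shows "norm (matrix D) \<le> 9 * c"
proof -
  have "\<bar>matrix D $ i $ j\<bar> \<le> c" for i j
    using component_le_norm_cart[of "D (axis j 1)" i] assms[of "axis j 1"] by (simp add: matrix_def norm_axis_1)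
  then have row: "norm (matrix D $ i) \<le> 3 * c" for i
  proof -
    have "norm (matrix D $ i) \<le> (\<Sum>j\<in>UNIV. \<bar>matrix D $ i $ j\<bar>)" by (rule norm_le_l1_cart)
    also have "\<dots> \<le> (\<Sum>j\<in>(UNIV::3 set). c)" using \<open>\<And>i j. \<bar>matrix D $ i $ j\<bar> \<le> c\<close> by (intro sum_mono)
    finally show ?thesis by simp
  qed
  have "norm (matrix D) \<le> (\<Sum>i\<in>UNIV. norm (matrix D $ i))"
    unfolding norm_vec_def by (rule L2_set_le_sum) simp
  also have "\<dots> \<le> (\<Sum>i\<in>(UNIV::3 set). 3 * c)" using row by (intro sum_mono)
  finally show ?thesis by simp
qed

context perforated_domain
begin

lemma place_box: "place k ` unit_cell = box (\<epsilon> *\<^sub>R k) (\<chi> i. \<epsilon> * (k $ i + 1))"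
proof (intro equalityI subsetI)
  fix x assume "x \<in> place k ` unit_cell"
  then show "x \<in> box (\<epsilon> *\<^sub>R k) (\<chi> i. \<epsilon> * (k $ i + 1))"
    using eps_pos by (auto simp: unit_cell_def mem_box_cart place_def)
next
  fix x assume x: "x \<in> box (\<epsilon> *\<^sub>R k) (\<chi> i. \<epsilon> * (k $ i + 1))"
  then have "x /\<^sub>R \<epsilon> - k \<in> unit_cell"
    using eps_pos by (auto simp: unit_cell_def mem_box_cart field_simps)
  then show "x \<in> place k ` unit_cell" by (intro image_eqI[of _ _ "x /\<^sub>R \<epsilon> - k"]) auto
qed

text \<open>
  The factor \<open>\<epsilon>\<close> in the Lipschitz constant comes from rescaling. It turns into a bound for the
  velocity itself because the velocity vanishes at some point of the cell.
\<close>

lemma velocity_in_cells: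
  fixes T :: real
  assumes b: "smooth_bump b" and k: "k \<in> cells"
  defines "D \<equiv> {0<..<T} \<times> \<Omega>"
  assumes v: "continuous_on D v"
    and g: "\<And>i. weak_deriv D [(0, axis i 1)] v (g i)" "\<And>i. AE z in lebesgue_on D. \<bar>g i z\<bar> \<le> M"
    and M: "0 \<le> M"
    and supp: "\<And>t. t \<in> {0<..<T} \<Longrightarrow> closure {x \<in> \<Omega>. v (t, x) \<noteq> 0} \<subseteq> tube A (\<epsilon> * a)"
    and t: "t \<in> {0<..<T}"
  shows "x \<in> unit_cell \<Longrightarrow> y \<in> unit_cell \<Longrightarrow>
      \<bar>v (t, place k x) - v (t, place k y)\<bar> \<le> 3 * (M * \<epsilon>) * norm (x - y)"
    and "y \<in> unit_cell \<Longrightarrow> \<bar>v (t, place k y)\<bar> \<le> 9 * (M * \<epsilon>)"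
proof -
  let ?p = "(0, \<epsilon> *\<^sub>R k)" and ?q = "(T, \<chi> i. \<epsilon> * (k $ i + 1))"
  have box: "box ?p ?q = {0<..<T} \<times> place k ` unit_cell"
    by (simp add: box_prod place_box box_real)
  have boxD: "box ?p ?q \<subseteq> D" unfolding box D_def using place_in_Omega[OF k] by auto
  have oD: "open D" unfolding D_def using open_Omega by (intro open_Times) auto
  have step: "\<bar>v (t, place k (x + s *\<^sub>R axis i 1)) - v (t, place k x)\<bar> \<le> (M * \<epsilon>) * s"
    if x: "x \<in> unit_cell" "x + s *\<^sub>R axis i 1 \<in> unit_cell" "0 \<le> s" for x s i
  proof -
    have e: "(0, axis i 1) \<in> (Basis :: (real \<times> (real^3)) set)" by (auto simp: Basis_prod_def axis_in_Basis_iff)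
    have pl: "(t, place k x) + (\<epsilon> * s) *\<^sub>R (0, axis i 1) = (t, place k (x + s *\<^sub>R axis i 1))"
      by (simp add: place_add)
    have "\<bar>v ((t, place k x) + (\<epsilon> * s) *\<^sub>R (0, axis i 1)) - v (t, place k x)\<bar> \<le> M * (\<epsilon> * s)"
    proof (rule weak_derivative_bound_imp_lipschitz[OF b oD v g(1)[of i] g(2)[of i] M e _ boxD])
      show "(t, place k x) \<in> box ?p ?q" unfolding box using x(1) t by blast
      show "(t, place k x) + (\<epsilon> * s) *\<^sub>R (0, axis i 1) \<in> box ?p ?q" unfolding pl box using x(2) t by blast
    qed (use x eps_pos in simp)
    then show ?thesis by (simp only: pl mult.assoc)
  qed
  show lip: "\<bar>v (t, place k x) - v (t, place k y)\<bar> \<le> 3 * (M * \<epsilon>) * norm (x - y)"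
    if "x \<in> unit_cell" "y \<in> unit_cell" for x y
    by (rule coordinatewise_lipschitz_unit_cell[OF step _ that]) (use M eps_pos in auto)
  \<comment> \<open>The velocity vanishes somewhere in the cell, since its support does not reach the corner.\<close>
  have "\<exists>z\<in>unit_cell. v (t, place k z) = 0"
  proof (rule ccontr)
    assume "\<not> ?thesis"
    then have "place k ` unit_cell \<subseteq> {x \<in> \<Omega>. v (t, x) \<noteq> 0}" using place_in_Omega[OF k] by auto
    then have "closure (place k ` unit_cell) \<subseteq> tube A (\<epsilon> * a)"
      using supp[OF t] closure_mono by blast
    moreover have "place k 0 \<in> closure (place k ` unit_cell)"
    proof -
      have "closure (place k ` unit_cell) = cbox (\<epsilon> *\<^sub>R k) (\<chi> i. \<epsilon> * (k $ i + 1))"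
      proof -
        have "(\<chi> i. 1/2) \<in> unit_cell" by (simp add: unit_cell_def)
        then show ?thesis unfolding place_box[symmetric] using closure_box place_box by (metis empty_iff image_eqI)
      qed
      then show ?thesis using eps_pos by (simp add: place_def mem_box_cart)
    qed
    ultimately obtain k' y where k': "k' \<in> cells" "y \<in> U" "place k 0 = place k' y"
      unfolding tube_inclusions by blast
    then have y: "y \<in> unit_cell" using U_subset by blast
    have "0 + k = y + k'" using k'(3) eps_pos unfolding place_def by (metis scaleR_cancel_left less_irrefl)
    then have y': "y = k - k'" by simp
    have "k $ 1 \<in> \<int>" "k' $ 1 \<in> \<int>" using k k'(1) by (auto simp: cells_def)
    then have "y $ 1 \<in> \<int>" using y' by simp
    then obtain m :: int where "y $ 1 = of_int m" by (auto elim: Ints_cases)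
    moreover have "0 < y $ 1" "y $ 1 < 1" using y by (auto simp: unit_cell_def)
    ultimately show False by simp
  qed
  then obtain z where z: "z \<in> unit_cell" "v (t, place k z) = 0" by blast
  show "\<bar>v (t, place k y)\<bar> \<le> 9 * (M * \<epsilon>)" if y: "y \<in> unit_cell" for y
  proof -
    have "\<bar>v (t, place k y)\<bar> \<le> 3 * (M * \<epsilon>) * norm (y - z)" using lip[OF y z(1)] z(2) by simp
    also have "\<dots> \<le> 3 * (M * \<epsilon>) * 3"
      using diameter_unit_cell[OF y z(1)] M eps_pos by (intro mult_left_mono) auto
    finally show ?thesis by simp
  qed
qed

section \<open>The unfolded Jacobian of the motion function\<close>

context
  fixes \<tau> K :: real and v \<phi> :: "real \<times> (real^3) \<Rightarrow> real" and h :: "real \<Rightarrow> real^3 \<Rightarrow> real"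
    and \<eta> :: "real \<Rightarrow> real" and P B :: real
  assumes \<eta>: "cutoff \<eta>"
    and motion: "motion_levelset \<epsilon> \<Omega> A v \<tau> \<phi>"
    and height: "height_function \<epsilon> a A \<tau> (zero_surface \<Omega> \<phi>) h"
    and K: "0 < K"
    and speed: "\<And>k t y. k \<in> cells \<Longrightarrow> t \<in> {0<..<\<tau>} \<Longrightarrow> y \<in> unit_cell \<Longrightarrow> \<bar>v (t, place k y)\<bar> \<le> K"
      "\<And>k t x y. k \<in> cells \<Longrightarrow> t \<in> {0<..<\<tau>} \<Longrightarrow> x \<in> unit_cell \<Longrightarrow> y \<in> unit_cell \<Longrightarrow>
        \<bar>v (t, place k x) - v (t, place k y)\<bar> \<le> K * norm (x - y)"
    and P: "P-lipschitz_on inner_tube foot" and B: "B-lipschitz_on inner_tube unit_normal"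
begin

abbreviation "rescaled k t \<equiv> (\<lambda>\<gamma>. h t (place k \<gamma>) / \<epsilon>)"
abbreviation "unfolded \<equiv> unfolding_op \<epsilon> \<Omega> (space_jacobian (motion_function \<epsilon> a A \<eta> h))"

lemma cell_index_cells: "scaled_cell \<epsilon> unit_cell (cell_index x) \<subseteq> \<Omega> \<longleftrightarrow> cell_index x \<in> cells"
  by (simp add: cells_def cell_index_def)

lemma displacement_derivative_bounded:
  assumes k: "k \<in> cells" and t: "t \<in> {0<..<\<tau>}"
  obtains D where "(displacement \<eta> (rescaled k t) has_derivative D) (at y)"
    "\<And>w. norm (D w) \<le> (P / 4 + a / 10 * (4 / a + B)) * norm w"
proof -
  have t': "t \<in> {0..\<tau>}" using t by auto
  note r = rescaled_height_derivative[OF height t' k]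
  have P0: "0 \<le> P" using P by (rule lipschitz_on_nonneg)
  show ?thesis
  proof (rule displacement_derivative[OF \<eta> r(1) B r(3), of "P / 4" y])
    show "\<bar>D w\<bar> \<le> P / 4 * norm w" if "z \<in> near" "((\<lambda>x. rescaled k t (foot x)) has_derivative D) (at z)" for z D w
      using height_foot_bound_of_onorm[OF P r(1,2) that, of w] by simp
  qed (use a_pos P0 that in auto)
qed

lemma displacement_derivative_small:
  assumes k: "k \<in> cells" and t: "t \<in> {0<..<\<tau>}" and small: "K * (2 + B) * \<tau> \<le> 1 / 4"
    and N: "N-lipschitz_on \<Gamma> n"
  obtains D where "(displacement \<eta> (rescaled k t) has_derivative D) (at y)"
    "\<And>w. norm (D w) \<le> K * (2 * (2 + B) * \<tau> * (1 + a * N) * P + 2 * \<tau> * (4 / a + B)) * norm w"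
proof -
  interpret moving_front Y1 Y2 a \<tau> K "\<lambda>(t, y). \<phi> (t, place k y)" "\<lambda>(t, y). v (t, place k y)" "rescaled k"
    by (rule moving_front_place[OF motion height k K speed(1)[OF k] speed(2)[OF k]])
  have t': "t \<in> {0..\<tau>}" using t by auto
  note r = rescaled_height_derivative[OF height t' k]
  have P0: "0 \<le> P" "0 \<le> B" "0 \<le> N" using P B N by (auto dest: lipschitz_on_nonneg)
  let ?L = "2 * (K * (2 + B) * \<tau>) * (1 + a * N)"
  have L0: "0 \<le> ?L" using K P0 t a_pos by simp
  have lip: "?L-lipschitz_on \<Gamma> (rescaled k t)"
    by (rule lipschitz_onI) (use height_lipschitz[OF B small N t] L0 in \<open>auto simp: dist_norm\<close>)
  have le: "\<bar>rescaled k t \<gamma>\<bar> \<le> 2 * K * \<tau>" if "\<gamma> \<in> \<Gamma>" for \<gamma>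
  proof -
    have "2 * K * t \<le> 2 * K * \<tau>" using t K by simp
    with height_le[OF t that] show ?thesis by linarith
  qed
  show ?thesis
  proof (rule displacement_derivative[OF \<eta> r(1) B le, of "?L * P" y])
    show "\<bar>D w\<bar> \<le> ?L * P * norm w" if "z \<in> near" "((\<lambda>x. rescaled k t (foot x)) has_derivative D) (at z)" for z D w
      using height_foot_bound_of_lipschitz[OF P lip that] by simp
    fix D assume D: "(displacement \<eta> (rescaled k t) has_derivative D) (at y)"
      "\<And>w. norm (D w) \<le> (?L * P + 2 * K * \<tau> * (4 / a + B)) * norm w"
    have "?L * P + 2 * K * \<tau> * (4 / a + B) = K * (2 * (2 + B) * \<tau> * (1 + a * N) * P + 2 * \<tau> * (4 / a + B))"
      by (simp add: algebra_simps)
    with D show thesis using that by simp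
  qed (use K t P0 L0 in auto)
qed

lemma unfolded_eq:
  assumes "t \<in> {0<..<\<tau>}" "y \<in> unit_cell" "cell_index (x /\<^sub>R \<epsilon>) = k" "k \<in> cells"
    and D: "(displacement \<eta> (rescaled k t) has_derivative D) (at y)"
  shows "unfolded (t, x, y) = mat 1 + matrix D"
proof -
  have "\<epsilon> *\<^sub>R y + \<epsilon> *\<^sub>R k = place k y" by (simp add: place_def algebra_simps)
  then show ?thesis
    using space_jacobian_place[where h = h and t = t, OF assms(4,2) D] assms(3,4) by (simp add: unfolding_op_def cell_index_cells)
qed

lemma unfolded_bound:
  assumes "t \<in> {0<..<\<tau>}" "y \<in> unit_cell"
  shows "norm (unfolded (t, x, y) - mat 1) \<le> norm (mat 1 :: real^3^3) + 9 * (P / 4 + a / 10 * (4 / a + B))"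
proof (cases "cell_index (x /\<^sub>R \<epsilon>) \<in> cells")
  case True
  obtain D where D: "(displacement \<eta> (rescaled (cell_index (x /\<^sub>R \<epsilon>)) t) has_derivative D) (at y)"
    "\<And>w. norm (D w) \<le> (P / 4 + a / 10 * (4 / a + B)) * norm w"
    using displacement_derivative_bounded[OF True assms(1)] by blast
  have "norm (unfolded (t, x, y) - mat 1) \<le> 9 * (P / 4 + a / 10 * (4 / a + B))"
    using unfolded_eq[OF assms refl True D(1)] norm_matrix_le[OF D(2)] by simp
  then show ?thesis using norm_ge_zero[of "mat 1 :: real^3^3"] by linarith
next
  case False
  then have "unfolded (t, x, y) = 0" by (simp add: unfolding_op_def cell_index_cells)
  moreover have "0 \<le> 9 * (P / 4 + a / 10 * (4 / a + B))"
    using lipschitz_on_nonneg[OF P] lipschitz_on_nonneg[OF B] a_pos by simp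
  ultimately show ?thesis by simp
qed

lemma unfolded_small:
  assumes "t \<in> {0<..<\<tau>}" "y \<in> unit_cell" "cell_index (x /\<^sub>R \<epsilon>) \<in> cells"
    and small: "K * (2 + B) * \<tau> \<le> 1 / 4" and N: "N-lipschitz_on \<Gamma> n"
  shows "norm (unfolded (t, x, y) - mat 1) \<le> 9 * (K * (2 * (2 + B) * \<tau> * (1 + a * N) * P + 2 * \<tau> * (4 / a + B)))"
proof -
  obtain D where D: "(displacement \<eta> (rescaled (cell_index (x /\<^sub>R \<epsilon>)) t) has_derivative D) (at y)"
    "\<And>w. norm (D w) \<le> K * (2 * (2 + B) * \<tau> * (1 + a * N) * P + 2 * \<tau> * (4 / a + B)) * norm w"
    using displacement_derivative_small[OF assms(3,1) small N] by blast
  show ?thesis using unfolded_eq[OF assms(1,2) refl assms(3) D(1)] norm_matrix_le[OF D(2)] by simp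
qed

text \<open>
  The unfolded Jacobian is a finite sum over the cells inside \<open>\<Omega>\<close>, each summand being supported on
  the points whose cell has the given index.
\<close>

lemma measurable_unfolded:
  obtains F where "F \<in> borel_measurable borel"
    "\<And>t x y. t \<in> {0<..<\<tau>} \<Longrightarrow> y \<in> unit_cell \<Longrightarrow> unfolded (t, x, y) = F (t, x, y)"
proof -
  define J :: "real^3 \<Rightarrow> real \<times> (real^3) \<Rightarrow> real^3^3" where
    "J k = (\<lambda>(t, y). if t \<in> {0<..<\<tau>} then matrix (frechet_derivative (displacement \<eta> (rescaled k t)) (at y)) else 0)" for k
  have J: "J k \<in> borel_measurable borel" if k: "k \<in> cells" for k
    unfolding J_def
  proof (rule measurable_jacobian)
    interpret moving_front Y1 Y2 a \<tau> K "\<lambda>(t, y). \<phi> (t, place k y)" "\<lambda>(t, y). v (t, place k y)" "rescaled k"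
      by (rule moving_front_place[OF motion height k K speed(1)[OF k] speed(2)[OF k]])
    show "continuous_on ({0<..<\<tau>} \<times> UNIV) (\<lambda>(t, y). displacement \<eta> (rescaled k t) y)"
      by (rule continuous_displacement[OF \<eta> _ continuous_height]) simp
    show "displacement \<eta> (rescaled k t) differentiable at y" if "t \<in> {0<..<\<tau>}" for t y
    proof -
      obtain D where "(displacement \<eta> (rescaled k t) has_derivative D) (at y)"
        by (rule displacement_derivative_bounded[OF k \<open>t \<in> {0<..<\<tau>}\<close>, of y])
      then show ?thesis by (rule differentiableI)
    qed
  qed simp
  define R :: "real^3 \<Rightarrow> (real \<times> (real^3) \<times> (real^3)) set" where
    "R k = {z. cell_index (fst (snd z) /\<^sub>R \<epsilon>) = k}" for k
  define F :: "real \<times> (real^3) \<times> (real^3) \<Rightarrow> real^3^3" where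
    "F z = (\<Sum>k\<in>cells. indicat_real (R k) z *\<^sub>R (mat 1 + J k (fst z, snd (snd z))))" for z
  have ind: "R k \<in> sets borel" for k
  proof -
    have "R k = (\<Inter>i\<in>UNIV. {z. real_of_int \<lfloor>fst (snd z) $ i / \<epsilon>\<rfloor> = k $ i})"
      by (auto simp: R_def cell_index_def vec_eq_iff divide_inverse mult.commute)
    moreover have "{z :: real \<times> (real^3) \<times> (real^3). real_of_int \<lfloor>fst (snd z) $ i / \<epsilon>\<rfloor> = k $ i} \<in> sets borel" for i
    proof -
      have [measurable]: "(\<lambda>z :: real \<times> (real^3) \<times> (real^3). fst (snd z) $ i / \<epsilon>) \<in> borel_measurable borel"
        by (intro borel_measurable_continuous_onI continuous_intros) (use eps_pos in auto)
      show ?thesis by measurable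
    qed
    ultimately show ?thesis by (simp add: sets.finite_INT)
  qed
  have J': "(\<lambda>z :: real \<times> (real^3) \<times> (real^3). J k (fst z, snd (snd z))) \<in> borel_measurable borel"
    if "k \<in> cells" for k
  proof (rule measurable_compose[OF _ J[OF that]])
    show "(\<lambda>z :: real \<times> (real^3) \<times> (real^3). (fst z, snd (snd z))) \<in> borel_measurable borel"
      by (intro borel_measurable_continuous_onI continuous_intros)
  qed
  have "F \<in> borel_measurable borel"
    unfolding F_def[abs_def]
    by (intro borel_measurable_sum borel_measurable_scaleR borel_measurable_indicator ind
        borel_measurable_add J' borel_measurable_const)
  moreover have "unfolded (t, x, y) = F (t, x, y)" if t: "t \<in> {0<..<\<tau>}" and y: "y \<in> unit_cell" for t x y
  proof (cases "cell_index (x /\<^sub>R \<epsilon>) \<in> cells")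
    case True
    let ?k = "cell_index (x /\<^sub>R \<epsilon>)"
    obtain D where D: "(displacement \<eta> (rescaled ?k t) has_derivative D) (at y)"
      by (rule displacement_derivative_bounded[OF True t, of y])
    have "F (t, x, y) = (\<Sum>k\<in>cells. if k = ?k then mat 1 + J ?k (t, y) else 0)"
      unfolding F_def by (intro sum.cong) (auto simp: R_def indicator_def)
    also have "\<dots> = mat 1 + J ?k (t, y)" using finite_cells True by simp
    also have "\<dots> = mat 1 + matrix D" using t frechet_derivative_at[OF D] by (simp add: J_def)
    finally show ?thesis using unfolded_eq[OF t y refl True D] by simp
  next
    case False
    have "F (t, x, y) = 0" unfolding F_def by (rule sum.neutral) (use False in \<open>auto simp: R_def indicator_def\<close>)
    with False show ?thesis by (simp add: unfolding_op_def cell_index_cells)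
  qed
  ultimately show ?thesis by (rule that)
qed

end

end

text \<open>The cell containing \<open>x\<close> has diameter at most \<open>3 \<epsilon>\<close>.\<close>

lemma eventually_cell_subset:
  fixes \<epsilon> :: "nat \<Rightarrow> real"
  assumes "open \<Omega>" "x \<in> \<Omega>" "\<And>n. 0 < \<epsilon> n" "\<epsilon> \<longlonglongrightarrow> 0"
  shows "\<forall>\<^sub>F n in sequentially. scaled_cell (\<epsilon> n) unit_cell (cell_index (x /\<^sub>R \<epsilon> n)) \<subseteq> \<Omega>"
proof -
  obtain r where r: "0 < r" "ball x r \<subseteq> \<Omega>" using assms(1,2) by (meson openE)
  have "\<forall>\<^sub>F n in sequentially. \<epsilon> n < r / 3" using assms(4) r(1) by (intro order_tendstoD) auto
  then show ?thesis
  proof eventually_elim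
    case (elim n)
    show ?case
    proof
      fix z assume "z \<in> scaled_cell (\<epsilon> n) unit_cell (cell_index (x /\<^sub>R \<epsilon> n))"
      then obtain y where y: "y \<in> unit_cell" "z = \<epsilon> n *\<^sub>R (y + cell_index (x /\<^sub>R \<epsilon> n))"
        by (auto simp: scaled_cell_def)
      let ?d = "y - (x /\<^sub>R \<epsilon> n - cell_index (x /\<^sub>R \<epsilon> n))"
      have "\<bar>?d $ i\<bar> \<le> 1" for i
      proof -
        have "0 < y $ i" "y $ i < 1" using y by (auto simp: unit_cell_def)
        moreover have "?d $ i = y $ i - ((x /\<^sub>R \<epsilon> n) $ i - of_int \<lfloor>(x /\<^sub>R \<epsilon> n) $ i\<rfloor>)"
          by (simp add: cell_index_def)
        ultimately show ?thesis by linarith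
      qed
      then have "(\<Sum>i\<in>UNIV. \<bar>?d $ i\<bar>) \<le> (\<Sum>i\<in>(UNIV::3 set). 1)" by (intro sum_mono)
      with norm_le_l1_cart[of ?d] have "norm ?d \<le> 3" by simp
      have "z - x = \<epsilon> n *\<^sub>R ?d" using assms(3)[of n] y(2) by (simp add: algebra_simps)
      then have "dist x z = \<epsilon> n * norm ?d"
        using assms(3)[of n] by (simp add: dist_commute[of x z] dist_norm[of z x])
      also have "\<dots> \<le> \<epsilon> n * 3" using \<open>norm ?d \<le> 3\<close> assms(3)[of n] by (intro mult_left_mono) auto
      also have "\<dots> < r" using elim by simp
      finally show "z \<in> \<Omega>" using r(2) by auto
    qed
  qed
qed

section \<open>The two-scale limit\<close>

text \<open>
  The integral of a difference quotient vanishes by translation invariance, and the difference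
  quotients converge dominatedly.
\<close>

lemma integral_directional_derivative_eq_0:
  fixes \<xi> :: "'a::euclidean_space \<Rightarrow> 'b::euclidean_space"
  assumes d: "\<And>z. (\<xi> has_derivative \<xi>' z) (at z)" and cont: "continuous_on UNIV (\<lambda>z. \<xi>' z b)"
    and K: "compact K" "\<And>z. z \<notin> K \<Longrightarrow> \<xi> z = 0"
  shows "(\<integral>z. \<xi>' z b \<partial>lborel) = 0"
proof -
  have c\<xi>: "continuous_on UNIV \<xi>" using d by (meson has_derivative_continuous_on has_derivative_at_withinI)
  have \<xi>m: "\<xi> \<in> borel_measurable borel" by (rule borel_measurable_continuous_onI[OF c\<xi>])
  have zero': "\<xi>' z b = 0" if "z \<notin> K" for z
  proof -
    have "open (- K)" using K(1) by (intro open_Compl compact_imp_closed)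
    then have "(\<xi> has_derivative (\<lambda>h. 0)) (at z)"
      by (rule has_derivative_transform_within_open[OF has_derivative_const]) (use K(2) that in auto)
    then have "\<xi>' z = (\<lambda>h. 0)" using d has_derivative_unique by blast
    then show ?thesis by simp
  qed
  have "bounded ((\<lambda>z. \<xi>' z b) ` K)"
    by (intro compact_imp_bounded compact_continuous_image continuous_on_subset[OF cont] K) auto
  then obtain C where C: "0 < C" "\<And>z. z \<in> K \<Longrightarrow> norm (\<xi>' z b) \<le> C" by (auto simp: bounded_pos)
  have C': "norm (\<xi>' z b) \<le> C" for z using C zero'[of z] by (cases "z \<in> K") auto
  obtain R where R: "\<And>z. z \<in> K \<Longrightarrow> norm z \<le> R" using compact_imp_bounded[OF K(1)] by (auto simp: bounded_iff)
  let ?B = "cball 0 (R + norm b) :: 'a set"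
  define q where "q m z = real (Suc m) *\<^sub>R (\<xi> (z + (1 / real (Suc m)) *\<^sub>R b) - \<xi> z)" for m z
  have int: "integrable lborel \<xi>"
  proof -
    have "integrable lborel (\<lambda>z. indicator K z *\<^sub>R \<xi> z)"
      by (intro borel_integrable_compact K continuous_on_subset[OF c\<xi>]) auto
    also have "(\<lambda>z. indicator K z *\<^sub>R \<xi> z) = \<xi>" using K(2) by (auto simp: indicator_def fun_eq_iff)
    finally show ?thesis .
  qed
  have shift: "integrable lborel (\<lambda>z. \<xi> (z + c))" "(\<integral>z. \<xi> (z + c) \<partial>lborel) = (\<integral>z. \<xi> z \<partial>lborel)" for c
  proof -
    have "integrable (distr lborel borel ((+) c)) \<xi>" using int by (simp add: lborel_distr_plus)
    then show "integrable lborel (\<lambda>z. \<xi> (z + c))"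
      by (subst (asm) integrable_distr_eq) (use \<xi>m in \<open>auto simp: add.commute\<close>)
    have "(\<integral>z. \<xi> z \<partial>lborel) = (\<integral>z. \<xi> z \<partial>distr lborel borel ((+) c))" by (simp add: lborel_distr_plus)
    also have "\<dots> = (\<integral>z. \<xi> (c + z) \<partial>lborel)" by (rule integral_distr) (use \<xi>m in auto)
    finally show "(\<integral>z. \<xi> (z + c) \<partial>lborel) = (\<integral>z. \<xi> z \<partial>lborel)" by (simp add: add.commute)
  qed
  have q0: "(\<integral>z. q m z \<partial>lborel) = 0" for m
    unfolding q_def using shift int by simp
  have line: "((\<lambda>s. \<xi> (z + s *\<^sub>R b)) has_vector_derivative \<xi>' (z + s *\<^sub>R b) b) (at s)" for z s
  proof -
    have "((\<lambda>s. z + s *\<^sub>R b) has_derivative (\<lambda>s. s *\<^sub>R b)) (at s)" by (auto intro!: derivative_eq_intros)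
    from diff_chain_at[OF this d] have "((\<lambda>s. \<xi> (z + s *\<^sub>R b)) has_derivative (\<lambda>r. \<xi>' (z + s *\<^sub>R b) (r *\<^sub>R b))) (at s)"
      by (simp add: o_def)
    moreover have "(\<lambda>r. \<xi>' (z + s *\<^sub>R b) (r *\<^sub>R b)) = (\<lambda>r. r *\<^sub>R \<xi>' (z + s *\<^sub>R b) b)"
      using linear_cmul[OF has_derivative_linear[OF d]] by simp
    ultimately show ?thesis by (simp add: has_vector_derivative_def)
  qed
  have seq: "filterlim (\<lambda>m. 1 / real (Suc m)) (at 0) sequentially"
    unfolding filterlim_at using LIMSEQ_Suc[OF lim_1_over_n] by (auto intro!: eventuallyI)
  have lim: "(\<lambda>m. q m z) \<longlonglongrightarrow> \<xi>' z b" for z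
  proof -
    have "((\<lambda>s. (1 / s) *\<^sub>R (\<xi> (z + s *\<^sub>R b) - \<xi> z)) \<longlongrightarrow> \<xi>' z b) (at 0)"
    proof -
      have "((\<lambda>s. norm (\<xi> (z + s *\<^sub>R b) - \<xi> z - s *\<^sub>R \<xi>' z b) / norm s) \<longlongrightarrow> 0) (at 0)"
        using line[of z 0] by (simp add: has_vector_derivative_def has_derivative_at)
      moreover have "\<forall>\<^sub>F s in at 0. norm (\<xi> (z + s *\<^sub>R b) - \<xi> z - s *\<^sub>R \<xi>' z b) / norm s
          = norm ((1 / s) *\<^sub>R (\<xi> (z + s *\<^sub>R b) - \<xi> z) - \<xi>' z b)"
        unfolding eventually_at_filter
      proof (rule always_eventually, intro allI impI)
        fix s :: real assume "s \<noteq> 0"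
        then have "(1 / s) *\<^sub>R (\<xi> (z + s *\<^sub>R b) - \<xi> z) - \<xi>' z b
            = (1 / s) *\<^sub>R (\<xi> (z + s *\<^sub>R b) - \<xi> z - s *\<^sub>R \<xi>' z b)"
          by (simp add: scaleR_diff_right)
        then show "norm (\<xi> (z + s *\<^sub>R b) - \<xi> z - s *\<^sub>R \<xi>' z b) / norm s
          = norm ((1 / s) *\<^sub>R (\<xi> (z + s *\<^sub>R b) - \<xi> z) - \<xi>' z b)" by simp
      qed
      ultimately have "((\<lambda>s. norm ((1 / s) *\<^sub>R (\<xi> (z + s *\<^sub>R b) - \<xi> z) - \<xi>' z b)) \<longlongrightarrow> 0) (at 0)"
        by (rule Lim_transform_eventually)
      then show ?thesis by (simp only: tendsto_norm_zero_iff LIM_zero_iff)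
    qed
    from filterlim_compose[OF this seq] show ?thesis by (simp add: q_def)
  qed
  have bound: "norm (q m z) \<le> C * indicator ?B z" for m z
  proof (cases "z \<in> ?B")
    case True
    let ?s = "1 / real (Suc m)"
    have "norm (\<xi> (z + ?s *\<^sub>R b) - \<xi> (z + 0 *\<^sub>R b)) \<le> C * norm (?s - 0)"
    proof (rule differentiable_bound[of "{0..?s}"])
      show "((\<lambda>s. \<xi> (z + s *\<^sub>R b)) has_derivative (\<lambda>r. r *\<^sub>R \<xi>' (z + s *\<^sub>R b) b)) (at s within {0..?s})" for s
        using has_vector_derivative_at_within[OF line] by (simp add: has_vector_derivative_def)
      show "onorm (\<lambda>r. r *\<^sub>R \<xi>' (z + s *\<^sub>R b) b) \<le> C" for s
        using C' C(1) by (intro onorm_bound) (simp_all add: mult.commute[of C] mult_left_mono)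
    qed auto
    then have "real (Suc m) * norm (\<xi> (z + ?s *\<^sub>R b) - \<xi> z) \<le> real (Suc m) * (C * ?s)"
      by (intro mult_left_mono) auto
    then show ?thesis using True by (simp add: q_def)
  next
    case False
    have far: "z + s *\<^sub>R b \<notin> K" if "0 \<le> s" "s \<le> 1" for s
    proof
      assume "z + s *\<^sub>R b \<in> K"
      have "norm z \<le> norm (z + s *\<^sub>R b) + norm (s *\<^sub>R b)" using norm_triangle_ineq4[of "z + s *\<^sub>R b" "s *\<^sub>R b"] by simp
      also have "\<dots> \<le> R + norm b" using R[OF \<open>z + s *\<^sub>R b \<in> K\<close>] that by (intro add_mono) (auto intro: mult_left_le_one_le)
      finally show False using False by simp
    qed
    have "\<xi> (z + (1 / real (Suc m)) *\<^sub>R b) = 0" by (intro K(2) far) simp_all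
    moreover have "\<xi> z = 0" using K(2)[OF far[of 0]] by simp
    ultimately show ?thesis using C(1) by (simp add: q_def)
  qed
  have "(\<lambda>m. \<integral>z. q m z \<partial>lborel) \<longlonglongrightarrow> (\<integral>z. \<xi>' z b \<partial>lborel)"
  proof (rule integral_dominated_convergence[where w = "\<lambda>z. C * indicator ?B z"])
    show "(\<lambda>z. \<xi>' z b) \<in> borel_measurable lborel" using borel_measurable_continuous_onI[OF cont] by simp
    show "q m \<in> borel_measurable lborel" for m
    proof -
      have "continuous_on UNIV (\<lambda>z. \<xi> (z + c))" for c
        by (rule continuous_on_compose2[OF c\<xi>]) (auto intro!: continuous_intros)
      then have "continuous_on UNIV (q m)" unfolding q_def[abs_def] using c\<xi> by (intro continuous_intros)
      then show ?thesis by (simp add: borel_measurable_continuous_onI)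
    qed
    have "integrable lborel (\<lambda>z. indicator ?B z *\<^sub>R (1::real))"
      by (intro borel_integrable_compact) auto
    then show "integrable lborel (\<lambda>z. C * indicator ?B z)" by simp
  qed (use lim bound in auto)
  then show ?thesis by (simp add: q0 LIMSEQ_const_iff)
qed

text \<open>Integration by parts for the product of a test function with a linear map. The limit
  \<open>(t, x, y) \<mapsto> y\<close> is of this kind.\<close>

lemma weak_deriv_linear:
  fixes L :: "'a::euclidean_space \<Rightarrow> 'b::euclidean_space"
  assumes L: "bounded_linear L" and E: "open E" and b: "b \<in> Basis"
  shows "weak_deriv E [b] L (\<lambda>_. L b)"
  unfolding weak_deriv_def
proof (intro conjI allI impI)
  interpret L: bounded_linear L by (rule L)
  have cL: "continuous_on S L" for S by (rule linear_continuous_on[OF L])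
  have El: "E \<in> sets lebesgue" using E by simp
  show "in_L1_loc E L" "in_L1_loc E (\<lambda>_. L b)"
    unfolding in_L1_loc_def
    by (auto intro!: integrable_lebesgue_on_compact_support cL continuous_on_const lmeasurable_compact[THEN fmeasurableD])
  fix \<zeta> :: "'a \<Rightarrow> real" assume \<zeta>: "test_function E \<zeta>"
  have ck: "Ck_on k UNIV \<zeta>" for k using \<zeta> by (simp add: test_function_def)
  define K where "K = closure {z. \<zeta> z \<noteq> 0}"
  have K: "compact K" "K \<subseteq> E" using \<zeta> unfolding test_function_def K_def by blast+
  have supp: "{z. \<zeta> z \<noteq> 0} \<subseteq> K" unfolding K_def by (rule closure_subset)
  let ?\<zeta>' = "\<lambda>z. frechet_derivative \<zeta> (at z) b"
  have d: "(\<zeta> has_derivative frechet_derivative \<zeta> (at z)) (at z)" for z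
    using ck[of 1] by (simp add: frechet_derivative_works)
  have c: "continuous_on S \<zeta>" "continuous_on S ?\<zeta>'" for S
    using ck[of 0] ck[of 1] b by (auto intro: continuous_on_subset)
  have out: "\<zeta> z = 0" if "z \<notin> K" for z
    using that supp by auto
  have out': "?\<zeta>' z = 0" if "z \<notin> K" for z
  proof -
    have "open (- K)" using K(1) by (intro open_Compl compact_imp_closed)
    then have "(\<zeta> has_derivative (\<lambda>h. 0)) (at z)"
      by (rule has_derivative_transform_within_open[OF has_derivative_const]) (use that out in auto)
    from has_derivative_unique[OF d this] show ?thesis by simp
  qed
  have zero: "(\<integral>z. \<zeta> z *\<^sub>R L b + ?\<zeta>' z *\<^sub>R L z \<partial>lborel) = 0"
  proof (rule integral_directional_derivative_eq_0[OF _ _ K(1)])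
    show "((\<lambda>z. \<zeta> z *\<^sub>R L z) has_derivative (\<lambda>h. \<zeta> z *\<^sub>R L h + frechet_derivative \<zeta> (at z) h *\<^sub>R L z)) (at z)" for z
      by (rule has_derivative_scaleR[OF d bounded_linear_imp_has_derivative[OF L]])
    show "continuous_on UNIV (\<lambda>z. \<zeta> z *\<^sub>R L b + ?\<zeta>' z *\<^sub>R L z)" by (intro continuous_intros c cL)
  qed (use out in auto)
  have int: "integrable (lebesgue_on E) (\<lambda>z. \<zeta> z *\<^sub>R L b)" "integrable (lebesgue_on E) (\<lambda>z. ?\<zeta>' z *\<^sub>R L z)"
    by (intro integrable_lebesgue_on_compact_support[OF El K(1,2)] continuous_intros c cL; use out out' in auto)+
  have "(\<integral>z. \<zeta> z *\<^sub>R L b + ?\<zeta>' z *\<^sub>R L z \<partial>lebesgue_on E) = 0"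
  proof (subst integral_lebesgue_on_support[OF El])
    show "(\<lambda>z. \<zeta> z *\<^sub>R L b + ?\<zeta>' z *\<^sub>R L z) \<in> borel_measurable borel"
      by (intro borel_measurable_continuous_onI continuous_intros c cL)
    show "\<zeta> z *\<^sub>R L b + ?\<zeta>' z *\<^sub>R L z = 0" if "z \<notin> E" for z
    proof -
      have "z \<notin> K" using K(2) that by blast
      then show ?thesis using out[of z] out'[of z] by simp
    qed
  qed (rule zero)
  then have "(\<integral>z. \<zeta> z *\<^sub>R L b \<partial>lebesgue_on E) + (\<integral>z. ?\<zeta>' z *\<^sub>R L z \<partial>lebesgue_on E) = 0"
    using int by simp
  then show "(\<integral>z. iter_deriv [b] \<zeta> z *\<^sub>R L z \<partial>lebesgue_on E)
      = (- 1) ^ length [b] *\<^sub>R (\<integral>z. \<zeta> z *\<^sub>R L b \<partial>lebesgue_on E)"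
    by (simp add: eq_neg_iff_add_eq_0 add.commute)
qed

lemma in_LinfI:
  fixes f :: "'a::euclidean_space \<Rightarrow> 'b::euclidean_space"
  assumes "f \<in> borel_measurable borel" "\<And>z. z \<in> D \<Longrightarrow> norm (f z) \<le> C"
  shows "in_Linf D f"
proof -
  have m: "f \<in> borel_measurable (lebesgue_on D)"
    using assms(1) by (intro measurable_restrict_space1 measurable_completion) simp
  then have "(\<lambda>z. ennreal (norm (f z))) \<in> borel_measurable (lebesgue_on D)" by simp
  then have "Linf_norm D f \<le> ennreal C"
    unfolding Linf_norm_def by (rule esssup_I) (use assms(2) in \<open>auto intro!: AE_I2 ennreal_leI simp: space_restrict_space\<close>)
  then show ?thesis using m by (simp add: in_Linf_def le_less_trans)
qed

lemma L2_tendsto_bounded: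
  fixes F :: "nat \<Rightarrow> 'a::euclidean_space \<Rightarrow> 'b::euclidean_space"
  assumes E: "open E" "bounded E"
    and F: "\<And>n. \<exists>G\<in>borel_measurable borel. \<forall>z\<in>E. F n z = G z"
    and b: "\<And>n z. z \<in> E \<Longrightarrow> norm (F n z - c) \<le> C"
    and lim: "\<And>z. z \<in> E \<Longrightarrow> (\<lambda>n. F n z) \<longlonglongrightarrow> c"
  shows "L2_tendsto E F (\<lambda>_. c)"
proof -
  have Em: "E \<in> lmeasurable" using E by (intro lmeasurable_open)
  interpret finite_measure "lebesgue_on E"
    using Em by (intro finite_measure_lebesgue_on)
  have Fm: "F n \<in> borel_measurable (lebesgue_on E)" for n
  proof -
    obtain G where G: "G \<in> borel_measurable borel" "\<forall>z\<in>E. F n z = G z" using F by blast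
    have "G \<in> borel_measurable (lebesgue_on E)" using G(1) by (intro measurable_restrict_space1 measurable_completion) simp
    then show ?thesis by (rule measurable_cong[THEN iffD2, rotated]) (use G(2) in \<open>auto simp: space_restrict_space\<close>)
  qed
  have Fb: "norm (F n z) \<le> C + norm c" if "z \<in> E" for n z
    using b[OF that, of n] norm_triangle_sub[of "F n z" c] by linarith
  have "in_L2 E (F n)" for n
    unfolding in_L2_def
  proof
    show "integrable (lebesgue_on E) (\<lambda>z. (norm (F n z))\<^sup>2)"
    proof (rule integrable_const_bound[where B = "(C + norm c)\<^sup>2"])
      show "AE z in lebesgue_on E. norm ((norm (F n z))\<^sup>2) \<le> (C + norm c)\<^sup>2"
        using Fb by (auto intro!: AE_I2 power_mono simp: space_restrict_space)
    qed (use Fm in measurable)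
  qed (rule Fm)
  moreover have "in_L2 E (\<lambda>_. c)" by (simp add: in_L2_def)
  moreover have "(\<lambda>n. L2_norm E (\<lambda>z. F n z - c)) \<longlonglongrightarrow> 0"
  proof -
    have "(\<lambda>n. \<integral>z. (norm (F n z - c))\<^sup>2 \<partial>lebesgue_on E) \<longlonglongrightarrow> (\<integral>z. 0 \<partial>lebesgue_on E)"
    proof (rule integral_dominated_convergence[where w = "\<lambda>_. C\<^sup>2"])
      show "AE z in lebesgue_on E. (\<lambda>n. (norm (F n z - c))\<^sup>2) \<longlonglongrightarrow> 0"
      proof (rule AE_I2)
        fix z assume "z \<in> space (lebesgue_on E)"
        then have "(\<lambda>n. norm (F n z - c)) \<longlonglongrightarrow> 0"
          using lim[of z] by (simp add: space_restrict_space LIM_zero_iff tendsto_norm_zero_iff)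
        from tendsto_power[OF this, of 2] show "(\<lambda>n. (norm (F n z - c))\<^sup>2) \<longlonglongrightarrow> 0" by simp
      qed
      show "AE z in lebesgue_on E. norm ((norm (F n z - c))\<^sup>2) \<le> C\<^sup>2" for n
        using b by (auto intro!: AE_I2 power_mono simp: space_restrict_space)
    qed (use Fm in \<open>auto intro!: borel_measurable_power borel_measurable_norm borel_measurable_diff\<close>)
    from tendsto_real_sqrt[OF this] show ?thesis by (simp add: L2_norm_def)
  qed
  ultimately show ?thesis by (simp add: L2_tendsto_def)
qed

theorem theorem3p2:
  fixes T Tv a :: real
    and \<Omega> Y1 Y2 :: "(real^3) set"
    and \<epsilon> :: "nat \<Rightarrow> real"
    and v \<phi> f1 f2 :: "nat \<Rightarrow> real \<times> (real^3) \<Rightarrow> real"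
    and \<theta>1 \<theta>2 :: "nat \<Rightarrow> real^3 \<Rightarrow> real"
    and h :: "nat \<Rightarrow> real \<Rightarrow> real^3 \<Rightarrow> real"
    and \<eta> :: "real \<Rightarrow> real"
  defines "A \<equiv> \<lambda>n. inclusions (\<epsilon> n) \<Omega> Y2"
    and "s_eps \<equiv> \<lambda>n. motion_function (\<epsilon> n) a (inclusions (\<epsilon> n) \<Omega> Y2) \<eta> (h n)"
    and "E \<equiv> {0<..<Tv} \<times> \<Omega> \<times> unit_cell"
  assumes T: "T > 0"
    and Omega: "lipschitz_domain \<Omega>" "bounded \<Omega>"
    and eps: "\<forall>n. \<epsilon> n > 0" "decseq \<epsilon>" "\<epsilon> \<longlonglongrightarrow> 0"
    and cell: "cell_geometry Y1 Y2 a"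
    and curvature: "\<forall>n. \<forall>\<gamma>\<in>frontier (A n). onorm (weingarten (A n) \<gamma>) \<le> 1 / (2 * \<epsilon> n * a)"
    and A1: "assumption_A1 \<epsilon> a T \<Omega> Y2 v"
    and Tv: "0 < Tv" "Tv \<le> T"
    and motion: "\<forall>n. motion_levelset (\<epsilon> n) \<Omega> (A n) (v n) Tv (\<phi> n)"
    and unique: "\<forall>n \<psi>. motion_levelset (\<epsilon> n) \<Omega> (A n) (v n) Tv \<psi> \<longrightarrow>
          (\<forall>t\<in>{0..<Tv}. zero_surface \<Omega> \<psi> t = zero_surface \<Omega> (\<phi> n) t)"
    and height: "\<forall>n. height_function (\<epsilon> n) a (A n) Tv (zero_surface \<Omega> (\<phi> n)) (h n)"
    and eta: "cutoff \<eta>"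
    and A2: "assumption_A2 (\<lambda>n. {(t, x). t \<in> {0<..<Tv} \<and> x \<in> \<Omega> \<and> \<phi> n (t, x) < 0})
               (\<lambda>n. matrix_part (\<epsilon> n) \<Omega> Y2) f1 \<theta>1"
            "assumption_A2 (\<lambda>n. {(t, x). t \<in> {0<..<Tv} \<and> x \<in> \<Omega> \<and> \<phi> n (t, x) > 0})
               A f2 \<theta>2"
  shows "\<exists>(s :: real \<times> (real^3) \<times> (real^3) \<Rightarrow> real^3)
            (dts :: real \<times> (real^3) \<times> (real^3) \<Rightarrow> real^3)
            (Dys :: real \<times> (real^3) \<times> (real^3) \<Rightarrow> real^3^3).
           in_Linf E s \<and> in_Linf E dts \<and> in_Linf E Dys \<and>
           weak_deriv E [(1, 0, 0)] s dts \<and>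
           (\<forall>j. weak_deriv E [(0, 0, axis j 1)] s (\<lambda>z. column j (Dys z))) \<and>
           L2_tendsto E (\<lambda>n. unfolding_op (\<epsilon> n) \<Omega> (space_jacobian (s_eps n))) Dys"
proof -
  interpret reference_cell Y1 Y2 a by unfold_locales (rule cell)
  have open_\<Omega>: "open \<Omega>" using Omega(1) by (simp add: lipschitz_domain_def)
  have pd: "perforated_domain Y1 Y2 a (\<epsilon> n) \<Omega>" for n
    by unfold_locales (use eps(1) open_\<Omega> Omega(2) in auto)
  obtain P where P: "P-lipschitz_on inner_tube foot" by (rule foot_lipschitz)
  obtain B where B: "B-lipschitz_on inner_tube unit_normal" by (rule unit_normal_lipschitz)
  obtain N where N: "N-lipschitz_on \<Gamma> n" by (rule normal_lipschitz)
  obtain b where b: "smooth_bump b" by (rule cutoff_imp_smooth_bump[OF eta])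
  obtain M where M: "0 \<le> M"
    "\<And>n i. weak_deriv ({0<..<T} \<times> \<Omega>) [(0, axis i 1)] (v n) (wderiv ({0<..<T} \<times> \<Omega>) [(0, axis i 1)] (v n))"
    "\<And>n i. AE z in lebesgue_on ({0<..<T} \<times> \<Omega>). \<bar>wderiv ({0<..<T} \<times> \<Omega>) [(0, axis i 1)] (v n) z\<bar> \<le> M"
    by (rule A1_gradient_bound[OF A1], rule that) blast+
  have vc: "continuous_on ({0<..<T} \<times> \<Omega>) (v n)"
    and vs: "\<And>t. t \<in> {0<..<T} \<Longrightarrow> closure {x \<in> \<Omega>. v n (t, x) \<noteq> 0} \<subseteq> tube (A n) (\<epsilon> n * a)" for n
    using A1 by (auto simp: assumption_A1_def Let_def A_def)
  \<comment> \<open>the summand 1 makes the speed bound positive even if the velocity vanishes\<close>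
  define K where "K n = (9 * M + 1) * \<epsilon> n" for n
  have K: "0 < K n" for n using M(1) eps(1) by (simp add: K_def)
  have K9: "9 * (M * \<epsilon> n) \<le> K n" "3 * (M * \<epsilon> n) \<le> K n" for n
    using M(1) eps(1)[rule_format, of n] by (simp_all add: K_def algebra_simps)
  have tT: "t \<in> {0<..<T}" if "t \<in> {0<..<Tv}" for t using that Tv(2) by auto
  have speed1: "\<bar>v n (t, perforated_domain.place (\<epsilon> n) k y)\<bar> \<le> K n"
    if "k \<in> perforated_domain.cells (\<epsilon> n) \<Omega>" "t \<in> {0<..<Tv}" "y \<in> unit_cell" for n k t y
  proof -
    have "\<bar>v n (t, perforated_domain.place (\<epsilon> n) k y)\<bar> \<le> 9 * (M * \<epsilon> n)"
      by (rule perforated_domain.velocity_in_cells(2)[OF pd b that(1) vc M(2,3,1) vs[unfolded A_def] tT[OF that(2)] that(3)])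
    then show ?thesis using K9(1) by (rule order_trans)
  qed
  have speed2: "\<bar>v n (t, perforated_domain.place (\<epsilon> n) k x) - v n (t, perforated_domain.place (\<epsilon> n) k y)\<bar> \<le> K n * norm (x - y)"
    if "k \<in> perforated_domain.cells (\<epsilon> n) \<Omega>" "t \<in> {0<..<Tv}" "x \<in> unit_cell" "y \<in> unit_cell" for n k t x y
  proof -
    have "\<bar>v n (t, perforated_domain.place (\<epsilon> n) k x) - v n (t, perforated_domain.place (\<epsilon> n) k y)\<bar> \<le> 3 * (M * \<epsilon> n) * norm (x - y)"
      by (rule perforated_domain.velocity_in_cells(1)[OF pd b that(1) vc M(2,3,1) vs[unfolded A_def] tT[OF that(2)] that(3,4)])
    also have "\<dots> \<le> K n * norm (x - y)" using K9(2) by (rule mult_right_mono) simp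
    finally show ?thesis .
  qed
  have mot: "motion_levelset (\<epsilon> n) \<Omega> (inclusions (\<epsilon> n) \<Omega> Y2) (v n) Tv (\<phi> n)"
    and hei: "height_function (\<epsilon> n) a (inclusions (\<epsilon> n) \<Omega> Y2) Tv (zero_surface \<Omega> (\<phi> n)) (h n)" for n
    using motion height by (simp_all add: A_def)
  note pars = eta mot hei K speed1 speed2 P B
  define F where "F n = unfolding_op (\<epsilon> n) \<Omega> (space_jacobian (s_eps n))" for n
  have meas: "\<exists>G\<in>borel_measurable borel. \<forall>z\<in>E. F n z = G z" for n
  proof -
    obtain G where "G \<in> borel_measurable borel"
      "\<And>t x y. t \<in> {0<..<Tv} \<Longrightarrow> y \<in> unit_cell \<Longrightarrow> F n (t, x, y) = G (t, x, y)"
      unfolding F_def s_eps_def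
      by (rule perforated_domain.measurable_unfolded[OF pd pars]) auto
    then show ?thesis by (intro bexI[of _ G]) (auto simp: E_def)
  qed
  have bound: "norm (F n z - mat 1) \<le> norm (mat 1 :: real^3^3) + 9 * (P / 4 + a / 10 * (4 / a + B))" if "z \<in> E" for n z
  proof -
    obtain t x y where z: "z = (t, x, y)" "t \<in> {0<..<Tv}" "y \<in> unit_cell"
      using \<open>z \<in> E\<close> by (auto simp: E_def)
    show ?thesis
      unfolding F_def s_eps_def z(1) by (rule perforated_domain.unfolded_bound[OF pd pars z(2,3)])
  qed
  define Q where "Q = 9 * ((9 * M + 1) * (2 * (2 + B) * Tv * (1 + a * N) * P + 2 * Tv * (4 / a + B)))"
  have lim: "(\<lambda>n. F n z) \<longlonglongrightarrow> mat 1" if "z \<in> E" for z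
  proof -
    obtain t x y where z: "z = (t, x, y)" "t \<in> {0<..<Tv}" "x \<in> \<Omega>" "y \<in> unit_cell"
      using \<open>z \<in> E\<close> by (auto simp: E_def)
    have "(\<lambda>n. K n * (2 + B) * Tv) \<longlonglongrightarrow> (9 * M + 1) * 0 * (2 + B) * Tv"
      unfolding K_def by (intro tendsto_intros eps(3))
    then have "\<forall>\<^sub>F n in sequentially. K n * (2 + B) * Tv < 1 / 4" by (intro order_tendstoD) auto
    moreover have "\<forall>\<^sub>F n in sequentially. scaled_cell (\<epsilon> n) unit_cell (cell_index (x /\<^sub>R \<epsilon> n)) \<subseteq> \<Omega>"
      by (rule eventually_cell_subset[OF open_\<Omega> z(3) _ eps(3)]) (use eps(1) in simp)
    ultimately have "\<forall>\<^sub>F n in sequentially. norm (F n z - mat 1) \<le> Q * \<epsilon> n"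
    proof eventually_elim
      case (elim n)
      have "cell_index (x /\<^sub>R \<epsilon> n) \<in> perforated_domain.cells (\<epsilon> n) \<Omega>"
        using elim(2) perforated_domain.cell_index_cells[OF pd pars] by blast
      from perforated_domain.unfolded_small[OF pd pars z(2,4) this _ N] elim(1)
      have "norm (F n z - mat 1) \<le> 9 * (K n * (2 * (2 + B) * Tv * (1 + a * N) * P + 2 * Tv * (4 / a + B)))"
        unfolding F_def s_eps_def z(1) by simp
      then show ?case by (simp add: Q_def K_def mult_ac)
    qed
    moreover have "(\<lambda>n. Q * \<epsilon> n) \<longlonglongrightarrow> 0" using tendsto_mult_right_zero[OF eps(3)] by simp
    ultimately have "(\<lambda>n. F n z - mat 1) \<longlonglongrightarrow> 0" by (rule Lim_null_comparison)
    then show ?thesis by (simp add: LIM_zero_iff)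
  qed
  have oE: "open E" unfolding E_def unit_cell_eq_box using open_\<Omega> by (intro open_Times) auto
  have bE: "bounded E" unfolding E_def unit_cell_eq_box using Omega(2) by (intro bounded_Times) auto
  have conv: "L2_tendsto E F (\<lambda>_. mat 1)" by (rule L2_tendsto_bounded[OF oE bE meas bound lim])
  define s :: "real \<times> (real^3) \<times> (real^3) \<Rightarrow> real^3" where "s = (\<lambda>z. snd (snd z))"
  have s: "bounded_linear s"
    unfolding s_def by (intro bounded_linear_compose[OF bounded_linear_snd bounded_linear_snd])
  have "in_Linf E s"
  proof (rule in_LinfI)
    show "s \<in> borel_measurable borel" by (intro borel_measurable_continuous_onI linear_continuous_on s)
    fix z assume "z \<in> E"
    then have y: "snd (snd z) \<in> unit_cell" by (auto simp: E_def)
    have "norm (snd (snd z)) \<le> (\<Sum>i\<in>UNIV. \<bar>snd (snd z) $ i\<bar>)" by (rule norm_le_l1_cart)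
    also have "\<dots> \<le> (\<Sum>i\<in>(UNIV::3 set). 1)" using y by (intro sum_mono) (auto simp: unit_cell_def less_imp_le)
    finally show "norm (s z) \<le> 3" by (simp add: s_def)
  qed
  moreover have "in_Linf E (\<lambda>_. 0 :: real^3)" "in_Linf E (\<lambda>_. mat 1 :: real^3^3)"
    by (auto intro!: in_LinfI)
  moreover have "weak_deriv E [(1, 0, 0)] s (\<lambda>_. 0)"
  proof -
    have "(1, 0, 0) \<in> (Basis :: (real \<times> (real^3) \<times> (real^3)) set)"
      by (simp add: Basis_prod_def zero_prod_def)
    from weak_deriv_linear[OF s oE this] show ?thesis by (simp add: s_def)
  qed
  moreover have "weak_deriv E [(0, 0, axis j 1)] s (\<lambda>_. column j (mat 1))" for j
  proof -
    have "(0, 0, axis j 1) \<in> (Basis :: (real \<times> (real^3) \<times> (real^3)) set)"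
      by (auto simp: Basis_prod_def axis_in_Basis_iff)
    from weak_deriv_linear[OF s oE this] show ?thesis
      by (simp add: s_def column_def mat_def axis_def if_distrib cong: if_cong)
  qed
  ultimately show ?thesis using conv unfolding F_def by blast
qed

end
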